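(* Let $c\in\mathbb{R}$ and let $M^7$ be a biconservative hypersurface in a space form $N^8(c)$ of constant sectional curvature $c$. Assume that $M$ has, at each point, three distinct principal curvatures of multiplicities $m_1=1$, $m_2=3$, $m_3=3$, and that $\operatorname{grad}f\neq 0$ at every point of $M$. Then the relation $$14|A|^2-245f^2-96c=0$$ cannot hold on any (non-empty) open subset of $M$.
   Context: All manifolds are assumed connected and oriented. $N^{m+1}(c)$ denotes an $(m+1)$-dimensional Riemannian manifold of constant sectional curvature $c$. For a hypersurface $M^m$ of $N^{m+1}(c)$ with unit normal field $\eta$, $A=A_\eta$ is the shape operator, the principal curvatures are the eigenvalues of $A$, $|A|^2$ is the sum of the squares of the principal curvatures counted with multiplicity, and $f=(\operatorname{trace}A)/m$ is the mean curvature function. A submanifold is called biconservative if the tangent part of the biharmonic equation $\tau_2=0$ (vanishing of the bitension field of the immersion) holds; for a hypersurface $M^m$ of $N^{m+1}(c)$ this means $2A(\operatorname{grad}f)+mf\operatorname{grad}f=0$. *)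

theory Defs
  imports "HOL-Analysis.Analysis"
begin

section \<open>Smooth functions on open subsets of Euclidean space\<close>

definition partial_deriv :: "'n::finite \<Rightarrow> (real^'n \<Rightarrow> 'b::real_normed_vector) \<Rightarrow> real^'n \<Rightarrow> 'b" where
  "partial_deriv i f x = frechet_derivative f (at x) (axis i 1)"

text \<open>Only meaningful for open \<open>U\<close>, since all derivatives are taken at \<open>at x\<close>.\<close>

primrec Ck_on :: "nat \<Rightarrow> (real^'n::finite \<Rightarrow> 'b::real_normed_vector) \<Rightarrow> (real^'n) set \<Rightarrow> bool" where
  "Ck_on 0 f U \<longleftrightarrow> continuous_on U f"
| "Ck_on (Suc k) f U \<longleftrightarrow> (\<forall>x\<in>U. f differentiable at x) \<and> (\<forall>i. Ck_on k (partial_deriv i f) U)"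

definition smooth_on :: "(real^'n::finite \<Rightarrow> 'b::real_normed_vector) \<Rightarrow> (real^'n) set \<Rightarrow> bool" where
  "smooth_on f U \<longleftrightarrow> (\<forall>k. Ck_on k f U)"


section \<open>Connected oriented Riemannian manifolds\<close>

text \<open>A smooth structure is given by an atlas (not necessarily maximal). Tensors are given by their
  components in each chart of the atlas: \<open>metric M c x\<close> is the Gram matrix of the coordinate vector
  fields of the chart \<open>c\<close> at the point with coordinates \<open>x\<close>.  The components of a tangent vector
  at \<open>p\<close> in a chart \<open>c\<close> around \<open>p\<close> form a vector of type \<open>real^'n\<close>.\<close>

record ('a, 'n::finite) chart =
  chart_dom :: "'a set"
  chart_map :: "'a \<Rightarrow> real^'n"

record ('a, 'n::finite) riem_manifold =
  mtop :: "'a topology"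
  atlas :: "('a, 'n) chart set"
  metric :: "('a, 'n) chart \<Rightarrow> real^'n \<Rightarrow> real^'n^'n"

definition chart_inv :: "('a, 'n::finite) chart \<Rightarrow> real^'n \<Rightarrow> 'a" where
  "chart_inv c = inv_into (chart_dom c) (chart_map c)"

definition chart_at :: "('a, 'n::finite) riem_manifold \<Rightarrow> 'a \<Rightarrow> ('a, 'n) chart" where
  "chart_at M p = (SOME c. c \<in> atlas M \<and> p \<in> chart_dom c)"

definition coord_rep ::
  "('a, 'm::finite) chart \<Rightarrow> ('b, 'n::finite) chart \<Rightarrow> ('a \<Rightarrow> 'b) \<Rightarrow> real^'m \<Rightarrow> real^'n" where
  "coord_rep a c \<phi> = chart_map c \<circ> \<phi> \<circ> chart_inv a"

definition jacobian :: "(real^'m::finite \<Rightarrow> real^'n::finite) \<Rightarrow> real^'m \<Rightarrow> real^'m^'n" where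
  "jacobian F x = matrix (frechet_derivative F (at x))"

definition topological_chart :: "'a topology \<Rightarrow> ('a, 'n::finite) chart \<Rightarrow> bool" where
  "topological_chart X c \<longleftrightarrow>
     openin X (chart_dom c) \<and> open (chart_map c ` chart_dom c) \<and>
     homeomorphic_map (subtopology X (chart_dom c)) (top_of_set (chart_map c ` chart_dom c)) (chart_map c)"

text \<open>The orientation is the one determined by the atlas, all of whose transition maps preserve
  orientation.\<close>

definition oriented_manifold :: "('a, 'n::finite) riem_manifold \<Rightarrow> bool" where
  "oriented_manifold M \<longleftrightarrow>
     Hausdorff_space (mtop M) \<and> second_countable (mtop M) \<and>
     (\<forall>c\<in>atlas M. topological_chart (mtop M) c) \<and>
     (\<Union>c\<in>atlas M. chart_dom c) = topspace (mtop M) \<and>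
     (\<forall>c\<in>atlas M. \<forall>d\<in>atlas M.
        smooth_on (coord_rep c d id) (chart_map c ` (chart_dom c \<inter> chart_dom d)) \<and>
        (\<forall>x \<in> chart_map c ` (chart_dom c \<inter> chart_dom d). det (jacobian (coord_rep c d id) x) > 0))"

definition riemannian_metric :: "('a, 'n::finite) riem_manifold \<Rightarrow> bool" where
  "riemannian_metric M \<longleftrightarrow>
     (\<forall>c\<in>atlas M.
        smooth_on (metric M c) (chart_map c ` chart_dom c) \<and>
        (\<forall>x \<in> chart_map c ` chart_dom c.
           transpose (metric M c x) = metric M c x \<and> (\<forall>v. v \<noteq> 0 \<longrightarrow> v \<bullet> (metric M c x *v v) > 0))) \<and>
     (\<forall>c\<in>atlas M. \<forall>d\<in>atlas M. \<forall>x \<in> chart_map c ` (chart_dom c \<inter> chart_dom d).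
        metric M c x =
          transpose (jacobian (coord_rep c d id) x) ** metric M d (coord_rep c d id x)
            ** jacobian (coord_rep c d id) x)"

definition connected_oriented_riemannian :: "('a, 'n::finite) riem_manifold \<Rightarrow> bool" where
  "connected_oriented_riemannian M \<longleftrightarrow>
     oriented_manifold M \<and> connected_space (mtop M) \<and> riemannian_metric M"

definition inner_at ::
  "('a, 'n::finite) riem_manifold \<Rightarrow> ('a, 'n) chart \<Rightarrow> real^'n \<Rightarrow> real^'n \<Rightarrow> real^'n \<Rightarrow> real" where
  "inner_at M c x u v = u \<bullet> (metric M c x *v v)"

definition gradient ::
  "('a, 'n::finite) riem_manifold \<Rightarrow> ('a, 'n) chart \<Rightarrow> ('a \<Rightarrow> real) \<Rightarrow> 'a \<Rightarrow> real^'n" where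
  "gradient M c f p =
     matrix_inv (metric M c (chart_map c p)) *v
       (\<chi> i. partial_deriv i (f \<circ> chart_inv c) (chart_map c p))"


section \<open>Levi-Civita connection and sectional curvature\<close>

text \<open>\<open>christoffel M c k i j x\<close> is $\Gamma^k_{ij}$, and \<open>curvature M c x u v w\<close> is
  $R(u,v)w = \nabla_u\nabla_v w - \nabla_v\nabla_u w - \nabla_{[u,v]}w$.\<close>

definition christoffel ::
  "('a, 'n::finite) riem_manifold \<Rightarrow> ('a, 'n) chart \<Rightarrow> 'n \<Rightarrow> 'n \<Rightarrow> 'n \<Rightarrow> real^'n \<Rightarrow> real" where
  "christoffel M c k i j x =
     1/2 * (\<Sum>l\<in>UNIV. matrix_inv (metric M c x) $ k $ l *
       (partial_deriv i (\<lambda>y. metric M c y $ j $ l) x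
        + partial_deriv j (\<lambda>y. metric M c y $ i $ l) x
        - partial_deriv l (\<lambda>y. metric M c y $ i $ j) x))"

definition curvature ::
  "('a, 'n::finite) riem_manifold \<Rightarrow> ('a, 'n) chart \<Rightarrow> real^'n \<Rightarrow> real^'n \<Rightarrow> real^'n \<Rightarrow> real^'n \<Rightarrow> real^'n" where
  "curvature M c x u v w =
     (\<chi> l. \<Sum>i\<in>UNIV. \<Sum>j\<in>UNIV. \<Sum>k\<in>UNIV. u $ i * v $ j * w $ k *
       (partial_deriv i (christoffel M c l j k) x - partial_deriv j (christoffel M c l i k) x
        + (\<Sum>s\<in>UNIV. christoffel M c l i s x * christoffel M c s j k x
                    - christoffel M c l j s x * christoffel M c s i k x)))"

definition sectional_curvature ::
  "('a, 'n::finite) riem_manifold \<Rightarrow> ('a, 'n) chart \<Rightarrow> real^'n \<Rightarrow> real^'n \<Rightarrow> real^'n \<Rightarrow> real" where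
  "sectional_curvature M c x u v =
     inner_at M c x (curvature M c x u v v) u /
       (inner_at M c x u u * inner_at M c x v v - (inner_at M c x u v)\<^sup>2)"

definition constant_sectional_curvature :: "('a, 'n::finite) riem_manifold \<Rightarrow> real \<Rightarrow> bool" where
  "constant_sectional_curvature M \<kappa> \<longleftrightarrow>
     (\<forall>c\<in>atlas M. \<forall>x \<in> chart_map c ` chart_dom c. \<forall>u v.
        u \<noteq> v \<and> independent {u, v} \<longrightarrow> sectional_curvature M c x u v = \<kappa>)"


section \<open>Isometric immersions of hypersurfaces\<close>

text \<open>The set of coordinates, in the chart \<open>a\<close>, on which \<open>coord_rep a c \<phi>\<close> represents \<open>\<phi>\<close>.\<close>

definition rep_dom ::
  "('a, 'm::finite) chart \<Rightarrow> ('b, 'n::finite) chart \<Rightarrow> ('a \<Rightarrow> 'b) \<Rightarrow> (real^'m) set" where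
  "rep_dom a c \<phi> = chart_map a ` {p \<in> chart_dom a. \<phi> p \<in> chart_dom c}"

definition differential_at ::
  "('a, 'm::finite) chart \<Rightarrow> ('b, 'n::finite) chart \<Rightarrow> ('a \<Rightarrow> 'b) \<Rightarrow> 'a \<Rightarrow> real^'m \<Rightarrow> real^'n" where
  "differential_at a c \<phi> p = frechet_derivative (coord_rep a c \<phi>) (at (chart_map a p))"

definition smooth_map ::
  "('a, 'm::finite) riem_manifold \<Rightarrow> ('b, 'n::finite) riem_manifold \<Rightarrow> ('a \<Rightarrow> 'b) \<Rightarrow> bool" where
  "smooth_map M N \<phi> \<longleftrightarrow>
     continuous_map (mtop M) (mtop N) \<phi> \<and>
     (\<forall>a\<in>atlas M. \<forall>c\<in>atlas N. smooth_on (coord_rep a c \<phi>) (rep_dom a c \<phi>))"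

definition isometric_immersion ::
  "('a, 'm::finite) riem_manifold \<Rightarrow> ('b, 'n::finite) riem_manifold \<Rightarrow> ('a \<Rightarrow> 'b) \<Rightarrow> bool" where
  "isometric_immersion M N \<phi> \<longleftrightarrow>
     smooth_map M N \<phi> \<and>
     (\<forall>a\<in>atlas M. \<forall>c\<in>atlas N. \<forall>p\<in>chart_dom a. \<phi> p \<in> chart_dom c \<longrightarrow>
        inj (differential_at a c \<phi> p) \<and>
        (\<forall>u v. inner_at N c (chart_map c (\<phi> p)) (differential_at a c \<phi> p u) (differential_at a c \<phi> p v)
               = inner_at M a (chart_map a p) u v))"

text \<open>A vector field along \<open>\<phi>\<close>: \<open>\<eta> c p\<close> are the components of $\eta_p\in T_{\varphi(p)}N$ in the
  chart \<open>c\<close> of \<open>N\<close>.\<close>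

definition vector_field_along ::
  "('a, 'm::finite) riem_manifold \<Rightarrow> ('b, 'n::finite) riem_manifold \<Rightarrow> ('a \<Rightarrow> 'b)
     \<Rightarrow> (('b, 'n) chart \<Rightarrow> 'a \<Rightarrow> real^'n) \<Rightarrow> bool" where
  "vector_field_along M N \<phi> \<eta> \<longleftrightarrow>
     (\<forall>a\<in>atlas M. \<forall>c\<in>atlas N. smooth_on (\<eta> c \<circ> chart_inv a) (rep_dom a c \<phi>)) \<and>
     (\<forall>p\<in>topspace (mtop M). \<forall>c\<in>atlas N. \<forall>d\<in>atlas N.
        \<phi> p \<in> chart_dom c \<inter> chart_dom d \<longrightarrow>
        \<eta> d p = jacobian (coord_rep c d id) (chart_map c (\<phi> p)) *v \<eta> c p)"

definition unit_normal_field ::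
  "('a, 'm::finite) riem_manifold \<Rightarrow> ('b, 'n::finite) riem_manifold \<Rightarrow> ('a \<Rightarrow> 'b)
     \<Rightarrow> (('b, 'n) chart \<Rightarrow> 'a \<Rightarrow> real^'n) \<Rightarrow> bool" where
  "unit_normal_field M N \<phi> \<eta> \<longleftrightarrow>
     vector_field_along M N \<phi> \<eta> \<and>
     (\<forall>a\<in>atlas M. \<forall>c\<in>atlas N. \<forall>p\<in>chart_dom a. \<phi> p \<in> chart_dom c \<longrightarrow>
        inner_at N c (chart_map c (\<phi> p)) (\<eta> c p) (\<eta> c p) = 1 \<and>
        (\<forall>u. inner_at N c (chart_map c (\<phi> p)) (\<eta> c p) (differential_at a c \<phi> p u) = 0))"

text \<open>The components, in the chart \<open>c\<close> of \<open>N\<close>, of the derivative of \<open>\<eta>\<close> in the direction \<open>u\<close> with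
  respect to the pull-back of the Levi-Civita connection of \<open>N\<close>.\<close>

definition covariant_deriv_along ::
  "('b, 'n::finite) riem_manifold \<Rightarrow> ('a \<Rightarrow> 'b) \<Rightarrow> (('b, 'n) chart \<Rightarrow> 'a \<Rightarrow> real^'n)
     \<Rightarrow> ('a, 'm::finite) chart \<Rightarrow> ('b, 'n) chart \<Rightarrow> 'a \<Rightarrow> real^'m \<Rightarrow> real^'n" where
  "covariant_deriv_along N \<phi> \<eta> a c p u =
     frechet_derivative (\<eta> c \<circ> chart_inv a) (at (chart_map a p)) u +
     (\<chi> k. \<Sum>i\<in>UNIV. \<Sum>j\<in>UNIV.
        christoffel N c k i j (chart_map c (\<phi> p)) * differential_at a c \<phi> p u $ i * \<eta> c p $ j)"

text \<open>The matrix of the shape operator in the chart \<open>a\<close>, defined by the Weingarten formula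
  $d\varphi(A u) = -\overline\nabla_u\eta$.  Both sides are vectors tangent to \<open>N\<close>, so the choice of
  \<open>c\<close> does not matter.\<close>

definition shape_operator ::
  "('a, 'm::finite) riem_manifold \<Rightarrow> ('b, 'n::finite) riem_manifold \<Rightarrow> ('a \<Rightarrow> 'b)
     \<Rightarrow> (('b, 'n) chart \<Rightarrow> 'a \<Rightarrow> real^'n) \<Rightarrow> ('a, 'm) chart \<Rightarrow> 'a \<Rightarrow> real^'m^'m" where
  "shape_operator M N \<phi> \<eta> a p =
     (THE A. \<forall>c\<in>atlas N. \<phi> p \<in> chart_dom c \<longrightarrow>
        (\<forall>u. differential_at a c \<phi> p (A *v u) = - covariant_deriv_along N \<phi> \<eta> a c p u))"

text \<open>The eigenvalues, the dimensions of the eigenspaces and the trace of the shape operator do not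
  depend on the chart in which its matrix is taken.  As the shape operator is self-adjoint for the
  metric of \<open>M\<close>, the geometric and algebraic multiplicities coincide.\<close>

definition principal_curvatures ::
  "('a, 'm::finite) riem_manifold \<Rightarrow> ('b, 'n::finite) riem_manifold \<Rightarrow> ('a \<Rightarrow> 'b)
     \<Rightarrow> (('b, 'n) chart \<Rightarrow> 'a \<Rightarrow> real^'n) \<Rightarrow> 'a \<Rightarrow> real set" where
  "principal_curvatures M N \<phi> \<eta> p =
     {\<mu>. \<exists>v. v \<noteq> 0 \<and> shape_operator M N \<phi> \<eta> (chart_at M p) p *v v = \<mu> *\<^sub>R v}"

definition curvature_multiplicity ::
  "('a, 'm::finite) riem_manifold \<Rightarrow> ('b, 'n::finite) riem_manifold \<Rightarrow> ('a \<Rightarrow> 'b)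
     \<Rightarrow> (('b, 'n) chart \<Rightarrow> 'a \<Rightarrow> real^'n) \<Rightarrow> 'a \<Rightarrow> real \<Rightarrow> nat" where
  "curvature_multiplicity M N \<phi> \<eta> p \<mu> =
     dim {v. shape_operator M N \<phi> \<eta> (chart_at M p) p *v v = \<mu> *\<^sub>R v}"

definition shape_norm_sq ::
  "('a, 'm::finite) riem_manifold \<Rightarrow> ('b, 'n::finite) riem_manifold \<Rightarrow> ('a \<Rightarrow> 'b)
     \<Rightarrow> (('b, 'n) chart \<Rightarrow> 'a \<Rightarrow> real^'n) \<Rightarrow> 'a \<Rightarrow> real" where
  "shape_norm_sq M N \<phi> \<eta> p =
     (\<Sum>\<mu>\<in>principal_curvatures M N \<phi> \<eta> p. real (curvature_multiplicity M N \<phi> \<eta> p \<mu>) * \<mu>\<^sup>2)"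

definition mean_curvature ::
  "('a, 'm::finite) riem_manifold \<Rightarrow> ('b, 'n::finite) riem_manifold \<Rightarrow> ('a \<Rightarrow> 'b)
     \<Rightarrow> (('b, 'n) chart \<Rightarrow> 'a \<Rightarrow> real^'n) \<Rightarrow> 'a \<Rightarrow> real" where
  "mean_curvature M N \<phi> \<eta> p = trace (shape_operator M N \<phi> \<eta> (chart_at M p) p) / real CARD('m)"

text \<open>Biconservativity of a hypersurface of a space of constant curvature:
  $2A(\mathrm{grad} f) + m f\,\mathrm{grad} f = 0$.\<close>

definition biconservative ::
  "('a, 'm::finite) riem_manifold \<Rightarrow> ('b, 'n::finite) riem_manifold \<Rightarrow> ('a \<Rightarrow> 'b)
     \<Rightarrow> (('b, 'n) chart \<Rightarrow> 'a \<Rightarrow> real^'n) \<Rightarrow> bool" where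
  "biconservative M N \<phi> \<eta> \<longleftrightarrow>
     (\<forall>a\<in>atlas M. \<forall>p\<in>chart_dom a.
        2 *\<^sub>R (shape_operator M N \<phi> \<eta> a p *v gradient M a (mean_curvature M N \<phi> \<eta>) p)
        + (real CARD('m) * mean_curvature M N \<phi> \<eta> p) *\<^sub>R gradient M a (mean_curvature M N \<phi> \<eta>) p = 0)"

end

theory Submission imports Defs begin

text \<open>Suppose that the relation holds on an open set, let \<open>s = 7f/2\<close> and let \<open>\<xi>\<close> be the gradient of \<open>s\<close>.
  Biconservativity says that \<open>\<xi>\<close> is a principal direction with principal curvature \<open>-s\<close>.

  The principal curvature \<open>-s\<close> is the simple one.  If it were triple on an open set, the Codazzi equation
  would make it constant along \<open>\<xi>\<close>, although its derivative there is \<open>-|\<xi>|\<^sup>2\<close>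
  (\<open>double_principal_curvature_impossible\<close>).  The points at which it is triple do form an open set, because
  at the other points the shape operator satisfies a quadratic identity (\<open>quadratic_at\<close>), a closed
  condition that fails wherever \<open>-s\<close> is triple (\<open>quadratic_at_not_double\<close>).

  The trace then shows that the other two principal curvatures \<open>\<lambda>\<close> and \<open>\<mu>\<close> add up to \<open>s\<close>, and the relation
  becomes \<open>\<lambda>\<mu> = (3s\<^sup>2 - 8c)/7\<close>: all principal curvatures are functions of \<open>s\<close> alone.  Differentiating the
  quadratic identity along \<open>\<xi>\<close> determines the Hessian of \<open>s\<close> orthogonally to \<open>\<xi>\<close>.  It preserves the three
  eigenspaces, and on those of \<open>\<lambda>\<close> and \<open>\<mu>\<close> it is a multiple of the identity: \<open>N = |\<xi>|\<^sup>2\<close> times an explicit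
  function of \<open>s\<close> (\<open>hessian_eigen\<close>).  Since the Hessian is a combination of the identity, the shape operator and
  \<open>ds \<otimes> ds\<close> with scalar coefficients, the Ricci identity for \<open>\<xi>\<close> turns into one Riccati equation
  along \<open>\<xi>\<close> for each of the two multiples (\<open>riccati\<close>).

  These two equations are linear in \<open>N\<close> and in the eigenvalue \<open>h\<close> of the Hessian on \<open>\<xi>\<close>.  Eliminating \<open>h\<close>
  gives \<open>N T(s) + Z(s) = 0\<close> with polynomials \<open>T\<close> and \<open>Z\<close> (\<open>gradient_norm_equations\<close>), and the
  derivative of this along \<open>\<xi>\<close> is a third linear equation.  The three are compatible only where \<open>s\<close> is a
  root of a certain nonzero polynomial (\<open>elimination_polynomial\<close>, \<open>finite_elimination_roots\<close>).
  So \<open>s\<close> takes finitely many values, is locally constant, and has zero gradient, a contradiction.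

  The computations use the ambient connection pulled back along the immersion \<open>F\<close>, acting on the fields
  \<open>dF(u)\<close> and \<open>dF(Au)\<close> for constant coordinate vectors \<open>u\<close>, so that eigenvectors are
  needed at single points only.  What has to be known about the ambient space is the Ricci
  identity with the curvature tensor of constant curvature \<open>c\<close>; the Weingarten formula in every
  chart rests on the naturality of the Levi-Civita connection.\<close>

section \<open>Calculus of smooth functions\<close>

definition dir_deriv :: "'a::real_normed_vector \<Rightarrow> ('a \<Rightarrow> 'b::real_normed_vector) \<Rightarrow> 'a \<Rightarrow> 'b" where
  "dir_deriv u f x = frechet_derivative f (at x) u"

lemma dir_deriv_eqI: "(f has_derivative f') (at x) \<Longrightarrow> dir_deriv u f x = f' u"
  unfolding dir_deriv_def using frechet_derivative_at by metis

lemma has_derivative_dir_deriv: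
  "f differentiable (at x) \<Longrightarrow> (f has_derivative (\<lambda>u. dir_deriv u f x)) (at x)"
  unfolding dir_deriv_def using frechet_derivative_works by blast

lemma partial_deriv_eq_dir_deriv: "partial_deriv i = dir_deriv (axis i 1)"
  by (auto simp: fun_eq_iff partial_deriv_def dir_deriv_def)

lemma dir_deriv_cong:
  assumes "open U" "x \<in> U" "\<And>y. y \<in> U \<Longrightarrow> f y = g y"
  shows "dir_deriv u f x = dir_deriv u g x"
proof (cases "f differentiable at x")
  case True
  then show ?thesis unfolding dir_deriv_def
    using frechet_derivative_transform_within_open[OF True assms(1,2)] assms(3) by metis
next
  case False
  then have "\<not> g differentiable at x"
    using assms by (metis differentiable_def has_derivative_transform_within_open)
  with False have "(f has_derivative h) (at x) \<longleftrightarrow> (g has_derivative h) (at x)" for h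
    by (auto simp: differentiable_def)
  then show ?thesis by (simp add: dir_deriv_def frechet_derivative_def)
qed

lemma dir_deriv_linear:
  assumes "f differentiable at x"
  shows "dir_deriv (u + v) f x = dir_deriv u f x + dir_deriv v f x"
    and "dir_deriv (r *\<^sub>R u) f x = r *\<^sub>R dir_deriv u f x"
    and "dir_deriv 0 f x = 0"
    and "dir_deriv (- u) f x = - dir_deriv u f x"
    and "dir_deriv (u - v) f x = dir_deriv u f x - dir_deriv v f x"
  using linear_frechet_derivative[OF assms]
  by (simp_all add: dir_deriv_def linear_add linear_scale linear_0 linear_neg linear_diff)

lemma dir_deriv_const [simp]: "dir_deriv u (\<lambda>x. a) x = 0"
  by (simp add: dir_deriv_def)

lemma dir_deriv_rules:
  fixes a b :: "real^'n::finite \<Rightarrow> real"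
  assumes "a differentiable at x" "b differentiable at x"
  shows "dir_deriv u (\<lambda>y. a y + b y) x = dir_deriv u a x + dir_deriv u b x"
    "dir_deriv u (\<lambda>y. a y - b y) x = dir_deriv u a x - dir_deriv u b x"
    "dir_deriv u (\<lambda>y. a y * b y) x = a x * dir_deriv u b x + dir_deriv u a x * b x"
    "dir_deriv u (\<lambda>y. k * a y) x = k * dir_deriv u a x"
    "dir_deriv u (\<lambda>y. - a y) x = - dir_deriv u a x"
proof -
  note d = assms[THEN has_derivative_dir_deriv]
  show "dir_deriv u (\<lambda>y. a y + b y) x = dir_deriv u a x + dir_deriv u b x"
    by (rule dir_deriv_eqI[OF has_derivative_add[OF d]])
  show "dir_deriv u (\<lambda>y. a y - b y) x = dir_deriv u a x - dir_deriv u b x"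
    by (rule dir_deriv_eqI[OF has_derivative_diff[OF d]])
  show "dir_deriv u (\<lambda>y. a y * b y) x = a x * dir_deriv u b x + dir_deriv u a x * b x"
    by (rule dir_deriv_eqI[OF has_derivative_mult[OF d]])
  show "dir_deriv u (\<lambda>y. k * a y) x = k * dir_deriv u a x"
    by (rule dir_deriv_eqI[OF has_derivative_mult_right[OF d(1)]])
  show "dir_deriv u (\<lambda>y. - a y) x = - dir_deriv u a x"
    by (rule dir_deriv_eqI[OF has_derivative_minus[OF d(1)]])
qed

lemma dir_deriv_expand:
  fixes f :: "real^'n::finite \<Rightarrow> 'b::real_normed_vector"
  assumes "f differentiable at x"
  shows "dir_deriv u f x = (\<Sum>i\<in>UNIV. (u $ i) *\<^sub>R dir_deriv (axis i 1) f x)"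
proof -
  have "u = (\<Sum>i\<in>UNIV. (u $ i) *\<^sub>R axis i 1)"
    using basis_expansion[of u] by (simp add: scalar_mult_eq_scaleR)
  then have "dir_deriv u f x = frechet_derivative f (at x) (\<Sum>i\<in>UNIV. (u $ i) *\<^sub>R axis i 1)"
    by (simp add: dir_deriv_def)
  also have "\<dots> = (\<Sum>i\<in>UNIV. (u $ i) *\<^sub>R dir_deriv (axis i 1) f x)"
    using linear_frechet_derivative[OF assms]
    by (simp add: linear_sum linear_scale dir_deriv_def)
  finally show ?thesis .
qed

text \<open>The set must be open: a partial derivative at a point of \<open>U\<close> depends on the values nearby.\<close>

lemma Ck_on_cong:
  assumes "open U" "\<And>x. x \<in> U \<Longrightarrow> f x = g x" "Ck_on k f U"
  shows "Ck_on k g U"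
  using assms(2,3)
proof (induction k arbitrary: f g)
  case 0
  then show ?case using continuous_on_cong[of U U f g] by simp
next
  case (Suc k)
  have "g differentiable at x" if "x \<in> U" for x
    using Suc.prems that assms(1) unfolding differentiable_def Ck_on.simps
    by (meson has_derivative_transform_within_open)
  moreover have "partial_deriv i f x = partial_deriv i g x" if "x \<in> U" for x i
    unfolding partial_deriv_eq_dir_deriv using dir_deriv_cong[OF assms(1) that] Suc.prems(1) by blast
  then have "Ck_on k (partial_deriv i g) U" for i
    using Suc.IH[of "partial_deriv i f" "partial_deriv i g"] Suc.prems(2) by simp
  ultimately show ?case by simp
qed

lemma Ck_on_Suc_D: "Ck_on (Suc k) f U \<Longrightarrow> Ck_on k f U"
proof (induction k arbitrary: f)
  case 0
  then show ?case
    by (auto intro: continuous_at_imp_continuous_on differentiable_imp_continuous_within)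
next
  case (Suc k)
  then show ?case by (metis Ck_on.simps(2))
qed

lemma Ck_on_subset: "Ck_on k f U \<Longrightarrow> V \<subseteq> U \<Longrightarrow> Ck_on k f V"
  by (induction k arbitrary: f) (auto intro: continuous_on_subset)

lemma Ck_on_const: "Ck_on k (\<lambda>x::real^'a::finite. a) U"
proof (induction k arbitrary: a)
  case (Suc k)
  have "partial_deriv i (\<lambda>x. a) = (\<lambda>x. 0)" for i :: 'a by (auto simp: partial_deriv_def)
  with Suc show ?case by simp
qed simp

lemma Ck_on_add:
  assumes "open U" "Ck_on k f U" "Ck_on k g U"
  shows "Ck_on k (\<lambda>x. f x + g x) U"
  using assms(2,3)
proof (induction k arbitrary: f g)
  case 0
  then show ?case by (auto intro: continuous_intros)
next
  case (Suc k)
  have eq: "partial_deriv i f x + partial_deriv i g x = partial_deriv i (\<lambda>x. f x + g x) x"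
    if "x \<in> U" for i x
    unfolding partial_deriv_eq_dir_deriv
    apply (subst dir_deriv_eqI[of "\<lambda>x. f x + g x"])
     apply (rule has_derivative_add[OF has_derivative_dir_deriv has_derivative_dir_deriv])
    using Suc.prems that by auto
  have "Ck_on k (partial_deriv i (\<lambda>x. f x + g x)) U" for i
    by (rule Ck_on_cong[OF assms(1) eq Suc.IH]) (use Suc.prems in auto)
  with Suc.prems show ?case by auto
qed

lemma Ck_on_sum:
  assumes "open U" "\<And>i. i \<in> I \<Longrightarrow> Ck_on k (f i) U"
  shows "Ck_on k (\<lambda>x. \<Sum>i\<in>I. f i x) U"
  using assms(2)
proof (induction I rule: infinite_finite_induct)
  case (insert i I)
  have "Ck_on k (\<lambda>x. f i x + (\<Sum>i\<in>I. f i x)) U"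
    by (rule Ck_on_add[OF assms(1)]) (use insert in auto)
  with insert show ?case by simp
qed (simp_all add: Ck_on_const)

text \<open>By the product rule the partial derivatives are sums of two products of functions that are one
  order less smooth, so that induction on the order applies.  The same scheme proves the rules for
  compositions and reciprocals.\<close>

lemma Ck_on_bilinear:
  assumes "bounded_bilinear B" "open U" "Ck_on k f U" "Ck_on k g U"
  shows "Ck_on k (\<lambda>x. B (f x) (g x)) U"
  using assms(3,4)
proof (induction k arbitrary: f g)
  case 0
  then show ?case by (simp add: bounded_bilinear.continuous_on[OF assms(1)])
next
  case (Suc k)
  have der: "((\<lambda>x. B (f x) (g x)) has_derivative
      (\<lambda>u. B (f x) (dir_deriv u g x) + B (dir_deriv u f x) (g x))) (at x)" if "x \<in> U" for x
    by (rule bounded_bilinear.FDERIV[OF assms(1) has_derivative_dir_deriv has_derivative_dir_deriv])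
      (use Suc.prems that in auto)
  have "Ck_on k (partial_deriv i (\<lambda>x. B (f x) (g x))) U" for i
    apply (rule Ck_on_cong[OF assms(2), of
          "\<lambda>x. B (f x) (partial_deriv i g x) + B (partial_deriv i f x) (g x)"])
    unfolding partial_deriv_eq_dir_deriv
     apply (simp add: dir_deriv_eqI[OF der])
    apply (rule Ck_on_add[OF assms(2) Suc.IH Suc.IH])
    using Suc.prems Ck_on_Suc_D[OF Suc.prems(1)] Ck_on_Suc_D[OF Suc.prems(2)]
    by (auto simp: partial_deriv_eq_dir_deriv)
  moreover have "(\<lambda>x. B (f x) (g x)) differentiable at x" if "x \<in> U" for x
    using der[OF that] by (auto simp: differentiable_def)
  ultimately show ?case by simp
qed

lemma Ck_on_linear:
  assumes "bounded_linear L" "open U" "Ck_on k f U"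
  shows "Ck_on k (\<lambda>x. L (f x)) U"
  using assms(3)
proof (induction k arbitrary: f)
  case 0
  then show ?case by (simp add: bounded_linear.continuous_on[OF assms(1)])
next
  case (Suc k)
  have der: "((\<lambda>x. L (f x)) has_derivative (\<lambda>u. L (dir_deriv u f x))) (at x)" if "x \<in> U" for x
    by (rule bounded_linear.has_derivative[OF assms(1) has_derivative_dir_deriv])
      (use Suc.prems that in auto)
  have "Ck_on k (partial_deriv i (\<lambda>x. L (f x))) U" for i
    apply (rule Ck_on_cong[OF assms(2), of "\<lambda>x. L (partial_deriv i f x)"])
    unfolding partial_deriv_eq_dir_deriv
     apply (simp add: dir_deriv_eqI[OF der])
    apply (rule Suc.IH)
    using Suc.prems by (auto simp: partial_deriv_eq_dir_deriv)
  moreover have "(\<lambda>x. L (f x)) differentiable at x" if "x \<in> U" for x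
    using der[OF that] by (auto simp: differentiable_def)
  ultimately show ?case by simp
qed

lemma has_derivative_compose_dir_deriv:
  assumes "F differentiable at x" "g differentiable at (F x)"
  shows "((\<lambda>x. g (F x)) has_derivative (\<lambda>u. dir_deriv (dir_deriv u F x) g (F x))) (at x)"
  using has_derivative_compose[OF has_derivative_dir_deriv[OF assms(1)] has_derivative_dir_deriv[OF assms(2)]] .

lemma Ck_on_compose:
  fixes F :: "real^'m::finite \<Rightarrow> real^'n::finite"
  assumes "open U" "F ` U \<subseteq> V" "Ck_on k F U" "Ck_on k g V"
  shows "Ck_on k (\<lambda>x. g (F x)) U"
  using assms(3,4)
proof (induction k arbitrary: g)
  case 0
  then show ?case using assms(2) by (auto intro: continuous_on_compose2)
next
  case (Suc k)
  have der: "((\<lambda>x. g (F x)) has_derivative (\<lambda>u. dir_deriv (dir_deriv u F x) g (F x))) (at x)"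
    if "x \<in> U" for x
    by (rule has_derivative_compose_dir_deriv) (use Suc.prems that assms(2) in auto)
  have "Ck_on k (partial_deriv i (\<lambda>x. g (F x))) U" for i
  proof (rule Ck_on_cong[OF assms(1)])
    show "(\<Sum>j\<in>UNIV. (partial_deriv i F x $ j) *\<^sub>R partial_deriv j g (F x)) =
        partial_deriv i (\<lambda>x. g (F x)) x" if "x \<in> U" for x
      unfolding partial_deriv_eq_dir_deriv dir_deriv_eqI[OF der[OF that]]
      by (rule dir_deriv_expand[symmetric]) (use Suc.prems that assms(2) in auto)
    show "Ck_on k (\<lambda>x. \<Sum>j\<in>UNIV. (partial_deriv i F x $ j) *\<^sub>R partial_deriv j g (F x)) U"
      by (rule Ck_on_sum[OF assms(1)], rule Ck_on_bilinear[OF bounded_bilinear_scaleR assms(1)],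
          rule Ck_on_linear[OF bounded_linear_vec_nth assms(1)], use Suc.prems in simp,
          rule Suc.IH) (use Suc.prems Ck_on_Suc_D[OF Suc.prems(1)] in auto)
  qed
  moreover have "(\<lambda>x. g (F x)) differentiable at x" if "x \<in> U" for x
    using der[OF that] by (auto simp: differentiable_def)
  ultimately show ?case by simp
qed

lemma Ck_on_inverse:
  fixes f :: "real^'n::finite \<Rightarrow> real"
  assumes "open U" "\<And>x. x \<in> U \<Longrightarrow> f x \<noteq> 0" "Ck_on k f U"
  shows "Ck_on k (\<lambda>x. inverse (f x)) U"
  using assms(3)
proof (induction k)
  case 0
  then show ?case using assms(2) by (auto intro: continuous_intros)
next
  case (Suc k)
  have der: "((\<lambda>x. inverse (f x)) has_derivative
      (\<lambda>u. - (inverse (f x) * dir_deriv u f x * inverse (f x)))) (at x)" if "x \<in> U" for x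
    by (rule Deriv.has_derivative_inverse[OF _ has_derivative_dir_deriv])
      (use Suc.prems that assms(2) in auto)
  note mult = Ck_on_bilinear[OF bounded_bilinear_mult assms(1)]
  note IH = Suc.IH[OF Ck_on_Suc_D[OF Suc.prems]]
  have "Ck_on k (partial_deriv i (\<lambda>x. inverse (f x))) U" for i
    apply (rule Ck_on_cong[OF assms(1), of "\<lambda>x. - (inverse (f x) * partial_deriv i f x * inverse (f x))"])
     apply (simp add: partial_deriv_eq_dir_deriv dir_deriv_eqI[OF der])
    apply (rule Ck_on_linear[OF bounded_linear_minus[OF bounded_linear_ident] assms(1)])
    by (intro mult IH) (use Suc.prems in auto)
  moreover have "(\<lambda>x. inverse (f x)) differentiable at x" if "x \<in> U" for x
    using der[OF that] by (auto simp: differentiable_def)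
  ultimately show ?case by simp
qed

lemma smooth_on_cong: "open U \<Longrightarrow> (\<And>x. x \<in> U \<Longrightarrow> f x = g x) \<Longrightarrow> smooth_on f U \<Longrightarrow> smooth_on g U"
  unfolding smooth_on_def using Ck_on_cong by metis

lemma smooth_on_subset: "smooth_on f U \<Longrightarrow> V \<subseteq> U \<Longrightarrow> smooth_on f V"
  unfolding smooth_on_def using Ck_on_subset by metis

lemma smooth_on_const: "smooth_on (\<lambda>x. a) U"
  unfolding smooth_on_def using Ck_on_const by metis

lemma smooth_on_add: "open U \<Longrightarrow> smooth_on f U \<Longrightarrow> smooth_on g U \<Longrightarrow> smooth_on (\<lambda>x. f x + g x) U"
  unfolding smooth_on_def using Ck_on_add by metis

lemma smooth_on_sum: "open U \<Longrightarrow> (\<And>i. i \<in> I \<Longrightarrow> smooth_on (f i) U) \<Longrightarrow> smooth_on (\<lambda>x. \<Sum>i\<in>I. f i x) U"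
  unfolding smooth_on_def using Ck_on_sum by metis

lemma smooth_on_linear: "bounded_linear L \<Longrightarrow> open U \<Longrightarrow> smooth_on f U \<Longrightarrow> smooth_on (\<lambda>x. L (f x)) U"
  unfolding smooth_on_def using Ck_on_linear by metis

lemma smooth_on_bilinear:
  "bounded_bilinear B \<Longrightarrow> open U \<Longrightarrow> smooth_on f U \<Longrightarrow> smooth_on g U \<Longrightarrow> smooth_on (\<lambda>x. B (f x) (g x)) U"
  unfolding smooth_on_def using Ck_on_bilinear by metis

lemma smooth_on_compose:
  fixes F :: "real^'m::finite \<Rightarrow> real^'n::finite"
  shows "open U \<Longrightarrow> F ` U \<subseteq> V \<Longrightarrow> smooth_on F U \<Longrightarrow> smooth_on g V \<Longrightarrow> smooth_on (\<lambda>x. g (F x)) U"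
  unfolding smooth_on_def using Ck_on_compose by metis

lemma smooth_on_inverse:
  fixes f :: "real^'n::finite \<Rightarrow> real"
  shows "open U \<Longrightarrow> (\<And>x. x \<in> U \<Longrightarrow> f x \<noteq> 0) \<Longrightarrow> smooth_on f U \<Longrightarrow> smooth_on (\<lambda>x. inverse (f x)) U"
  unfolding smooth_on_def using Ck_on_inverse by metis

lemmas smooth_on_mult = smooth_on_bilinear[OF bounded_bilinear_mult]
lemmas smooth_on_scaleR = smooth_on_bilinear[OF bounded_bilinear_scaleR]
lemmas smooth_on_inner = smooth_on_bilinear[OF bounded_bilinear_inner]
lemmas smooth_on_minus = smooth_on_linear[OF bounded_linear_minus[OF bounded_linear_ident]]
lemmas smooth_on_vec_nth = smooth_on_linear[OF bounded_linear_vec_nth]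

lemma smooth_on_diff: "open U \<Longrightarrow> smooth_on f U \<Longrightarrow> smooth_on g U \<Longrightarrow> smooth_on (\<lambda>x. f x - g x) U"
  using smooth_on_add[of U f "\<lambda>x. - g x"] smooth_on_minus[of U g] by simp

lemma smooth_on_divide:
  fixes f g :: "real^'n::finite \<Rightarrow> real"
  shows "open U \<Longrightarrow> smooth_on f U \<Longrightarrow> smooth_on g U \<Longrightarrow> (\<And>x. x \<in> U \<Longrightarrow> g x \<noteq> 0)
    \<Longrightarrow> smooth_on (\<lambda>x. f x / g x) U"
  unfolding divide_inverse by (intro smooth_on_mult smooth_on_inverse) auto

lemma smooth_on_prod:
  fixes f :: "'i \<Rightarrow> real^'n::finite \<Rightarrow> real"
  shows "open U \<Longrightarrow> (\<And>i. i \<in> I \<Longrightarrow> smooth_on (f i) U) \<Longrightarrow> smooth_on (\<lambda>x. \<Prod>i\<in>I. f i x) U"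
proof (induction I rule: infinite_finite_induct)
  case (insert i I)
  have "smooth_on (\<lambda>x. f i x * (\<Prod>i\<in>I. f i x)) U"
    by (rule smooth_on_mult) (use insert in auto)
  with insert show ?case by simp
qed (simp_all add: smooth_on_const)

lemma smooth_on_componentwise:
  fixes f :: "real^'m::finite \<Rightarrow> ('b::euclidean_space)^'n::finite"
  assumes "open U" "\<And>i. smooth_on (\<lambda>x. f x $ i) U"
  shows "smooth_on f U"
proof -
  have bl: "bounded_linear (axis i :: 'b \<Rightarrow> 'b^'n)" for i
    by (rule linear_conv_bounded_linear[THEN iffD1]) (auto intro!: linearI simp: vec_eq_iff axis_def)
  have "smooth_on (\<lambda>x. \<Sum>i\<in>UNIV. axis i (f x $ i)) U"
    by (intro smooth_on_sum smooth_on_linear[OF bl] assms)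
  moreover have "(\<Sum>i\<in>UNIV. axis i (f x $ i)) = f x" for x
    by (simp add: vec_eq_iff axis_def if_distrib cong: if_cong)
  ultimately show ?thesis by simp
qed

lemma smooth_on_differentiable: "smooth_on f U \<Longrightarrow> x \<in> U \<Longrightarrow> f differentiable at x"
  unfolding smooth_on_def by (metis Ck_on.simps(2))

lemma smooth_on_has_derivative:
  "smooth_on f U \<Longrightarrow> x \<in> U \<Longrightarrow> (f has_derivative (\<lambda>u. dir_deriv u f x)) (at x)"
  by (intro has_derivative_dir_deriv smooth_on_differentiable)

lemma smooth_on_continuous_on: "smooth_on f U \<Longrightarrow> continuous_on U f"
  unfolding smooth_on_def by (metis Ck_on.simps(1))

lemma smooth_on_dir_deriv:
  assumes "open U" "smooth_on f U"
  shows "smooth_on (dir_deriv u f) U"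
proof (rule smooth_on_cong[OF assms(1)])
  show "(\<Sum>i\<in>UNIV. (u $ i) *\<^sub>R partial_deriv i f x) = dir_deriv u f x" if "x \<in> U" for x
    using dir_deriv_expand[OF smooth_on_differentiable[OF assms(2) that], of u]
    by (simp add: partial_deriv_eq_dir_deriv)
  have "smooth_on (partial_deriv i f) U" for i
    using assms(2) by (auto simp: smooth_on_def intro: Ck_on.simps(2)[THEN iffD1, THEN conjunct2, rule_format])
  then show "smooth_on (\<lambda>x. \<Sum>i\<in>UNIV. (u $ i) *\<^sub>R partial_deriv i f x) U"
    by (intro smooth_on_sum smooth_on_scaleR smooth_on_const assms)
qed

lemma dir_deriv_field_expand:
  assumes "smooth_on f U" "x \<in> U"
  shows "dir_deriv u f x = (\<Sum>i\<in>UNIV. (u $ i) *\<^sub>R dir_deriv (axis i 1) f x)"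
  using dir_deriv_expand smooth_on_differentiable assms by blast

lemma smooth_on_dir_deriv_field:
  assumes "open U" "smooth_on f U" "smooth_on v U"
  shows "smooth_on (\<lambda>x. dir_deriv (v x) f x) U"
  by (rule smooth_on_cong[OF assms(1) dir_deriv_field_expand[OF assms(2), symmetric]])
    (auto intro!: smooth_on_sum smooth_on_scaleR smooth_on_vec_nth smooth_on_dir_deriv assms)

lemmas smooth_on_intros = smooth_on_const smooth_on_add smooth_on_diff smooth_on_minus smooth_on_mult
  smooth_on_scaleR smooth_on_inner smooth_on_vec_nth smooth_on_sum smooth_on_dir_deriv
  smooth_on_dir_deriv_field

lemma smooth_on_det:
  fixes A :: "real^'m::finite \<Rightarrow> real^'n::finite^'n"
  assumes "open U" "\<And>i j. smooth_on (\<lambda>x. A x $ i $ j) U"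
  shows "smooth_on (\<lambda>x. det (A x)) U"
  unfolding det_def by (intro smooth_on_sum smooth_on_mult smooth_on_const smooth_on_prod assms)

lemma matrix_inv_mult:
  fixes A :: "real^'n::finite^'n"
  assumes "invertible A"
  shows "A ** matrix_inv A = mat 1" "matrix_inv A ** A = mat 1"
  using someI_ex[OF assms[unfolded invertible_def]] unfolding matrix_inv_def by auto

lemma matrix_inv_cramer:
  fixes A :: "real^'n::finite^'n"
  assumes "det A \<noteq> 0"
  shows "matrix_inv A $ k $ l = det (\<chi> i j. if j = k then axis l 1 $ i else A $ i $ j) / det A"
proof -
  have "A ** matrix_inv A = mat 1"
    using assms invertible_det_nz matrix_inv_mult by blast
  then have "A *v (matrix_inv A *v axis l 1) = axis l 1"
    by (simp add: matrix_vector_mul_assoc)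
  then have "matrix_inv A *v axis l 1 =
      (\<chi> k. det (\<chi> i j. if j = k then axis l 1 $ i else A $ i $ j) / det A)"
    using cramer[OF assms] by blast
  from arg_cong[OF this, of "\<lambda>v. v $ k"]
  have "(matrix_inv A *v axis l 1) $ k = det (\<chi> i j. if j = k then axis l 1 $ i else A $ i $ j) / det A"
    by simp
  then show ?thesis by (simp add: matrix_vector_mult_basis column_def)
qed

text \<open>By Cramer's rule the entries of the inverse are quotients of polynomials in the entries.\<close>

lemma smooth_on_matrix_inv:
  fixes A :: "real^'m::finite \<Rightarrow> real^'n::finite^'n"
  assumes U: "open U" and A: "smooth_on A U" and inv: "\<And>x. x \<in> U \<Longrightarrow> invertible (A x)"
  shows "smooth_on (\<lambda>x. matrix_inv (A x)) U"
proof -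
  have d: "det (A x) \<noteq> 0" if "x \<in> U" for x using inv[OF that] invertible_det_nz by blast
  have A2: "smooth_on (\<lambda>x. A x $ i $ j) U" for i j by (intro smooth_on_vec_nth U A)
  have "smooth_on (\<lambda>x. matrix_inv (A x) $ k $ l) U" for k l
  proof (rule smooth_on_cong[OF U])
    show "det (\<chi> i j. if j = k then axis l 1 $ i else A x $ i $ j) / det (A x) = matrix_inv (A x) $ k $ l"
      if "x \<in> U" for x using matrix_inv_cramer[OF d[OF that]] by simp
    show "smooth_on (\<lambda>x. det (\<chi> i j. if j = k then axis l 1 $ i else A x $ i $ j) / det (A x)) U"
    proof (intro smooth_on_divide smooth_on_det U A2 d)
      show "smooth_on (\<lambda>x. (\<chi> i j. if j = k then axis l 1 $ i else A x $ i $ j) $ i $ j) U" for i j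
        by (cases "j = k") (auto intro: smooth_on_const A2)
    qed
  qed
  then show ?thesis by (intro smooth_on_componentwise U)
qed

subsection \<open>Symmetry of second derivatives\<close>

text \<open>The left-hand side is symmetric in \<open>u\<close> and \<open>v\<close>, so it also equals \<open>t\<^sup>2\<close> times the other mixed
  derivative at a nearby point; this makes the two mixed derivatives agree in the limit \<open>t \<rightarrow> 0\<close>.\<close>

lemma mixed_difference_mean_value:
  fixes f :: "real^'n::finite \<Rightarrow> real"
  assumes U: "open U" and f: "smooth_on f U" and "t > 0"
    and seg: "\<And>a b. 0 \<le> a \<Longrightarrow> a \<le> t \<Longrightarrow> 0 \<le> b \<Longrightarrow> b \<le> t \<Longrightarrow> x + a *\<^sub>R u + b *\<^sub>R v \<in> U"
  shows "\<exists>a b. 0 < a \<and> a < t \<and> 0 < b \<and> b < t \<and>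
    f (x + t *\<^sub>R u + t *\<^sub>R v) - f (x + t *\<^sub>R u) - f (x + t *\<^sub>R v) + f x
     = t * t * dir_deriv v (dir_deriv u f) (x + a *\<^sub>R u + b *\<^sub>R v)"
proof -
  define \<phi> where "\<phi> a = f (x + a *\<^sub>R u + t *\<^sub>R v) - f (x + a *\<^sub>R u)" for a
  have df: "((\<lambda>a. f (x + a *\<^sub>R u + b *\<^sub>R v)) has_real_derivative dir_deriv u f (x + a *\<^sub>R u + b *\<^sub>R v)) (at a)"
    if "0 \<le> a" "a \<le> t" "0 \<le> b" "b \<le> t" for a b
  proof -
    have d: "f differentiable at (x + a *\<^sub>R u + b *\<^sub>R v)"
      using smooth_on_differentiable[OF f seg] that by auto
    have "((\<lambda>a. f (x + a *\<^sub>R u + b *\<^sub>R v)) has_derivative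
        (\<lambda>r. dir_deriv (r *\<^sub>R u) f (x + a *\<^sub>R u + b *\<^sub>R v))) (at a)"
      by (rule has_derivative_compose[of "\<lambda>a. x + a *\<^sub>R u + b *\<^sub>R v", OF _ has_derivative_dir_deriv[OF d]])
        (auto intro!: derivative_eq_intros)
    then show ?thesis
      unfolding has_field_derivative_def dir_deriv_linear(2)[OF d] by (simp add: mult_commute_abs)
  qed
  have "\<exists>a. 0 < a \<and> a < t \<and> \<phi> t - \<phi> 0 = (t - 0) *
      (dir_deriv u f (x + a *\<^sub>R u + t *\<^sub>R v) - dir_deriv u f (x + a *\<^sub>R u))"
  proof (rule MVT2[OF \<open>t > 0\<close>])
    fix a assume a: "0 \<le> a" "a \<le> t"
    show "(\<phi> has_real_derivative (dir_deriv u f (x + a *\<^sub>R u + t *\<^sub>R v) - dir_deriv u f (x + a *\<^sub>R u))) (at a)"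
      unfolding \<phi>_def using df[OF a, of t] df[OF a, of 0] \<open>t > 0\<close>
      by (intro DERIV_diff) auto
  qed
  then obtain a where a: "0 < a" "a < t" and *: "\<phi> t - \<phi> 0 = t *
      (dir_deriv u f (x + a *\<^sub>R u + t *\<^sub>R v) - dir_deriv u f (x + a *\<^sub>R u))" by auto
  have "\<exists>b. 0 < b \<and> b < t \<and> dir_deriv u f (x + a *\<^sub>R u + t *\<^sub>R v) - dir_deriv u f (x + a *\<^sub>R u + 0 *\<^sub>R v) =
      (t - 0) * dir_deriv v (dir_deriv u f) (x + a *\<^sub>R u + b *\<^sub>R v)"
  proof (rule MVT2[OF \<open>t > 0\<close>])
    fix b assume b: "0 \<le> b" "b \<le> t"
    have d: "dir_deriv u f differentiable at (x + a *\<^sub>R u + b *\<^sub>R v)"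
      using smooth_on_differentiable[OF smooth_on_dir_deriv[OF U f] seg] a b by auto
    have "((\<lambda>b. dir_deriv u f (x + a *\<^sub>R u + b *\<^sub>R v)) has_derivative
        (\<lambda>r. dir_deriv (r *\<^sub>R v) (dir_deriv u f) (x + a *\<^sub>R u + b *\<^sub>R v))) (at b)"
      by (rule has_derivative_compose[of "\<lambda>b. x + a *\<^sub>R u + b *\<^sub>R v", OF _ has_derivative_dir_deriv[OF d]])
        (auto intro!: derivative_eq_intros)
    then show "((\<lambda>b. dir_deriv u f (x + a *\<^sub>R u + b *\<^sub>R v)) has_real_derivative
        dir_deriv v (dir_deriv u f) (x + a *\<^sub>R u + b *\<^sub>R v)) (at b)"
      unfolding has_field_derivative_def dir_deriv_linear(2)[OF d] by (simp add: mult_commute_abs)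
  qed
  then obtain b where "0 < b" "b < t" "dir_deriv u f (x + a *\<^sub>R u + t *\<^sub>R v) - dir_deriv u f (x + a *\<^sub>R u) =
      t * dir_deriv v (dir_deriv u f) (x + a *\<^sub>R u + b *\<^sub>R v)" by auto
  with a * show ?thesis by (intro exI[of _ a] exI[of _ b]) (auto simp: \<phi>_def)
qed

lemma dir_deriv_commute_real:
  fixes f :: "real^'n::finite \<Rightarrow> real"
  assumes U: "open U" and f: "smooth_on f U" and x: "x \<in> U"
  shows "dir_deriv u (dir_deriv v f) x = dir_deriv v (dir_deriv u f) x"
proof (rule ccontr)
  define A where "A = dir_deriv u (dir_deriv v f)"
  define B where "B = dir_deriv v (dir_deriv u f)"
  assume "\<not> ?thesis"
  then have ne: "A x \<noteq> B x" by (simp add: A_def B_def)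
  define e where "e = \<bar>A x - B x\<bar> / 2"
  have "e > 0" using ne by (simp add: e_def)
  have "continuous_on U A" "continuous_on U B"
    unfolding A_def B_def by (intro smooth_on_continuous_on smooth_on_dir_deriv U f)+
  then obtain dA dB where d: "dA > 0" "dB > 0"
    "\<And>y. dist y x < dA \<Longrightarrow> y \<in> U \<Longrightarrow> dist (A y) (A x) < e"
    "\<And>y. dist y x < dB \<Longrightarrow> y \<in> U \<Longrightarrow> dist (B y) (B x) < e"
    unfolding continuous_on_iff using x \<open>e > 0\<close> by metis
  obtain dU where dU: "dU > 0" "ball x dU \<subseteq> U" using U x open_contains_ball by blast
  define m where "m = min dU (min dA dB)"
  have "m > 0" using d dU by (simp add: m_def)
  define t where "t = m / (2 * (norm u + norm v + 1))"
  have t: "t > 0" using \<open>m > 0\<close> by (simp add: t_def add_nonneg_pos)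
  have near: "dist (x + a *\<^sub>R u + b *\<^sub>R v) x < m" if "0 \<le> a" "a \<le> t" "0 \<le> b" "b \<le> t" for a b
  proof -
    have "dist (x + a *\<^sub>R u + b *\<^sub>R v) x = norm (a *\<^sub>R u + b *\<^sub>R v)" by (simp add: dist_norm)
    also have "\<dots> \<le> a * norm u + b * norm v"
      using norm_triangle_ineq[of "a *\<^sub>R u" "b *\<^sub>R v"] that by simp
    also have "\<dots> \<le> t * norm u + t * norm v" using that by (intro add_mono mult_right_mono) auto
    also have "\<dots> \<le> t * (norm u + norm v + 1)" using t by (simp add: algebra_simps)
    also have "\<dots> = m / 2"
    proof -
      have "norm u + norm v + 1 > 0" by (simp add: add_nonneg_pos)
      then show ?thesis unfolding t_def by (auto simp: divide_simps)
    qed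
    finally show ?thesis using \<open>m > 0\<close> by simp
  qed
  have inU: "x + a *\<^sub>R u + b *\<^sub>R v \<in> U" if "0 \<le> a" "a \<le> t" "0 \<le> b" "b \<le> t" for a b
    using near[OF that] dU by (auto simp: m_def dist_commute)
  obtain a b where ab: "0 < a" "a < t" "0 < b" "b < t"
    and 1: "f (x + t *\<^sub>R u + t *\<^sub>R v) - f (x + t *\<^sub>R u) - f (x + t *\<^sub>R v) + f x
      = t * t * B (x + a *\<^sub>R u + b *\<^sub>R v)"
    using mixed_difference_mean_value[OF U f t, of x u v] inU unfolding B_def by auto
  have inU': "x + a *\<^sub>R v + b *\<^sub>R u \<in> U" if "0 \<le> a" "a \<le> t" "0 \<le> b" "b \<le> t" for a b
    using inU[of b a] that by (simp add: add.assoc add.commute[of "a *\<^sub>R v"])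
  obtain a' b' where ab': "0 < a'" "a' < t" "0 < b'" "b' < t"
    and 2: "f (x + t *\<^sub>R v + t *\<^sub>R u) - f (x + t *\<^sub>R v) - f (x + t *\<^sub>R u) + f x
      = t * t * A (x + a' *\<^sub>R v + b' *\<^sub>R u)"
    using mixed_difference_mean_value[OF U f t, of x v u] inU' unfolding A_def by auto
  have eq: "A (x + b' *\<^sub>R u + a' *\<^sub>R v) = B (x + a *\<^sub>R u + b *\<^sub>R v)"
    using 1 2 t by (simp add: algebra_simps)
  have "dist (A (x + b' *\<^sub>R u + a' *\<^sub>R v)) (A x) < e"
    using near[of b' a'] inU[of b' a'] ab' d(3) by (auto simp: m_def)
  moreover have "dist (B (x + a *\<^sub>R u + b *\<^sub>R v)) (B x) < e"
    using near[of a b] inU[of a b] ab d(4) by (auto simp: m_def)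
  ultimately have "dist (A x) (B x) < 2 * e" unfolding eq by (simp add: dist_real_def)
  then show False by (simp add: e_def dist_real_def)
qed

lemma dir_deriv_vec_nth:
  "f differentiable at x \<Longrightarrow> dir_deriv u (\<lambda>y. f y $ i) x = dir_deriv u f x $ i"
  by (rule dir_deriv_eqI) (rule bounded_linear.has_derivative[OF bounded_linear_vec_nth has_derivative_dir_deriv])

lemma dir_deriv_nth2:
  fixes G :: "real^'n::finite \<Rightarrow> real^'n^'n"
  assumes "G differentiable at x"
  shows "dir_deriv u (\<lambda>y. G y $ i $ j) x = dir_deriv u G x $ i $ j"
proof -
  have "(\<lambda>y. G y $ i) differentiable at x"
    using bounded_linear.has_derivative[OF bounded_linear_vec_nth has_derivative_dir_deriv[OF assms]]
    unfolding differentiable_def by blast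
  from dir_deriv_vec_nth[OF this] dir_deriv_vec_nth[OF assms] show ?thesis by metis
qed

lemma dir_deriv_commute:
  fixes f :: "real^'m::finite \<Rightarrow> real^'n::finite"
  assumes U: "open U" and f: "smooth_on f U" and x: "x \<in> U"
  shows "dir_deriv u (dir_deriv v f) x = dir_deriv v (dir_deriv u f) x"
proof -
  have *: "dir_deriv u (dir_deriv v f) x $ i = dir_deriv u (dir_deriv v (\<lambda>y. f y $ i)) x" for i u v
  proof -
    have "dir_deriv u (dir_deriv v f) x $ i = dir_deriv u (\<lambda>y. dir_deriv v f y $ i) x"
      by (rule dir_deriv_vec_nth[symmetric])
        (rule smooth_on_differentiable[OF smooth_on_dir_deriv[OF U f] x])
    also have "\<dots> = dir_deriv u (dir_deriv v (\<lambda>y. f y $ i)) x"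
      by (rule dir_deriv_cong[OF U x])
        (rule dir_deriv_vec_nth[symmetric], rule smooth_on_differentiable[OF f])
    finally show ?thesis .
  qed
  show ?thesis
    unfolding vec_eq_iff *
    using dir_deriv_commute_real[OF U smooth_on_vec_nth[OF U f] x] by blast
qed

text \<open>The chain rule for the field \<open>dF(X)\<close> along \<open>\<Phi>\<close>, when the vector \<open>X\<close> varies together with the point:
  expand \<open>X\<close> in coordinate vectors and use the symmetry of the second derivative of \<open>F\<close>.\<close>

lemma has_derivative_dir_deriv_along:
  fixes F :: "real^'n::finite \<Rightarrow> real^'k::finite" and \<Phi> :: "real^'m::finite \<Rightarrow> real^'n"
  assumes V: "open V" and F: "smooth_on F V" and U: "open U" "x \<in> U" "\<Phi> ` U \<subseteq> V"
    and \<Phi>: "\<Phi> differentiable at x" and X: "X differentiable at x"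
  shows "((\<lambda>y. dir_deriv (X y) F (\<Phi> y)) has_derivative
    (\<lambda>u. dir_deriv (dir_deriv u \<Phi> x) (dir_deriv (X x) F) (\<Phi> x) + dir_deriv (dir_deriv u X x) F (\<Phi> x))) (at x)"
proof -
  have V': "\<Phi> y \<in> V" if "y \<in> U" for y using U that by auto
  have d: "((\<lambda>y. dir_deriv (axis j 1) F (\<Phi> y)) has_derivative
      (\<lambda>u. dir_deriv (dir_deriv u \<Phi> x) (dir_deriv (axis j 1) F) (\<Phi> x))) (at x)" for j
    by (rule has_derivative_compose_dir_deriv[OF \<Phi> smooth_on_differentiable[OF smooth_on_dir_deriv[OF V F] V'[OF U(2)]]])
  have X': "((\<lambda>y. X y $ j) has_derivative (\<lambda>u. dir_deriv u X x $ j)) (at x)" for j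
    by (rule bounded_linear.has_derivative[OF bounded_linear_vec_nth has_derivative_dir_deriv[OF X]])
  have ex: "dir_deriv a F (\<Phi> y) = (\<Sum>j\<in>UNIV. (a $ j) *\<^sub>R dir_deriv (axis j 1) F (\<Phi> y))" if "y \<in> U" for a y
    by (rule dir_deriv_field_expand[OF F V'[OF that]])
  have "((\<lambda>y. \<Sum>j\<in>UNIV. (X y $ j) *\<^sub>R dir_deriv (axis j 1) F (\<Phi> y)) has_derivative
      (\<lambda>u. \<Sum>j\<in>UNIV. (X x $ j) *\<^sub>R dir_deriv (dir_deriv u \<Phi> x) (dir_deriv (axis j 1) F) (\<Phi> x)
        + (dir_deriv u X x $ j) *\<^sub>R dir_deriv (axis j 1) F (\<Phi> x))) (at x)"
    by (rule has_derivative_sum, rule has_derivative_scaleR[OF X' d])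
  moreover have "(\<Sum>j\<in>UNIV. (X x $ j) *\<^sub>R dir_deriv w (dir_deriv (axis j 1) F) (\<Phi> x))
      = dir_deriv w (dir_deriv (X x) F) (\<Phi> x)" for w
  proof -
    have "dir_deriv w (dir_deriv (X x) F) (\<Phi> x) = dir_deriv (X x) (dir_deriv w F) (\<Phi> x)"
      by (rule dir_deriv_commute[OF V F V'[OF U(2)]])
    also have "\<dots> = (\<Sum>j\<in>UNIV. (X x $ j) *\<^sub>R dir_deriv (axis j 1) (dir_deriv w F) (\<Phi> x))"
      by (rule dir_deriv_field_expand[OF smooth_on_dir_deriv[OF V F] V'[OF U(2)]])
    finally show ?thesis
      using dir_deriv_commute[OF V F V'[OF U(2)], of w] by simp
  qed
  ultimately have "((\<lambda>y. \<Sum>j\<in>UNIV. (X y $ j) *\<^sub>R dir_deriv (axis j 1) F (\<Phi> y)) has_derivative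
    (\<lambda>u. dir_deriv (dir_deriv u \<Phi> x) (dir_deriv (X x) F) (\<Phi> x) + dir_deriv (dir_deriv u X x) F (\<Phi> x))) (at x)"
    by (simp add: sum.distrib ex[OF U(2), symmetric])
  then show ?thesis
    by (rule has_derivative_transform_within_open[OF _ U(1,2)]) (simp add: ex)
qed

section \<open>Eigenspaces\<close>

text \<open>In a multiple eigenspace this finds an eigenvector orthogonal to the gradient.\<close>

lemma exists_kernel_vector:
  fixes W :: "'a::euclidean_space set" and f :: "'a \<Rightarrow> real"
  assumes W: "subspace W" "dim W \<ge> 2" and f: "linear f"
  shows "\<exists>u\<in>W. u \<noteq> 0 \<and> f u = 0"
proof -
  have "\<not> W \<subseteq> {0}"
  proof
    assume "W \<subseteq> {0}"
    then have "dim W = 0" by (simp only: dim_eq_0)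
    then show False using W(2) by linarith
  qed
  then obtain a where a: "a \<in> W" "a \<noteq> 0" by blast
  have "\<not> W \<subseteq> span {a}"
  proof
    assume "W \<subseteq> span {a}"
    then have "dim W \<le> dim {a}" using dim_subset dim_span by metis
    also have "\<dots> \<le> 1" using dim_le_card'[of "{a}"] by simp
    finally show False using W(2) by simp
  qed
  then obtain b where b: "b \<in> W" "b \<notin> span {a}" by blast
  show ?thesis
  proof (cases "f a = 0")
    case True
    then show ?thesis using a by blast
  next
    case False
    define u where "u = b - (f b / f a) *\<^sub>R a"
    have "u \<in> W" unfolding u_def using a b W(1) by (intro subspace_diff subspace_scale)
    moreover have "u \<noteq> 0"
      using b(2) span_scale[OF span_base, of a "{a}"] by (metis eq_iff_diff_eq_0 insertI1 u_def)
    moreover have "f u = 0" using False by (simp add: u_def linear_diff[OF f] linear_scale[OF f])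
    ultimately show ?thesis by blast
  qed
qed

definition eigspace :: "real^'m::finite^'m \<Rightarrow> real \<Rightarrow> (real^'m) set" where
  "eigspace M \<mu> = {v. M *v v = \<mu> *\<^sub>R v}"

lemma subspace_eigspace: "subspace (eigspace M \<mu>)"
  by (rule subspaceI) (auto simp: eigspace_def matrix_vector_right_distrib matrix_vector_mult_scaleR scaleR_add_right)

lemma eigspace_nonzero: "dim (eigspace M \<mu>) > 0 \<Longrightarrow> \<exists>v. v \<noteq> 0 \<and> M *v v = \<mu> *\<^sub>R v"
proof -
  assume "dim (eigspace M \<mu>) > 0"
  then have "\<not> eigspace M \<mu> \<subseteq> {0}" by (metis dim_eq_0 less_numeral_extra(3))
  then show ?thesis by (auto simp: eigspace_def)
qed

text \<open>Eigenspaces of distinct eigenvalues are independent.  When their dimensions add up to that of the whole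
  space, bases of the three together form a basis, in which the matrix is diagonal.\<close>

lemma eigspace_decomposition:
  fixes M :: "real^'m::finite^'m" and a b d :: real
  assumes distinct: "a \<noteq> b" "a \<noteq> d" "b \<noteq> d"
    and dims: "dim (eigspace M a) + dim (eigspace M b) + dim (eigspace M d) = CARD('m)"
  shows "\<exists>v1 v2 v3. v = v1 + v2 + v3 \<and> M *v v1 = a *\<^sub>R v1 \<and> M *v v2 = b *\<^sub>R v2 \<and> M *v v3 = d *\<^sub>R v3"
    and "trace M = dim (eigspace M a) * a + dim (eigspace M b) * b + dim (eigspace M d) * d"
proof -
  let ?W = "eigspace M"
  let ?W2 = "{x + y |x y. x \<in> ?W a \<and> y \<in> ?W b}"
  let ?W3 = "{x + y |x y. x \<in> ?W2 \<and> y \<in> ?W d}"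
  have s2: "subspace ?W2" and s3: "subspace ?W3"
    by (intro subspace_sums subspace_eigspace)+
  have "?W a \<inter> ?W b \<subseteq> {0}" using distinct(1) by (auto simp: eigspace_def)
  then have i2: "dim (?W a \<inter> ?W b) = 0" using dim_eq_0 by blast
  have "?W2 \<inter> ?W d \<subseteq> {0}"
  proof
    fix z assume z: "z \<in> ?W2 \<inter> ?W d"
    then obtain x y where xy: "z = x + y" "M *v x = a *\<^sub>R x" "M *v y = b *\<^sub>R y" and d: "M *v z = d *\<^sub>R z"
      by (auto simp: eigspace_def)
    have 1: "(a - d) *\<^sub>R x + (b - d) *\<^sub>R y = 0"
      using d unfolding xy(1) matrix_vector_right_distrib xy(2,3) by (simp add: algebra_simps)
    have "M *v ((a - d) *\<^sub>R x + (b - d) *\<^sub>R y) = (a - d) *\<^sub>R (a *\<^sub>R x) + (b - d) *\<^sub>R (b *\<^sub>R y)"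
      by (simp only: matrix_vector_right_distrib matrix_vector_mult_scaleR xy)
    then have 2: "(a - d) *\<^sub>R (a *\<^sub>R x) + (b - d) *\<^sub>R (b *\<^sub>R y) = 0"
      unfolding 1 by simp
    have "(a - d) *\<^sub>R ((a - b) *\<^sub>R x) = ((a - d) *\<^sub>R (a *\<^sub>R x) + (b - d) *\<^sub>R (b *\<^sub>R y)) - b *\<^sub>R ((a - d) *\<^sub>R x + (b - d) *\<^sub>R y)"
      by (simp add: algebra_simps)
    then have "x = 0" unfolding 1 2 using distinct by simp
    then have "y = 0" using 1 distinct by simp
    then show "z \<in> {0}" using xy \<open>x = 0\<close> by simp
  qed
  then have i3: "dim (?W2 \<inter> ?W d) = 0" using dim_eq_0 by blast
  have "dim ?W3 = CARD('m)"
    using dim_sums_Int[OF subspace_eigspace subspace_eigspace, of M a M b] i2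
      dim_sums_Int[OF s2 subspace_eigspace, of M d] i3 dims by simp
  then have "span ?W3 = UNIV" by (simp add: dim_eq_full[symmetric])
  moreover have "span ?W3 = ?W3" using s3 by (simp only: span_eq_iff)
  ultimately have full: "?W3 = UNIV" by (simp only:)
  then show "\<exists>v1 v2 v3. v = v1 + v2 + v3 \<and> M *v v1 = a *\<^sub>R v1 \<and> M *v v2 = b *\<^sub>R v2 \<and> M *v v3 = d *\<^sub>R v3" for v
  proof -
    have "v \<in> ?W3" unfolding full by simp
    then show ?thesis unfolding eigspace_def mem_Collect_eq by blast
  qed
  have "\<exists>B. B \<subseteq> ?W e \<and> independent B \<and> ?W e \<subseteq> span B \<and> card B = dim (?W e)" for e
    using basis_exists[of "?W e"] by metis
  then obtain B where B: "\<And>e. B e \<subseteq> ?W e" "\<And>e. independent (B e)" "\<And>e. ?W e \<subseteq> span (B e)" "\<And>e. card (B e) = dim (?W e)"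
    by metis
  have fin: "finite (B e)" for e by (rule independent_imp_finite[OF B(2)])
  let ?B = "B a \<union> B b \<union> B d"
  have sp: "span ?B = UNIV"
  proof -
    have "x + y + z \<in> span ?B" if "x \<in> ?W a" "y \<in> ?W b" "z \<in> ?W d" for x y z
    proof -
      have "span (B a) \<subseteq> span ?B" "span (B b) \<subseteq> span ?B" "span (B d) \<subseteq> span ?B"
        by (intro span_mono; blast)+
      then show ?thesis using that B(3)[of a] B(3)[of b] B(3)[of d] by (intro span_add) blast+
    qed
    then have "?W3 \<subseteq> span ?B" by blast
    then show ?thesis unfolding full by blast
  qed
  have disj: "B e \<inter> B e' = {}" if "e \<noteq> e'" for e e'
  proof -
    have "v = 0" if "v \<in> B e \<inter> B e'" for v
    proof -
      have "M *v v = e *\<^sub>R v" "M *v v = e' *\<^sub>R v"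
        using that B(1)[of e] B(1)[of e'] by (auto simp: eigspace_def)
      then show ?thesis using \<open>e \<noteq> e'\<close> by (metis scaleR_cancel_right)
    qed
    then show ?thesis using dependent_zero B(2)[of e] by auto
  qed
  have card: "card ?B = CARD('m)"
    using disj distinct fin B(4) dims by (subst card_Un_disjoint; (subst card_Un_disjoint)?) auto
  obtain h where h: "bij_betw h (UNIV :: 'm set) ?B"
    using finite_same_card_bij[of "UNIV :: 'm set" ?B] fin card by auto
  define P where "P = (\<chi> i j. h j $ i)"
  have colP: "column j P = h j" for j by (simp add: P_def column_def vec_eq_iff)
  have "columns P = ?B" using h by (auto simp: columns_def colP bij_betw_def)
  then obtain Q where Q: "P ** Q = mat 1" using matrix_right_invertible_span_columns[of P] sp by (auto simp: span_vec_eq)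
  then have QP: "Q ** P = mat 1" by (simp add: matrix_left_right_inverse)
  define \<nu> where "\<nu> v = (if v \<in> B a then a else if v \<in> B b then b else d)" for v
  have Mh: "M *v h j = \<nu> (h j) *\<^sub>R h j" for j
  proof -
    have "h j \<in> ?B" using h by (auto simp: bij_betw_def)
    then show ?thesis using B(1)[of a] B(1)[of b] B(1)[of d] by (auto simp: \<nu>_def eigspace_def)
  qed
  have "trace M = trace ((M ** P) ** Q)" by (simp add: matrix_mul_assoc[symmetric] Q)
  also have "\<dots> = trace (Q ** (M ** P))" by (rule trace_mul_sym)
  also have "\<dots> = (\<Sum>j\<in>UNIV. \<nu> (h j))"
    unfolding trace_def
  proof (rule sum.cong[OF refl])
    fix j :: 'm
    have ax: "(X *v axis j 1) $ j = X $ j $ j" for X :: "real^'m^'m"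
      by (simp add: matrix_vector_mult_basis column_def)
    have "(Q ** (M ** P)) $ j $ j = (Q *v (M *v (P *v axis j 1))) $ j"
      by (simp add: ax[symmetric] matrix_vector_mul_assoc del: matrix_vector_mult_basis)
    also have "P *v axis j 1 = h j" by (simp add: matrix_vector_mult_basis colP)
    also have "(Q *v (M *v h j)) $ j = \<nu> (h j) * (Q *v (P *v axis j 1)) $ j"
      by (simp add: Mh matrix_vector_mult_scaleR matrix_vector_mult_basis colP)
    also have "Q *v (P *v axis j 1) = axis j 1" by (simp add: matrix_vector_mul_assoc QP)
    finally show "(Q ** (M ** P)) $ j $ j = \<nu> (h j)" by simp
  qed
  also have "\<dots> = (\<Sum>v\<in>?B. \<nu> v)" using sum.reindex_bij_betw[OF h] by simp
  also have "\<dots> = (\<Sum>v\<in>B a. \<nu> v) + (\<Sum>v\<in>B b. \<nu> v) + (\<Sum>v\<in>B d. \<nu> v)"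
    using disj distinct fin by (subst sum.union_disjoint; (subst sum.union_disjoint)?) auto
  also have "(\<Sum>v\<in>B a. \<nu> v) = dim (?W a) * a" by (simp add: \<nu>_def B(4))
  also have "(\<Sum>v\<in>B b. \<nu> v) = (\<Sum>v\<in>B b. b)"
    using disj[OF distinct(1)] by (intro sum.cong) (auto simp: \<nu>_def)
  also have "(\<Sum>v\<in>B d. \<nu> v) = (\<Sum>v\<in>B d. d)"
    using disj[OF distinct(2)] disj[OF distinct(3)] by (intro sum.cong) (auto simp: \<nu>_def)
  finally show "trace M = dim (?W a) * a + dim (?W b) * b + dim (?W d) * d"
    by (simp add: B(4))
qed

section \<open>The Levi-Civita connection of a metric in coordinates\<close>

definition ip :: "real^'n::finite^'n \<Rightarrow> real^'n \<Rightarrow> real^'n \<Rightarrow> real" where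
  "ip g u v = u \<bullet> (g *v v)"

lemma bounded_bilinear_matrix_vector_mult:
  "bounded_bilinear (\<lambda>(A::real^'n::finite^'m::finite) v. A *v v)"
  unfolding bilinear_conv_bounded_bilinear[symmetric] bilinear_def
  by (auto intro!: linearI simp: matrix_vector_mult_add_rdistrib matrix_vector_right_distrib
      scaleR_matrix_vector_assoc matrix_vector_mult_scaleR)

lemma ip_simps [simp]:
  "ip g (u + u') v = ip g u v + ip g u' v"
  "ip g u (v + v') = ip g u v + ip g u v'"
  "ip g (u - u') v = ip g u v - ip g u' v"
  "ip g u (v - v') = ip g u v - ip g u v'"
  "ip g (- u) v = - ip g u v"
  "ip g u (- v) = - ip g u v"
  "ip g (r *\<^sub>R u) v = r * ip g u v"
  "ip g u (r *\<^sub>R v) = r * ip g u v"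
  "ip g 0 v = 0"
  "ip g u 0 = 0"
  by (simp_all add: ip_def inner_add_left inner_diff_left inner_add_right inner_diff_right
      matrix_vector_right_distrib matrix_vector_mult_diff_distrib matrix_vector_mult_scaleR
      matrix_vector_mult_0_right linear_neg[OF matrix_vector_mul_linear])

lemma ip_axis: "ip g (axis i 1) (axis j 1) = g $ i $ j"
  by (simp add: ip_def matrix_vector_mult_basis column_def inner_axis_axis inner_axis' )

lemma has_derivative_ip:
  assumes "(g has_derivative g') (at x)" "(X has_derivative X') (at x)" "(Y has_derivative Y') (at x)"
  shows "((\<lambda>x. ip (g x) (X x) (Y x)) has_derivative
    (\<lambda>u. ip (g' u) (X x) (Y x) + ip (g x) (X' u) (Y x) + ip (g x) (X x) (Y' u))) (at x)"
  unfolding ip_def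
  by (rule has_derivative_eq_rhs[OF bounded_bilinear.FDERIV[OF bounded_bilinear_inner assms(2)
        bounded_bilinear.FDERIV[OF bounded_bilinear_matrix_vector_mult assms(1,3)]]])
    (simp add: fun_eq_iff inner_add_right algebra_simps)

lemma smooth_on_ip:
  "open U \<Longrightarrow> smooth_on g U \<Longrightarrow> smooth_on X U \<Longrightarrow> smooth_on Y U \<Longrightarrow> smooth_on (\<lambda>x. ip (g x) (X x) (Y x)) U"
  unfolding ip_def
  by (intro smooth_on_inner smooth_on_bilinear[OF bounded_bilinear_matrix_vector_mult])

lemma linear_expand_axis:
  fixes L :: "real^'n::finite \<Rightarrow> 'b::real_vector"
  assumes "linear L"
  shows "L u = (\<Sum>i\<in>UNIV. (u $ i) *\<^sub>R L (axis i 1))"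
proof -
  have "L u = L (\<Sum>i\<in>UNIV. (u $ i) *\<^sub>R axis i 1)"
    using basis_expansion[of u] by (simp add: scalar_mult_eq_scaleR)
  then show ?thesis by (simp add: linear_sum[OF assms] linear_scale[OF assms])
qed

lemma bilinear_expand_axis:
  fixes B :: "real^'n::finite \<Rightarrow> real^'n \<Rightarrow> 'b::real_vector"
  assumes "bilinear B"
  shows "B a b = (\<Sum>i\<in>UNIV. \<Sum>j\<in>UNIV. (a $ i * b $ j) *\<^sub>R B (axis i 1) (axis j 1))"
  using assms unfolding bilinear_def
  by (subst linear_expand_axis[of "\<lambda>a. B a b"], blast)
    (simp add: scaleR_sum_right[symmetric] scaleR_scaleR[symmetric]
      linear_expand_axis[of "B _" b, symmetric] del: scaleR_scaleR)

text \<open>The Leibniz rule for a bilinear map that itself depends on the point \<open>F x\<close>.  For the Christoffel map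
  the first summand is the source of the curvature tensor.\<close>

lemma has_derivative_bilinear_family:
  fixes L :: "real^'n::finite \<Rightarrow> real^'n \<Rightarrow> real^'n \<Rightarrow> real^'n"
  assumes lin: "\<And>y. y \<in> V \<Longrightarrow> bilinear (L y)"
    and smooth: "\<And>a b. smooth_on (\<lambda>y. L y a b) V"
    and V: "open V" and F: "F differentiable at x" and maps: "open U" "x \<in> U" "F ` U \<subseteq> V"
    and X: "X differentiable at x" and Y: "Y differentiable at x"
  shows "((\<lambda>x. L (F x) (X x) (Y x)) has_derivative (\<lambda>u.
    dir_deriv (dir_deriv u F x) (\<lambda>y. L y (X x) (Y x)) (F x)
      + L (F x) (dir_deriv u X x) (Y x) + L (F x) (X x) (dir_deriv u Y x))) (at x)"
proof -
  have ex: "L y a b = (\<Sum>i\<in>UNIV. \<Sum>j\<in>UNIV. (a $ i * b $ j) *\<^sub>R L y (axis i 1) (axis j 1))"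
    if "y \<in> V" for y a b
    by (rule bilinear_expand_axis[OF lin[OF that]])
  have FxV: "F x \<in> V" using maps by auto
  define D where "D i j u = dir_deriv (dir_deriv u F x) (\<lambda>y. L y (axis i 1) (axis j 1)) (F x)" for i j u
  have dL: "((\<lambda>x. L (F x) (axis i 1) (axis j 1)) has_derivative D i j) (at x)" for i j
    unfolding D_def
    by (rule has_derivative_compose_dir_deriv[OF F smooth_on_differentiable[OF smooth FxV]])
  have first: "dir_deriv w (\<lambda>y. L y a b) (F x) = (\<Sum>i\<in>UNIV. \<Sum>j\<in>UNIV.
      (a $ i * b $ j) *\<^sub>R dir_deriv w (\<lambda>y. L y (axis i 1) (axis j 1)) (F x))" for w a b
  proof -
    have "dir_deriv w (\<lambda>y. L y a b) (F x) = dir_deriv w (\<lambda>y. \<Sum>i\<in>UNIV. \<Sum>j\<in>UNIV.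
        (a $ i * b $ j) *\<^sub>R L y (axis i 1) (axis j 1)) (F x)"
      by (rule dir_deriv_cong[OF V FxV]) (rule ex)
    also have "\<dots> = (\<Sum>i\<in>UNIV. \<Sum>j\<in>UNIV.
        (a $ i * b $ j) *\<^sub>R dir_deriv w (\<lambda>y. L y (axis i 1) (axis j 1)) (F x))"
      by (rule dir_deriv_eqI)
        (rule has_derivative_sum, rule has_derivative_sum, rule has_derivative_scaleR_right,
          rule smooth_on_has_derivative[OF smooth FxV])
    finally show ?thesis .
  qed
  have dX: "((\<lambda>x. X x $ i) has_derivative (\<lambda>u. dir_deriv u X x $ i)) (at x)" for i
    by (rule bounded_linear.has_derivative[OF bounded_linear_vec_nth has_derivative_dir_deriv[OF X]])
  have dY: "((\<lambda>x. Y x $ i) has_derivative (\<lambda>u. dir_deriv u Y x $ i)) (at x)" for i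
    by (rule bounded_linear.has_derivative[OF bounded_linear_vec_nth has_derivative_dir_deriv[OF Y]])
  have "((\<lambda>x. \<Sum>i\<in>UNIV. \<Sum>j\<in>UNIV. (X x $ i * Y x $ j) *\<^sub>R L (F x) (axis i 1) (axis j 1)) has_derivative
     (\<lambda>u. \<Sum>i\<in>UNIV. \<Sum>j\<in>UNIV. (X x $ i * Y x $ j) *\<^sub>R D i j u +
        (X x $ i * dir_deriv u Y x $ j + dir_deriv u X x $ i * Y x $ j) *\<^sub>R L (F x) (axis i 1) (axis j 1))) (at x)"
    by (rule has_derivative_sum, rule has_derivative_sum,
        rule has_derivative_scaleR[OF has_derivative_mult[OF dX dY] dL])
  moreover have "(\<Sum>i\<in>UNIV. \<Sum>j\<in>UNIV. (X x $ i * Y x $ j) *\<^sub>R D i j u +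
        (X x $ i * dir_deriv u Y x $ j + dir_deriv u X x $ i * Y x $ j) *\<^sub>R L (F x) (axis i 1) (axis j 1))
    = dir_deriv (dir_deriv u F x) (\<lambda>y. L y (X x) (Y x)) (F x)
      + L (F x) (dir_deriv u X x) (Y x) + L (F x) (X x) (dir_deriv u Y x)" for u
    unfolding first[of _ "X x" "Y x"] D_def ex[OF FxV, of "X x"] ex[OF FxV, of "dir_deriv u X x"]
    by (simp add: scaleR_add_left sum.distrib algebra_simps)
  ultimately have "((\<lambda>x. \<Sum>i\<in>UNIV. \<Sum>j\<in>UNIV. (X x $ i * Y x $ j) *\<^sub>R L (F x) (axis i 1) (axis j 1)) has_derivative
     (\<lambda>u. dir_deriv (dir_deriv u F x) (\<lambda>y. L y (X x) (Y x)) (F x)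
      + L (F x) (dir_deriv u X x) (Y x) + L (F x) (X x) (dir_deriv u Y x))) (at x)"
    by simp
  then show ?thesis
    by (rule has_derivative_transform_within_open[OF _ maps(1,2)])
      (use ex maps(3) in \<open>auto simp: image_subset_iff\<close>)
qed

lemma smooth_on_bilinear_family:
  fixes L :: "real^'n::finite \<Rightarrow> real^'n \<Rightarrow> real^'n \<Rightarrow> real^'n" and F :: "real^'m::finite \<Rightarrow> real^'n"
  assumes lin: "\<And>y. y \<in> V \<Longrightarrow> bilinear (L y)"
    and smooth: "\<And>a b. smooth_on (\<lambda>y. L y a b) V"
    and U: "open U" "F ` U \<subseteq> V" and F: "smooth_on F U"
    and X: "smooth_on X U" and Y: "smooth_on Y U"
  shows "smooth_on (\<lambda>x. L (F x) (X x) (Y x)) U"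
proof (rule smooth_on_cong[OF U(1)])
  show "(\<Sum>i\<in>UNIV. \<Sum>j\<in>UNIV. (X x $ i * Y x $ j) *\<^sub>R L (F x) (axis i 1) (axis j 1)) = L (F x) (X x) (Y x)"
    if "x \<in> U" for x
    by (rule bilinear_expand_axis[symmetric, OF lin]) (use that U(2) in auto)
  show "smooth_on (\<lambda>x. \<Sum>i\<in>UNIV. \<Sum>j\<in>UNIV. (X x $ i * Y x $ j) *\<^sub>R L (F x) (axis i 1) (axis j 1)) U"
    by (intro smooth_on_sum smooth_on_scaleR smooth_on_mult smooth_on_vec_nth X Y U(1)
        smooth_on_compose[OF U F smooth])
qed

text \<open>The Christoffel symbols as a bilinear map: the entries of the vector multiplied by the inverse matrix are
  the right-hand sides of Koszul's formula for the coordinate fields.\<close>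

definition levi_civita :: "(real^'n::finite \<Rightarrow> real^'n^'n) \<Rightarrow> real^'n \<Rightarrow> real^'n \<Rightarrow> real^'n \<Rightarrow> real^'n" where
  "levi_civita G x u v = matrix_inv (G x) *v (\<chi> l. 1/2 * (ip (dir_deriv u G x) v (axis l 1)
     + ip (dir_deriv v G x) u (axis l 1) - ip (dir_deriv (axis l 1) G x) u v))"

text \<open>The connection pulled back along \<open>F\<close>, differentiating a vector field \<open>X\<close> along \<open>F\<close> in the direction \<open>u\<close>.  For the
  identity map it is the Levi-Civita connection itself; for an immersion it differentiates fields
  that need not be tangent to the hypersurface.\<close>

definition nabla :: "(real^'n::finite \<Rightarrow> real^'n^'n) \<Rightarrow> (real^'m::finite \<Rightarrow> real^'n) \<Rightarrow> real^'m
    \<Rightarrow> (real^'m \<Rightarrow> real^'n) \<Rightarrow> real^'m \<Rightarrow> real^'n" where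
  "nabla G F u X x = dir_deriv u X x + levi_civita G (F x) (dir_deriv u F x) (X x)"

text \<open>The curvature tensor, in the form \<open>\<nabla>\<^sub>u\<nabla>\<^sub>v w - \<nabla>\<^sub>v\<nabla>\<^sub>u w\<close> for constant coordinate vectors.\<close>

definition riem_curv :: "(real^'n::finite \<Rightarrow> real^'n^'n) \<Rightarrow> real^'n \<Rightarrow> real^'n \<Rightarrow> real^'n \<Rightarrow> real^'n \<Rightarrow> real^'n" where
  "riem_curv G x u v w = dir_deriv u (\<lambda>y. levi_civita G y v w) x - dir_deriv v (\<lambda>y. levi_civita G y u w) x
     + levi_civita G x u (levi_civita G x v w) - levi_civita G x v (levi_civita G x u w)"

locale riem_metric =
  fixes G :: "real^'n::finite \<Rightarrow> real^'n^'n" and V :: "(real^'n) set"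
  assumes open_V: "open V" and smooth_G: "smooth_on G V"
    and symmetric_G: "x \<in> V \<Longrightarrow> transpose (G x) = G x"
    and positive_G: "x \<in> V \<Longrightarrow> v \<noteq> 0 \<Longrightarrow> ip (G x) v v > 0"
begin

lemma ip_commute: "x \<in> V \<Longrightarrow> ip (G x) u v = ip (G x) v u"
  unfolding ip_def using symmetric_G[of x]
  by (metis dot_matrix_vector_mul inner_commute dot_lmul_matrix transpose_matrix_vector)

lemma ip_eq_0_iff: "x \<in> V \<Longrightarrow> ip (G x) v v = 0 \<longleftrightarrow> v = 0"
  using positive_G[of x v] by fastforce

lemma invertible_G: "x \<in> V \<Longrightarrow> invertible (G x)"
proof -
  assume x: "x \<in> V"
  have "G x *v v = 0 \<Longrightarrow> v = 0" for v
    using ip_eq_0_iff[OF x, of v] by (simp add: ip_def)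
  then show ?thesis
    by (metis invertible_left_inverse matrix_left_invertible_ker)
qed

lemma ip_dG_commute: "x \<in> V \<Longrightarrow> ip (dir_deriv w G x) u v = ip (dir_deriv w G x) v u"
proof -
  assume x: "x \<in> V"
  have d: "dir_deriv w (\<lambda>y. ip (G y) a b) x = ip (dir_deriv w G x) a b" for a b
    by (rule dir_deriv_eqI[OF has_derivative_eq_rhs[OF has_derivative_ip[OF
            smooth_on_has_derivative[OF smooth_G x] has_derivative_const has_derivative_const]]]) simp
  show ?thesis
    using dir_deriv_cong[OF open_V x, of "\<lambda>y. ip (G y) u v" "\<lambda>y. ip (G y) v u" w] ip_commute
    by (simp add: d)
qed

lemma dG_add: "x \<in> V \<Longrightarrow> dir_deriv (u + v) G x = dir_deriv u G x + dir_deriv v G x"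
  and dG_scale: "x \<in> V \<Longrightarrow> dir_deriv (r *\<^sub>R u) G x = r *\<^sub>R dir_deriv u G x"
  using dir_deriv_linear smooth_on_differentiable[OF smooth_G] by blast+

lemma koszul:
  assumes x: "x \<in> V"
  shows "ip (G x) (levi_civita G x u v) w =
    1/2 * (ip (dir_deriv u G x) v w + ip (dir_deriv v G x) u w - ip (dir_deriv w G x) u v)"
proof -
  define L where "L w = 1/2 * (ip (dir_deriv u G x) v w + ip (dir_deriv v G x) u w - ip (dir_deriv w G x) u v)" for w
  have ipadd: "ip (A + B) a b = ip A a b + ip B a b" "ip (r *\<^sub>R A) a b = r * ip A a b" for A B a b r
    by (simp_all add: ip_def matrix_vector_mult_add_rdistrib inner_add_right
        scaleR_matrix_vector_assoc[symmetric])
  have "linear L"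
    by (rule linearI) (simp_all add: L_def dG_add[OF x] dG_scale[OF x] ipadd algebra_simps)
  from linear_expand_axis[OF this, of w] have L: "(\<chi> l. L (axis l 1)) \<bullet> w = L w"
    by (simp add: inner_vec_def mult.commute)
  have "ip (G x) (levi_civita G x u v) w = ip (G x) w (levi_civita G x u v)"
    by (rule ip_commute[OF x])
  also have "\<dots> = w \<bullet> (\<chi> l. L (axis l 1))"
    unfolding levi_civita_def ip_def[of "G x"] L_def[symmetric]
    by (simp add: matrix_vector_mul_assoc matrix_inv_mult[OF invertible_G[OF x]])
  finally show ?thesis using L by (simp add: inner_commute L_def)
qed

lemma ip_nondegenerate: "x \<in> V \<Longrightarrow> (\<And>w. ip (G x) a w = ip (G x) b w) \<Longrightarrow> a = b"
  using ip_eq_0_iff[of x "a - b"] by simp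

lemma levi_civita_commute: "x \<in> V \<Longrightarrow> levi_civita G x u v = levi_civita G x v u"
  by (rule ip_nondegenerate) (auto simp: koszul ip_dG_commute[of x _ u v])

lemma levi_civita_metric:
  "x \<in> V \<Longrightarrow> ip (G x) (levi_civita G x w u) v + ip (G x) u (levi_civita G x w v) = ip (dir_deriv w G x) u v"
  using ip_commute[of x u "levi_civita G x w v"]
  by (simp add: koszul ip_dG_commute[of x w u v] ip_dG_commute[of x u w v] ip_dG_commute[of x v w u] field_simps)

lemma bilinear_levi_civita: "x \<in> V \<Longrightarrow> bilinear (levi_civita G x)"
proof -
  assume x: "x \<in> V"
  have ipadd: "ip (A + B) a b = ip A a b + ip B a b" "ip (r *\<^sub>R A) a b = r * ip A a b" for A B a b r
    by (simp_all add: ip_def matrix_vector_mult_add_rdistrib inner_add_right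
        scaleR_matrix_vector_assoc[symmetric])
  show ?thesis
    unfolding bilinear_def
    by (auto intro!: linearI ip_nondegenerate[OF x] simp: koszul[OF x] dG_add[OF x] dG_scale[OF x] ipadd algebra_simps)
qed

lemma levi_civita_linear:
  assumes "x \<in> V"
  shows "levi_civita G x (u + u') v = levi_civita G x u v + levi_civita G x u' v"
    "levi_civita G x u (v + v') = levi_civita G x u v + levi_civita G x u v'"
    "levi_civita G x (r *\<^sub>R u) v = r *\<^sub>R levi_civita G x u v"
    "levi_civita G x u (r *\<^sub>R v) = r *\<^sub>R levi_civita G x u v"
    "levi_civita G x u 0 = 0" "levi_civita G x 0 v = 0"
  using bilinear_levi_civita[OF assms]
  by (simp_all add: bilinear_ladd bilinear_radd bilinear_lmul bilinear_rmul bilinear_lzero bilinear_rzero)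

lemma smooth_levi_civita: "smooth_on (\<lambda>x. levi_civita G x u v) V"
  unfolding levi_civita_def
proof (intro smooth_on_bilinear[OF bounded_bilinear_matrix_vector_mult open_V])
  show "smooth_on (\<lambda>x. matrix_inv (G x)) V"
    by (rule smooth_on_matrix_inv[OF open_V smooth_G invertible_G])
  have "smooth_on (\<lambda>x. 1 / 2 * (ip (dir_deriv u G x) v (axis l 1) + ip (dir_deriv v G x) u (axis l 1) - ip (dir_deriv (axis l 1) G x) u v)) V" for l
    by (intro smooth_on_intros smooth_on_ip open_V smooth_G)
  then show "smooth_on (\<lambda>x. \<chi> l. 1 / 2 * (ip (dir_deriv u G x) v (axis l 1) + ip (dir_deriv v G x) u (axis l 1) - ip (dir_deriv (axis l 1) G x) u v)) V"
    by (intro smooth_on_componentwise open_V) simp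
qed

lemma nabla_add:
  assumes "F x \<in> V" "X differentiable at x" "Y differentiable at x"
  shows "nabla G F u (\<lambda>y. X y + Y y) x = nabla G F u X x + nabla G F u Y x"
  using dir_deriv_eqI[OF has_derivative_add[OF assms(2,3)[THEN has_derivative_dir_deriv]]]
  by (simp add: nabla_def levi_civita_linear[OF assms(1)])

lemma nabla_scale:
  assumes "F x \<in> V" "X differentiable at x" "f differentiable at x"
  shows "nabla G F u (\<lambda>y. f y *\<^sub>R X y) x = dir_deriv u f x *\<^sub>R X x + f x *\<^sub>R nabla G F u X x"
  using dir_deriv_eqI[OF has_derivative_scaleR[OF assms(3,2)[THEN has_derivative_dir_deriv]], of u]
  by (simp add: nabla_def levi_civita_linear[OF assms(1)] scaleR_add_right)

lemma nabla_minus: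
  assumes "F x \<in> V" "X differentiable at x"
  shows "nabla G F u (\<lambda>y. - X y) x = - nabla G F u X x"
  using nabla_scale[where f="\<lambda>_. -1" and u=u and F=F and X=X and x=x] assms
  by (simp add: dir_deriv_def)

lemma nabla_cong:
  assumes "open U" "x \<in> U" "\<And>y. y \<in> U \<Longrightarrow> X y = Y y"
  shows "nabla G F u X x = nabla G F u Y x"
  using dir_deriv_cong[OF assms] assms(2,3) by (simp add: nabla_def)

lemma nabla_direction_linear:
  assumes "F x \<in> V" "X differentiable at x" "F differentiable at x"
  shows "nabla G F (u + v) X x = nabla G F u X x + nabla G F v X x"
    "nabla G F (r *\<^sub>R u) X x = r *\<^sub>R nabla G F u X x"
  using assms by (simp_all add: nabla_def dir_deriv_linear levi_civita_linear scaleR_add_right)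

lemma nabla_metric:
  assumes "F x \<in> V" "F differentiable at x" "X differentiable at x" "Y differentiable at x"
  shows "dir_deriv u (\<lambda>y. ip (G (F y)) (X y) (Y y)) x
    = ip (G (F x)) (nabla G F u X x) (Y x) + ip (G (F x)) (X x) (nabla G F u Y x)"
proof -
  have "dir_deriv u (\<lambda>y. ip (G (F y)) (X y) (Y y)) x =
      ip (dir_deriv (dir_deriv u F x) G (F x)) (X x) (Y x)
      + ip (G (F x)) (dir_deriv u X x) (Y x) + ip (G (F x)) (X x) (dir_deriv u Y x)"
    by (rule dir_deriv_eqI[OF has_derivative_ip[OF has_derivative_compose_dir_deriv[OF assms(2)
          smooth_on_differentiable[OF smooth_G assms(1)]] assms(3,4)[THEN has_derivative_dir_deriv]]])
  then show ?thesis
    by (simp add: nabla_def levi_civita_metric[OF assms(1), symmetric])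
qed

lemma nabla_torsion_free:
  assumes "open U" "x \<in> U" "F ` U \<subseteq> V" "smooth_on F U"
  shows "nabla G F u (dir_deriv v F) x = nabla G F v (dir_deriv u F) x"
  using dir_deriv_commute[OF assms(1,4,2), of u v] assms(2,3)
  by (auto simp: nabla_def levi_civita_commute)

lemma smooth_on_nabla:
  assumes "open U" "F ` U \<subseteq> V" "smooth_on F U" "smooth_on X U"
  shows "smooth_on (nabla G F u X) U"
proof -
  have "smooth_on (\<lambda>x. levi_civita G (F x) (dir_deriv u F x) (X x)) U"
    by (rule smooth_on_bilinear_family[OF bilinear_levi_civita smooth_levi_civita assms(1,2,3)
          smooth_on_dir_deriv[OF assms(1,3)] assms(4)])
  from smooth_on_add[OF assms(1) smooth_on_dir_deriv[OF assms(1,4)] this] show ?thesis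
    unfolding nabla_def .
qed

text \<open>The second derivatives of \<open>X\<close> and of \<open>F\<close> cancel by symmetry; the derivative of the Christoffel map and its
  compositions with itself remain.\<close>

lemma ricci_identity:
  fixes F :: "real^'m::finite \<Rightarrow> real^'n"
  assumes U: "open U" "x \<in> U" "F ` U \<subseteq> V" and F: "smooth_on F U" and X: "smooth_on X U"
  shows "nabla G F u (nabla G F v X) x - nabla G F v (nabla G F u X) x
    = riem_curv G (F x) (dir_deriv u F x) (dir_deriv v F x) (X x)"
proof -
  have FxV: "F x \<in> V" using U by auto
  have dX: "X differentiable at x" and dF: "F differentiable at x"
    and ddX: "dir_deriv w X differentiable at x" and ddF: "dir_deriv w F differentiable at x" for w
    by (rule smooth_on_differentiable[OF _ U(2)], intro smooth_on_dir_deriv U F X)+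
  have "dir_deriv u (nabla G F v X) x = dir_deriv u (dir_deriv v X) x
     + (dir_deriv (dir_deriv u F x) (\<lambda>y. levi_civita G y (dir_deriv v F x) (X x)) (F x)
       + levi_civita G (F x) (dir_deriv u (dir_deriv v F) x) (X x)
       + levi_civita G (F x) (dir_deriv v F x) (dir_deriv u X x))" for u v
    unfolding nabla_def
    by (rule dir_deriv_eqI[OF has_derivative_add[OF has_derivative_dir_deriv[OF ddX]
          has_derivative_bilinear_family[OF bilinear_levi_civita smooth_levi_civita open_V dF U ddF dX]]])
  then show ?thesis
    using dir_deriv_commute[OF U(1) X U(2), of u v] dir_deriv_commute[OF U(1) F U(2), of u v]
    by (simp add: nabla_def[of G F _ _ x] riem_curv_def levi_civita_linear[OF FxV])
qed

end

subsection \<open>Metrics of constant sectional curvature\<close>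

text \<open>A tensor with the symmetries of a curvature tensor vanishes if its sectional form does.  The Bianchi
  identity in its four arrangements gives the symmetry under exchange of the two pairs.  Polarizing the
  sectional form twice shows that \<open>B\<close> changes sign when its outer arguments are exchanged.
  Then \<open>B\<close> is totally alternating, hence invariant under cyclic permutations of three arguments, and the Bianchi
  identity reads \<open>3B = 0\<close>.\<close>

lemma algebraic_curvature_eq_0:
  fixes B :: "'a::ab_group_add \<Rightarrow> 'a \<Rightarrow> 'a \<Rightarrow> 'a \<Rightarrow> real"
  assumes add: "\<And>u u' v w z. B (u + u') v w z = B u v w z + B u' v w z"
      "\<And>u v v' w z. B u (v + v') w z = B u v w z + B u v' w z"
      "\<And>u v w w' z. B u v (w + w') z = B u v w z + B u v w' z"
      "\<And>u v w z z'. B u v w (z + z') = B u v w z + B u v w z'"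
    and anti12: "\<And>u v w z. B u v w z = - B v u w z"
    and anti34: "\<And>u v w z. B u v w z = - B u v z w"
    and bianchi: "\<And>u v w z. B u v w z + B v w u z + B w u v z = 0"
    and sec: "\<And>u v. B u v v u = 0"
  shows "B u v w z = 0"
proof -
  have pair: "B u v w z = B w z u v" for u v w z
    using bianchi[of u v w z] bianchi[of v w z u] bianchi[of w z u v] bianchi[of z u v w]
      anti34[of v w z u] anti34[of w z v u] anti12[of z v w u] anti12[of z u w v] anti34[of u z w v]
      anti12[of u w z v] anti34[of w u z v] anti12[of z u v w] anti34[of u v z w] anti34[of v z u w]
    by linarith
  have mid: "B u v w u = 0" for u v w
    using sec[of u "v + w"] sec[of u v] sec[of u w] pair[of u w v u] anti12[of v u u w] anti34[of u v u w]
    by (simp add: add)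
  have outer: "B u v w z = - B z v w u" for u v w z
    using mid[of "u + z" v w] mid[of u v w] mid[of z v w] by (simp add: add)
  have "B v w u z = B u v w z" for u v w z
    using anti34[of u v w z] outer[of u v z w] anti34[of w v z u] anti12[of w v u z] by linarith
  from this[of v w u z] this[of u v w z] show ?thesis
    using bianchi[of u v w z] by linarith
qed

context riem_metric
begin

lemma differentiable_levi_civita: "x \<in> V \<Longrightarrow> (\<lambda>y. levi_civita G y u v) differentiable at x"
  by (rule smooth_on_differentiable[OF smooth_levi_civita])

lemma dir_deriv_levi_civita_add:
  assumes x: "x \<in> V"
  shows "dir_deriv w (\<lambda>y. levi_civita G y (u + u') v) x
      = dir_deriv w (\<lambda>y. levi_civita G y u v) x + dir_deriv w (\<lambda>y. levi_civita G y u' v) x"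
    "dir_deriv w (\<lambda>y. levi_civita G y u (v + v')) x
      = dir_deriv w (\<lambda>y. levi_civita G y u v) x + dir_deriv w (\<lambda>y. levi_civita G y u v') x"
proof -
  note d = has_derivative_dir_deriv[OF differentiable_levi_civita[OF x]]
  have "dir_deriv w (\<lambda>y. levi_civita G y (u + u') v) x
      = dir_deriv w (\<lambda>y. levi_civita G y u v + levi_civita G y u' v) x"
    by (rule dir_deriv_cong[OF open_V x]) (simp add: levi_civita_linear)
  then show "dir_deriv w (\<lambda>y. levi_civita G y (u + u') v) x
      = dir_deriv w (\<lambda>y. levi_civita G y u v) x + dir_deriv w (\<lambda>y. levi_civita G y u' v) x"
    using dir_deriv_eqI[OF has_derivative_add[OF d[of u v] d[of u' v]]] by simp
  have "dir_deriv w (\<lambda>y. levi_civita G y u (v + v')) x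
      = dir_deriv w (\<lambda>y. levi_civita G y u v + levi_civita G y u v') x"
    by (rule dir_deriv_cong[OF open_V x]) (simp add: levi_civita_linear)
  then show "dir_deriv w (\<lambda>y. levi_civita G y u (v + v')) x
      = dir_deriv w (\<lambda>y. levi_civita G y u v) x + dir_deriv w (\<lambda>y. levi_civita G y u v') x"
    using dir_deriv_eqI[OF has_derivative_add[OF d[of u v] d[of u v']]] by simp
qed

lemma riem_curv_add:
  assumes "x \<in> V"
  shows "riem_curv G x (u + u') v w = riem_curv G x u v w + riem_curv G x u' v w"
    "riem_curv G x u (v + v') w = riem_curv G x u v w + riem_curv G x u v' w"
    "riem_curv G x u v (w + w') = riem_curv G x u v w + riem_curv G x u v w'"
  by (simp_all add: riem_curv_def levi_civita_linear[OF assms] dir_deriv_levi_civita_add[OF assms]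
      dir_deriv_linear[OF differentiable_levi_civita[OF assms]])

lemma riem_curv_anti: "riem_curv G x u v w = - riem_curv G x v u w"
  by (simp add: riem_curv_def)

lemma riem_curv_bianchi:
  assumes x: "x \<in> V"
  shows "riem_curv G x u v w + riem_curv G x v w u + riem_curv G x w u v = 0"
proof -
  have *: "dir_deriv a (\<lambda>y. levi_civita G y b c) x = dir_deriv a (\<lambda>y. levi_civita G y c b) x" for a b c
    by (rule dir_deriv_cong[OF open_V x]) (rule levi_civita_commute)
  show ?thesis
    using *[of u v w] *[of v w u] *[of w u v]
      levi_civita_commute[OF x, of v w] levi_civita_commute[OF x, of u w] levi_civita_commute[OF x, of u v]
    by (simp add: riem_curv_def)
qed

text \<open>The second derivatives of the function \<open>\<langle>a, b\<rangle>\<close>, for constant vectors \<open>a\<close> and \<open>b\<close>, commute; metric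
  compatibility expresses their commutator by the curvature.\<close>

lemma riem_curv_skew:
  assumes x: "x \<in> V"
  shows "ip (G x) (riem_curv G x u v a) b = - ip (G x) (riem_curv G x u v b) a"
proof -
  let ?I = "\<lambda>x::real^'n. x" and ?c = "\<lambda>a (y::real^'n). a"
  note nab = smooth_on_nabla[OF open_V, of ?I, simplified]
  have I: "smooth_on ?I V" unfolding smooth_on_def
  proof
    fix k show "Ck_on k ?I V"
    proof (cases k)
      case (Suc l)
      have "partial_deriv i ?I = (\<lambda>_. axis i 1)" for i by (simp add: partial_deriv_def fun_eq_iff)
      then show ?thesis using Suc by (simp add: Ck_on_const)
    qed simp
  qed
  have dI: "?I differentiable at y" for y by simp
  have ddI: "dir_deriv w ?I y = w" for w y by (simp add: dir_deriv_def)
  note sc = smooth_on_const[of _ V]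
  have sn: "smooth_on (nabla G ?I w (?c e)) V" for w e by (rule nab[OF I sc])
  have snd: "(nabla G ?I w (?c e)) differentiable at y" if "y \<in> V" for w e y
    by (rule smooth_on_differentiable[OF sn that])
  define h where "h y = ip (G y) a b" for y
  have h: "smooth_on h V" unfolding h_def by (intro smooth_on_ip open_V smooth_G sc)
  have h1: "dir_deriv w h y = ip (G y) (nabla G ?I w (?c a) y) b + ip (G y) a (nabla G ?I w (?c b) y)"
    if "y \<in> V" for w y
    unfolding h_def by (rule nabla_metric[of ?I y "?c a" "?c b"]) (use that in auto)
  have h2: "dir_deriv w' (dir_deriv w h) x =
     ip (G x) (nabla G ?I w' (nabla G ?I w (?c a)) x) b + ip (G x) (nabla G ?I w (?c a) x) (nabla G ?I w' (?c b) x)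
     + (ip (G x) (nabla G ?I w' (?c a) x) (nabla G ?I w (?c b) x) + ip (G x) a (nabla G ?I w' (nabla G ?I w (?c b)) x))"
    for w w'
  proof -
    have "dir_deriv w' (dir_deriv w h) x =
       dir_deriv w' (\<lambda>y. ip (G y) (nabla G ?I w (?c a) y) b + ip (G y) a (nabla G ?I w (?c b) y)) x"
      by (rule dir_deriv_cong[OF open_V x h1])
    also have "\<dots> = dir_deriv w' (\<lambda>y. ip (G y) (nabla G ?I w (?c a) y) b) x
       + dir_deriv w' (\<lambda>y. ip (G y) a (nabla G ?I w (?c b) y)) x"
      by (rule dir_deriv_eqI[OF has_derivative_add[OF smooth_on_has_derivative smooth_on_has_derivative]])
        (rule smooth_on_ip[OF open_V smooth_G] sn sc x)+
    also have "dir_deriv w' (\<lambda>y. ip (G y) (nabla G ?I w (?c a) y) b) x =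
       ip (G x) (nabla G ?I w' (nabla G ?I w (?c a)) x) b + ip (G x) (nabla G ?I w (?c a) x) (nabla G ?I w' (?c b) x)"
      by (rule nabla_metric[of ?I x _ "?c b"]) (use x snd in auto)
    also have "dir_deriv w' (\<lambda>y. ip (G y) a (nabla G ?I w (?c b) y)) x =
       ip (G x) (nabla G ?I w' (?c a) x) (nabla G ?I w (?c b) x) + ip (G x) a (nabla G ?I w' (nabla G ?I w (?c b)) x)"
      by (rule nabla_metric[of ?I x "?c a"]) (use x snd in auto)
    finally show ?thesis .
  qed
  have R: "riem_curv G x u v e = nabla G ?I u (nabla G ?I v (?c e)) x - nabla G ?I v (nabla G ?I u (?c e)) x" for e
    using ricci_identity[OF open_V x _ I sc, of u v e] by (simp add: ddI)
  have "dir_deriv u (dir_deriv v h) x = dir_deriv v (dir_deriv u h) x"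
    by (rule dir_deriv_commute_real[OF open_V h x])
  then have "ip (G x) (riem_curv G x u v a) b + ip (G x) a (riem_curv G x u v b) = 0"
    unfolding h2 R by simp
  then show ?thesis using ip_commute[OF x, of a "riem_curv G x u v b"] by simp
qed

text \<open>Divided by \<open>\<langle>v, v\<rangle>\<close>, the determinant is the squared length of the component \<open>w\<close> of \<open>u\<close> orthogonal to \<open>v\<close>.\<close>

lemma gram_determinant_pos:
  assumes x: "x \<in> V" and ind: "u \<noteq> v" "independent {u, v}"
  shows "ip (G x) u u * ip (G x) v v - (ip (G x) u v)\<^sup>2 > 0"
proof -
  have v: "v \<noteq> 0" "u \<notin> span {v}" using ind by (auto simp: independent_insert)
  define w where "w = u - (ip (G x) u v / ip (G x) v v) *\<^sub>R v"
  have pv: "ip (G x) v v > 0" using positive_G[OF x v(1)] .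
  have "w \<noteq> 0" using v(2) span_scale[OF span_base, of v "{v}"]
    by (metis eq_iff_diff_eq_0 insertI1 w_def)
  then have "ip (G x) w w > 0" by (rule positive_G[OF x])
  also have "ip (G x) w w = ip (G x) u u - (ip (G x) u v)\<^sup>2 / ip (G x) v v"
    using pv ip_commute[OF x, of v u] by (simp add: w_def power2_eq_square)
  finally show ?thesis using pv by (simp add: field_simps)
qed

text \<open>The difference \<open>B\<close> of the two sides has the symmetries of a curvature tensor, and its sectional form
  vanishes: by hypothesis on independent pairs, by skewness on dependent ones.\<close>

proposition riem_curv_constant_sectional:
  assumes x: "x \<in> V"
    and sec: "\<And>u v. u \<noteq> v \<Longrightarrow> independent {u, v} \<Longrightarrow>
      ip (G x) (riem_curv G x u v v) u / (ip (G x) u u * ip (G x) v v - (ip (G x) u v)\<^sup>2) = \<kappa>"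
  shows "riem_curv G x u v w = (\<kappa> * ip (G x) v w) *\<^sub>R u - (\<kappa> * ip (G x) u w) *\<^sub>R v"
proof (rule ip_nondegenerate[OF x])
  fix z
  define B where "B u v w z = ip (G x) (riem_curv G x u v w) z
      - \<kappa> * (ip (G x) v w * ip (G x) u z - ip (G x) u w * ip (G x) v z)" for u v w z
  have anti34: "B u v w z = - B u v z w" for u v w z
    using riem_curv_skew[OF x, of u v w z] by (simp add: B_def algebra_simps)
  have "B u v w z = 0"
  proof (rule algebraic_curvature_eq_0[of B])
    fix u v w z
    show "B u v w z = - B u v z w" by (rule anti34)
    show "B u v w z = - B v u w z" using riem_curv_anti[of x u v w] by (simp add: B_def algebra_simps)
    show "B u v w z + B v w u z + B w u v z = 0"
      using arg_cong[OF riem_curv_bianchi[OF x, of u v w], of "\<lambda>a. ip (G x) a z"]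
        ip_commute[OF x, of v u] ip_commute[OF x, of w u] ip_commute[OF x, of w v]
      by (simp add: B_def algebra_simps)
    show "B u v v u = 0"
    proof (cases "u \<noteq> v \<and> independent {u, v}")
      case True
      then have "ip (G x) (riem_curv G x u v v) u = \<kappa> * (ip (G x) u u * ip (G x) v v - (ip (G x) u v)\<^sup>2)"
        using sec[of u v] gram_determinant_pos[OF x, of u v] by (simp add: field_simps)
      then show ?thesis
        using ip_commute[OF x, of v u] by (simp add: B_def power2_eq_square algebra_simps)
    next
      case False
      have "v = 0 \<or> (\<exists>r. u = r *\<^sub>R v)"
      proof (cases "u = v")
        case True
        then show ?thesis by (metis scaleR_one)
      next
        case neq: False
        then show ?thesis using False by (auto simp: independent_insert span_singleton)
      qed
      then show ?thesis
      proof
        assume "v = 0"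
        then show ?thesis using riem_curv_add(2)[OF x, of u 0 0 0] by (simp add: B_def)
      next
        assume "\<exists>r. u = r *\<^sub>R v"
        then obtain r where r: "u = r *\<^sub>R v" by blast
        have "B a b c (r *\<^sub>R d) = r * B a b c d" for a b c d by (simp add: B_def algebra_simps)
        moreover have "B u v v v = 0" using anti34[of u v v v] by simp
        ultimately show ?thesis using r by (metis mult_zero_right)
      qed
    qed
  qed (simp_all add: B_def riem_curv_add[OF x] algebra_simps)
  then show "ip (G x) (riem_curv G x u v w) z
      = ip (G x) ((\<kappa> * ip (G x) v w) *\<^sub>R u - (\<kappa> * ip (G x) u w) *\<^sub>R v) z"
    by (simp add: B_def algebra_simps)
qed

end

subsection \<open>Naturality of the Levi-Civita connection\<close>

text \<open>The uniqueness of the Levi-Civita connection.  The numbers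
  \<open>T u v w = \<langle>\<nabla>\<^sub>u dF(v), dF(w)\<rangle>\<close> are symmetric in \<open>u\<close> and \<open>v\<close> and compatible with the pulled-back metric,
  so Koszul's formula determines them.\<close>

lemma levi_civita_pullback:
  assumes M: "riem_metric G V" and M': "riem_metric G' V'"
    and F: "smooth_on F V'" "F ` V' \<subseteq> V" and x: "x \<in> V'"
    and pull: "\<And>y u v. y \<in> V' \<Longrightarrow> ip (G' y) u v = ip (G (F y)) (dir_deriv u F y) (dir_deriv v F y)"
    and surj: "surj (\<lambda>u. dir_deriv u F x)"
  shows "dir_deriv (levi_civita G' x u v) F x = nabla G F u (dir_deriv v F) x"
proof -
  interpret m: riem_metric G V by (rule M)
  interpret m': riem_metric G' V' by (rule M')
  have FxV: "F x \<in> V" using F x by auto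
  note dF = smooth_on_differentiable[OF F(1) x]
  note ddF = smooth_on_differentiable[OF smooth_on_dir_deriv[OF m'.open_V F(1)] x]
  define T where "T u v w = ip (G (F x)) (nabla G F u (dir_deriv v F) x) (dir_deriv w F x)" for u v w
  have sym: "T u v w = T v u w" for u v w
    unfolding T_def using m.nabla_torsion_free[OF m'.open_V x F(2,1)] by simp
  have metric: "ip (dir_deriv w G' x) u v = T w u v + T w v u" for u v w
  proof -
    have "ip (dir_deriv w G' x) u v = dir_deriv w (\<lambda>y. ip (G' y) u v) x"
      by (rule dir_deriv_eqI[symmetric, OF has_derivative_eq_rhs[OF has_derivative_ip[OF
            smooth_on_has_derivative[OF m'.smooth_G x] has_derivative_const has_derivative_const]]]) simp
    also have "\<dots> = dir_deriv w (\<lambda>y. ip (G (F y)) (dir_deriv u F y) (dir_deriv v F y)) x"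
      by (rule dir_deriv_cong[OF m'.open_V x pull])
    also have "\<dots> = T w u v + T w v u"
      unfolding T_def m.nabla_metric[OF FxV dF ddF ddF]
      using m.ip_commute[OF FxV, of "dir_deriv u F x"] by simp
    finally show ?thesis .
  qed
  show ?thesis
  proof (rule m.ip_nondegenerate[OF FxV])
    fix w
    obtain w' where w: "w = dir_deriv w' F x" using surj by (metis surjD)
    have "ip (G (F x)) (dir_deriv (levi_civita G' x u v) F x) w = ip (G' x) (levi_civita G' x u v) w'"
      unfolding w by (rule pull[OF x, symmetric])
    also have "\<dots> = T u v w'"
      unfolding m'.koszul[OF x] metric using sym[of u v w'] sym[of u w' v] sym[of v w' u] by simp
    finally show "ip (G (F x)) (dir_deriv (levi_civita G' x u v) F x) w = ip (G (F x)) (nabla G F u (dir_deriv v F) x) w"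
      unfolding T_def w .
  qed
qed

text \<open>An isometry between open sets carries the covariant derivative of a field along \<open>\<Phi>\<close> to that of the
  image field along \<open>F \<circ> \<Phi>\<close>.  It is applied to the transition maps of the ambient manifold.\<close>

lemma nabla_pushforward:
  assumes M: "riem_metric G V" and M': "riem_metric G' V'"
    and F: "smooth_on F V'" "F ` V' \<subseteq> V"
    and pull: "\<And>y u v. y \<in> V' \<Longrightarrow> ip (G' y) u v = ip (G (F y)) (dir_deriv u F y) (dir_deriv v F y)"
    and U: "open U" "x \<in> U" "\<Phi> ` U \<subseteq> V'" and \<Phi>: "\<Phi> differentiable at x" and X: "X differentiable at x"
    and surj: "surj (\<lambda>u. dir_deriv u F (\<Phi> x))"
  shows "nabla G (\<lambda>y. F (\<Phi> y)) u (\<lambda>y. dir_deriv (X y) F (\<Phi> y)) x = dir_deriv (nabla G' \<Phi> u X x) F (\<Phi> x)"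
proof -
  interpret m': riem_metric G' V' by (rule M')
  have V': "\<Phi> x \<in> V'" using U by auto
  note dF = smooth_on_differentiable[OF F(1) V']
  have "dir_deriv u (\<lambda>y. F (\<Phi> y)) x = dir_deriv (dir_deriv u \<Phi> x) F (\<Phi> x)"
    by (rule dir_deriv_eqI[OF has_derivative_compose_dir_deriv[OF \<Phi> dF]])
  moreover have "dir_deriv u (\<lambda>y. dir_deriv (X y) F (\<Phi> y)) x =
      dir_deriv (dir_deriv u \<Phi> x) (dir_deriv (X x) F) (\<Phi> x) + dir_deriv (dir_deriv u X x) F (\<Phi> x)"
    by (rule dir_deriv_eqI[OF has_derivative_dir_deriv_along[OF m'.open_V F(1) U \<Phi> X]])
  moreover have "dir_deriv (levi_civita G' (\<Phi> x) (dir_deriv u \<Phi> x) (X x)) F (\<Phi> x)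
      = nabla G F (dir_deriv u \<Phi> x) (dir_deriv (X x) F) (\<Phi> x)"
    by (rule levi_civita_pullback[OF M M' F V' pull surj])
  ultimately show ?thesis
    by (simp add: nabla_def dir_deriv_linear[OF dF])
qed

lemma nabla_reparametrize:
  assumes "\<tau> differentiable at x" "F differentiable at (\<tau> x)" "X differentiable at (\<tau> x)"
  shows "nabla G (\<lambda>y. F (\<tau> y)) u (\<lambda>y. X (\<tau> y)) x = nabla G F (dir_deriv u \<tau> x) X (\<tau> x)"
  using dir_deriv_eqI[OF has_derivative_compose_dir_deriv[OF assms(1,2)]]
    dir_deriv_eqI[OF has_derivative_compose_dir_deriv[OF assms(1,3)]]
  by (simp add: nabla_def)

lemma nabla_cong_both:
  assumes "open U" "x \<in> U" "\<And>y. y \<in> U \<Longrightarrow> F y = F' y" "\<And>y. y \<in> U \<Longrightarrow> X y = X' y"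
  shows "nabla G F u X x = nabla G F' u X' x"
  using dir_deriv_cong[OF assms(1,2), of F F' u] dir_deriv_cong[OF assms(1,2), of X X' u] assms(2-4)
  by (simp add: nabla_def)

section \<open>Hypersurfaces of a metric of constant curvature\<close>

text \<open>A hypersurface in coordinates: \<open>F\<close> is the immersion, \<open>\<eta>\<close> a unit normal field, and \<open>G\<close> the ambient metric, whose
  curvature tensor is that of constant curvature \<open>c\<close>.\<close>

locale immersed_patch = riem_metric G V
  for G :: "real^'n::finite \<Rightarrow> real^'n^'n" and V +
  fixes U :: "(real^'m::finite) set" and F :: "real^'m \<Rightarrow> real^'n" and \<eta> :: "real^'m \<Rightarrow> real^'n"
    and c :: real
  assumes open_U: "open U" and F_maps: "F ` U \<subseteq> V" and smooth_F: "smooth_on F U"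
    and smooth_eta: "smooth_on \<eta> U"
    and immersion: "x \<in> U \<Longrightarrow> inj (\<lambda>u. dir_deriv u F x)"
    and codim: "CARD('n) = Suc CARD('m)"
    and eta_unit: "x \<in> U \<Longrightarrow> ip (G (F x)) (\<eta> x) (\<eta> x) = 1"
    and eta_normal: "x \<in> U \<Longrightarrow> ip (G (F x)) (\<eta> x) (dir_deriv u F x) = 0"
    and const_curv: "y \<in> V \<Longrightarrow> riem_curv G y a b w = (c * ip (G y) b w) *\<^sub>R a - (c * ip (G y) a w) *\<^sub>R b"
begin

abbreviation g :: "real^'m \<Rightarrow> real^'n \<Rightarrow> real^'n \<Rightarrow> real" where "g x \<equiv> ip (G (F x))"
abbreviation D :: "real^'m \<Rightarrow> (real^'m \<Rightarrow> real^'n) \<Rightarrow> real^'m \<Rightarrow> real^'n" where "D \<equiv> nabla G F"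
abbreviation E :: "real^'m \<Rightarrow> real^'m \<Rightarrow> real^'n" where "E u \<equiv> dir_deriv u F"

text \<open>The field \<open>dF(Au)\<close>.  Defining it by the covariant derivative makes it smooth and meaningful before the matrix \<open>A\<close> of
  the shape operator is available.\<close>

definition S :: "real^'m \<Rightarrow> real^'m \<Rightarrow> real^'n" where "S u = (\<lambda>x. - nabla G F u \<eta> x)"

lemma F_in_V: "x \<in> U \<Longrightarrow> F x \<in> V"
  using F_maps by auto

lemma g_commute: "x \<in> U \<Longrightarrow> g x a b = g x b a"
  by (rule ip_commute[OF F_in_V])

lemma smooth_E: "smooth_on (E u) U"
  by (rule smooth_on_dir_deriv[OF open_U smooth_F])

lemma smooth_S: "smooth_on (S u) U"
  unfolding S_def by (intro smooth_on_minus open_U smooth_on_nabla[OF open_U F_maps smooth_F smooth_eta])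

lemma smooth_D: "smooth_on X U \<Longrightarrow> smooth_on (D u X) U"
  by (rule smooth_on_nabla[OF open_U F_maps smooth_F])

lemma smooth_g: "smooth_on X U \<Longrightarrow> smooth_on Y U \<Longrightarrow> smooth_on (\<lambda>x. g x (X x) (Y x)) U"
  by (rule smooth_on_ip[OF open_U smooth_on_compose[OF open_U F_maps smooth_F smooth_G]])

lemma dir_deriv_g:
  "x \<in> U \<Longrightarrow> smooth_on X U \<Longrightarrow> smooth_on Y U \<Longrightarrow>
    dir_deriv u (\<lambda>y. g y (X y) (Y y)) x = g x (D u X x) (Y x) + g x (X x) (D u Y x)"
  using nabla_metric[of F x X Y u] F_in_V smooth_on_differentiable smooth_F by blast

lemma E_linear:
  assumes "x \<in> U"
  shows "E (u + v) x = E u x + E v x" "E (r *\<^sub>R u) x = r *\<^sub>R E u x" "E 0 x = 0" "E (u - v) x = E u x - E v x"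
  using dir_deriv_linear[OF smooth_on_differentiable[OF smooth_F assms]] by auto

lemma S_linear:
  assumes x: "x \<in> U"
  shows "S (u + v) x = S u x + S v x" "S (r *\<^sub>R u) x = r *\<^sub>R S u x"
proof -
  have d: "\<eta> differentiable at x" "F differentiable at x"
    by (rule smooth_on_differentiable[OF smooth_eta x], rule smooth_on_differentiable[OF smooth_F x])
  show "S (u + v) x = S u x + S v x" "S (r *\<^sub>R u) x = r *\<^sub>R S u x"
    using nabla_direction_linear[of F x \<eta>, OF F_in_V[OF x] d] by (simp_all add: S_def)
qed

lemma S_normal: "x \<in> U \<Longrightarrow> g x (S u x) (\<eta> x) = 0"
proof -
  assume x: "x \<in> U"
  have "dir_deriv u (\<lambda>y. g y (\<eta> y) (\<eta> y)) x = dir_deriv u (\<lambda>y. 1) x"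
    by (rule dir_deriv_cong[OF open_U x]) (rule eta_unit)
  then show ?thesis
    using g_commute[OF x, of "\<eta> x" "D u \<eta> x"] by (simp add: dir_deriv_g[OF x smooth_eta smooth_eta] S_def)
qed

lemma E_eq_0_iff: "x \<in> U \<Longrightarrow> E u x = 0 \<longleftrightarrow> u = 0"
  using immersion[of x] E_linear(3)[of x] by (metis injD)

lemma g_E_pos: "x \<in> U \<Longrightarrow> u \<noteq> 0 \<Longrightarrow> g x (E u x) (E u x) > 0"
  using positive_G[OF F_in_V] E_eq_0_iff by blast

lemma E_normal: "x \<in> U \<Longrightarrow> g x (E u x) (\<eta> x) = 0"
  using eta_normal g_commute by metis

lemma tangent_normal_span:
  assumes x: "x \<in> U"
  shows "span (insert (\<eta> x) (range (\<lambda>u. E u x))) = UNIV"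
proof -
  have lin: "linear (\<lambda>u. E u x)" by (rule linearI) (auto simp: E_linear[OF x])
  let ?T = "range (\<lambda>u. E u x)"
  have T: "subspace ?T" using linear_subspace_image[OF lin subspace_UNIV] .
  then have sT: "span ?T = ?T" by (simp add: span_eq_iff)
  have "\<eta> x \<notin> span ?T"
  proof
    assume "\<eta> x \<in> span ?T"
    then obtain u where "\<eta> x = E u x" unfolding sT by auto
    then show False using eta_normal[OF x, of u] eta_unit[OF x] by simp
  qed
  then have "dim (insert (\<eta> x) ?T) = dim ?T + 1" by (simp add: dim_insert)
  also have "dim ?T = CARD('m)"
    using dim_image_eq[OF lin] immersion[OF x] by (metis dim_UNIV DIM_cart DIM_real inj_on_subset mult.right_neutral subset_UNIV span_UNIV)
  finally have "dim (insert (\<eta> x) ?T) = DIM(real^'n)" using codim by simp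
  then show ?thesis using dim_eq_full by blast
qed

text \<open>The ambient vectors along the hypersurface are spanned by the tangent vectors and the normal.\<close>

lemma tangent_normal_eqI:
  assumes x: "x \<in> U" and E: "\<And>v. g x a (E v x) = g x b (E v x)" and n: "g x a (\<eta> x) = g x b (\<eta> x)"
  shows "a = b"
proof (rule ip_nondegenerate[OF F_in_V[OF x]])
  fix w
  have "w \<in> span (insert (\<eta> x) (range (\<lambda>u. E u x)))" using tangent_normal_span[OF x] by simp
  then show "g x a w = g x b w"
    by (induction rule: span_induct_alt) (use E n in auto)
qed

text \<open>The fields \<open>S u\<close> are orthogonal to \<open>\<eta>\<close>, hence tangent.\<close>

lemma weingarten_map_exists:
  assumes x: "x \<in> U"
  shows "\<exists>B. \<forall>u. E (B *v u) x = S u x"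
proof -
  have lin: "linear (\<lambda>u. E u x)" by (rule linearI) (auto simp: E_linear[OF x])
  have "\<exists>w. E w x = S u x" for u
  proof -
    have sT: "span (range (\<lambda>u. E u x)) = range (\<lambda>u. E u x)"
      using linear_subspace_image[OF lin subspace_UNIV] by (simp add: span_eq_iff)
    have "S u x \<in> span (insert (\<eta> x) (range (\<lambda>u. E u x)))" using tangent_normal_span[OF x] by simp
    then obtain k w where kw: "S u x - k *\<^sub>R \<eta> x = E w x"
      unfolding span_insert sT by auto
    have "g x (S u x - k *\<^sub>R \<eta> x) (\<eta> x) = 0" unfolding kw by (rule E_normal[OF x])
    then have "k = 0" using S_normal[OF x] eta_unit[OF x] by simp
    then show ?thesis using kw by (intro exI[of _ w]) simp
  qed
  then obtain w where w: "\<And>u. E (w u) x = S u x" by metis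
  have inj: "E a x = E b x \<Longrightarrow> a = b" for a b using immersion[OF x] by (auto dest: injD)
  have "linear w"
    by (rule linearI; rule inj) (simp_all add: w E_linear[OF x] S_linear[OF x])
  then have "matrix w *v u = w u" for u by (simp add: matrix_works linear_matrix_vector_mul_eq)
  then show ?thesis using w by (intro exI[of _ "matrix w"]) simp
qed

text \<open>Both sides are equal to \<open>\<langle>\<eta>, \<nabla>\<^sub>u dF(v)\<rangle>\<close>, which is symmetric because the connection has no torsion.\<close>

lemma S_sym: "x \<in> U \<Longrightarrow> g x (S u x) (E v x) = g x (S v x) (E u x)"
proof -
  assume x: "x \<in> U"
  have *: "g x (S u x) (E v x) = g x (\<eta> x) (D u (E v) x)" for u v
  proof -
    have "dir_deriv u (\<lambda>y. g y (\<eta> y) (E v y)) x = dir_deriv u (\<lambda>y. 0) x"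
      by (rule dir_deriv_cong[OF open_U x]) (rule eta_normal)
    then have "g x (D u \<eta> x) (E v x) + g x (\<eta> x) (D u (E v) x) = 0"
      by (simp add: dir_deriv_g[OF x smooth_eta smooth_E])
    then show ?thesis by (simp add: S_def)
  qed
  show ?thesis unfolding * using nabla_torsion_free[OF open_U x F_maps smooth_F, of u v] by simp
qed

lemma D_E_commute: "x \<in> U \<Longrightarrow> D u (E v) x = D v (E u) x"
  by (rule nabla_torsion_free[OF open_U _ F_maps smooth_F])

lemma ricci_along:
  "x \<in> U \<Longrightarrow> smooth_on X U \<Longrightarrow> D u (D v X) x - D v (D u X) x
    = (c * g x (E v x) (X x)) *\<^sub>R E u x - (c * g x (E u x) (X x)) *\<^sub>R E v x"
  using ricci_identity[OF open_U _ F_maps smooth_F] const_curv[OF F_in_V] by simp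

text \<open>The curvature \<open>R(dF(u), dF(v))\<eta>\<close> vanishes, because \<open>\<eta>\<close> is orthogonal to the tangent vectors.\<close>

lemma codazzi: "x \<in> U \<Longrightarrow> D u (S v) x = D v (S u) x"
proof -
  assume x: "x \<in> U"
  have "D u (S v) x = - D u (D v \<eta>) x" for u v
    unfolding S_def
    by (rule nabla_minus[where F=F, OF F_in_V[OF x]]) (rule smooth_on_differentiable[OF smooth_D[OF smooth_eta] x])
  then show ?thesis
    using ricci_along[OF x smooth_eta, of u v] E_normal[OF x] by simp
qed

end

locale hypersurface_patch = immersed_patch G V U F \<eta> c
  for G :: "real^'n::finite \<Rightarrow> real^'n^'n" and V and U :: "(real^'m::finite) set" and F \<eta> and c +
  fixes A :: "real^'m \<Rightarrow> real^'m^'m"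
  assumes weingarten: "x \<in> U \<Longrightarrow> dir_deriv (A x *v u) F x = - nabla G F u \<eta> x"
begin

lemma S_eq: "x \<in> U \<Longrightarrow> S u x = E (A x *v u) x"
  by (simp add: S_def weingarten)

end

section \<open>Gradients that are principal directions\<close>

text \<open>In the application \<open>s\<close> is \<open>7/2\<close> times the mean curvature, which gives the principal curvature of the
  gradient \<open>\<xi>\<close> of \<open>s\<close> the simple form \<open>-s\<close>.\<close>

locale biconservative_patch = hypersurface_patch G V U F \<eta> c A
  for G :: "real^'n::finite \<Rightarrow> real^'n^'n" and V and U :: "(real^'m::finite) set" and F \<eta> c A +
  fixes s :: "real^'m \<Rightarrow> real" and \<xi> :: "real^'m \<Rightarrow> real^'m"
  assumes smooth_s: "smooth_on s U" and smooth_xi: "smooth_on \<xi> U"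
    and xi_gradient: "x \<in> U \<Longrightarrow> ip (G (F x)) (dir_deriv (\<xi> x) F x) (dir_deriv u F x) = dir_deriv u s x"
    and xi_principal: "x \<in> U \<Longrightarrow> A x *v \<xi> x = - s x *\<^sub>R \<xi> x"
    and xi_nonzero: "x \<in> U \<Longrightarrow> \<xi> x \<noteq> 0"
begin

text \<open>The gradient as an ambient vector field along the hypersurface.  The tangent part of its covariant
  derivative is the Hessian of \<open>s\<close>.\<close>

definition Xi :: "real^'m \<Rightarrow> real^'n" where "Xi x = E (\<xi> x) x"

abbreviation ds :: "real^'m \<Rightarrow> real^'m \<Rightarrow> real" where "ds u \<equiv> dir_deriv u s"

definition N :: "real^'m \<Rightarrow> real" where "N x = g x (Xi x) (Xi x)"

lemma smooth_Xi: "smooth_on Xi U"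
  unfolding Xi_def by (rule smooth_on_dir_deriv_field[OF open_U smooth_F smooth_xi])

lemma smooth_ds: "smooth_on (ds u) U"
  by (rule smooth_on_dir_deriv[OF open_U smooth_s])

lemma N_pos: "x \<in> U \<Longrightarrow> N x > 0"
  unfolding N_def Xi_def by (rule g_E_pos[OF _ xi_nonzero])

lemma smooth_N: "smooth_on N U"
  unfolding N_def by (rule smooth_g[OF smooth_Xi smooth_Xi])

lemma ds_xi: "x \<in> U \<Longrightarrow> ds (\<xi> x) x = N x"
  using xi_gradient[of x "\<xi> x"] by (simp add: N_def Xi_def)

lemma Xi_E: "x \<in> U \<Longrightarrow> g x (Xi x) (E u x) = ds u x"
  unfolding Xi_def by (rule xi_gradient)

lemma S_xi: "x \<in> U \<Longrightarrow> S (\<xi> x) x = - s x *\<^sub>R Xi x"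
  using xi_principal[of x] E_linear(2)[of x "- s x" "\<xi> x"] by (simp add: S_eq Xi_def)

lemma Xi_S: "x \<in> U \<Longrightarrow> g x (Xi x) (S u x) = - s x * ds u x"
  using S_sym[of x u "\<xi> x"] S_xi[of x] Xi_E[of x u] g_commute[of x "Xi x" "S u x"]
  by (simp add: Xi_def)

lemma D_Xi_E:
  assumes x: "x \<in> U"
  shows "g x (D u Xi x) (E v x) + g x (Xi x) (D u (E v) x) = dir_deriv u (ds v) x"
  using dir_deriv_g[OF x smooth_Xi smooth_E, of u v]
    dir_deriv_cong[OF open_U x, of "\<lambda>y. g y (Xi y) (E v y)" "ds v" u] Xi_E by simp

lemma D_Xi_S:
  assumes x: "x \<in> U"
  shows "g x (D u Xi x) (S v x) + g x (Xi x) (D u (S v) x) = - ds u x * ds v x - s x * dir_deriv u (ds v) x"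
proof -
  have "dir_deriv u (\<lambda>y. g y (Xi y) (S v y)) x = dir_deriv u (\<lambda>y. - s y * ds v y) x"
    by (rule dir_deriv_cong[OF open_U x]) (rule Xi_S)
  also have "\<dots> = - s x * dir_deriv u (ds v) x + - ds u x * ds v x"
    by (rule dir_deriv_eqI[OF has_derivative_mult[OF has_derivative_minus[OF
          smooth_on_has_derivative[OF smooth_s x]] smooth_on_has_derivative[OF smooth_ds x]]])
  finally show ?thesis by (simp add: dir_deriv_g[OF x smooth_Xi smooth_S])
qed

lemma hessian_sym: "x \<in> U \<Longrightarrow> g x (D u Xi x) (E v x) = g x (D v Xi x) (E u x)"
  using D_Xi_E[of x u v] D_Xi_E[of x v u] D_E_commute[of x u v] dir_deriv_commute_real[OF open_U smooth_s, of x u v]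
  by simp

text \<open>The Hessian commutes with the shape operator: differentiate \<open>\<langle>Xi, S v\<rangle> = -s ds(v)\<close>; by the Codazzi
  equation all other terms are symmetric in \<open>u\<close> and \<open>v\<close>.\<close>

lemma hessian_S_sym: "x \<in> U \<Longrightarrow> g x (D u Xi x) (S v x) = g x (D v Xi x) (S u x)"
  using D_Xi_S[of x u v] D_Xi_S[of x v u] codazzi[of x u v] dir_deriv_commute_real[OF open_U smooth_s, of x u v]
  by (simp add: mult.commute)

lemma Xi_normal: "x \<in> U \<Longrightarrow> g x (Xi x) (\<eta> x) = 0"
  unfolding Xi_def by (rule E_normal)

lemma D_Xi_normal:
  assumes x: "x \<in> U"
  shows "g x (D u Xi x) (\<eta> x) = - s x * ds u x"
proof -
  have "dir_deriv u (\<lambda>y. g y (Xi y) (\<eta> y)) x = dir_deriv u (\<lambda>y. 0) x"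
    by (rule dir_deriv_cong[OF open_U x]) (rule Xi_normal)
  then have "g x (D u Xi x) (\<eta> x) = g x (Xi x) (S u x)"
    by (simp add: dir_deriv_g[OF x smooth_Xi smooth_eta] S_def)
  then show ?thesis using Xi_S[OF x] by simp
qed

text \<open>With \<open>A\<close> the shape operator this says \<open>\<nabla>\<^sub>\<xi> A = - ds \<otimes> ds - (s + A) Hess s\<close>.  By the Codazzi equation the
  derivative of \<open>A\<close> in the direction \<open>\<xi>\<close> is obtained from its values on \<open>\<xi>\<close>, where \<open>A\<xi> = -s\<xi>\<close> can be
  differentiated.\<close>

lemma shape_derivative_along_gradient:
  assumes x: "x \<in> U"
  shows "g x (D (\<xi> x) (S u) x) (E v x) - g x (S v x) (D (\<xi> x) (E u) x)
    = - ds u x * ds v x - s x * g x (D u Xi x) (E v x) - g x (D u Xi x) (S v x)"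
proof -
  define r where "r = \<xi> x"
  have "dir_deriv u (\<lambda>y. g y (S r y) (E v y)) x = dir_deriv u (\<lambda>y. g y (S v y) (E r y)) x"
    by (rule dir_deriv_cong[OF open_U x]) (rule S_sym)
  then have "g x (D u (S r) x) (E v x) + g x (S r x) (D u (E v) x)
      = g x (D u (S v) x) (E r x) + g x (S v x) (D u (E r) x)"
    by (simp add: dir_deriv_g[OF x smooth_S smooth_E])
  moreover have "S r x = - s x *\<^sub>R Xi x" "E r x = Xi x" by (simp_all add: r_def S_xi[OF x] Xi_def)
  ultimately have "g x (D r (S u) x) (E v x) - g x (S v x) (D r (E u) x)
      = g x (Xi x) (D u (S v) x) + s x * g x (Xi x) (D u (E v) x)"
    using g_commute[OF x, of "Xi x" "D u (S v) x"] codazzi[OF x, of u r] D_E_commute[OF x, of u r] by simp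
  also have "g x (Xi x) (D u (S v) x) = - ds u x * ds v x - s x * dir_deriv u (ds v) x - g x (D u Xi x) (S v x)"
    using D_Xi_S[OF x, of u v] by simp
  also have "g x (Xi x) (D u (E v) x) = dir_deriv u (ds v) x - g x (D u Xi x) (E v x)"
    using D_Xi_E[OF x, of u v] by simp
  finally show ?thesis by (simp add: r_def algebra_simps)
qed

text \<open>Let \<open>u\<close> be an eigenvector for \<open>-s\<close> orthogonal to the gradient.  The formula for \<open>\<nabla>\<^sub>\<xi> A\<close> gives
  \<open>\<langle>(\<nabla>\<^sub>\<xi> A)u, u\<rangle> = 0\<close>, whereas differentiating the eigenvalue equation along \<open>\<xi>\<close> gives
  \<open>\<langle>(\<nabla>\<^sub>\<xi> A)u, u\<rangle> = -N\<langle>u, u\<rangle>\<close>.  The eigenvectors near \<open>x0\<close> are merely assumed to exist, not to depend smoothly on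
  the point; therefore the derivative is computed as a limit of difference quotients along a
  sequence of points at which unit eigenvectors converge.\<close>

lemma double_principal_curvature_impossible:
  assumes W: "open W" "W \<subseteq> U" "x0 \<in> W"
    and ker: "\<And>x. x \<in> W \<Longrightarrow> \<exists>u. u \<noteq> 0 \<and> A x *v u = - s x *\<^sub>R u \<and> ds u x = 0"
  shows False
proof -
  have x0: "x0 \<in> U" using W by auto
  define r where "r = \<xi> x0"
  \<comment> \<open>The bilinear form \<open>\<langle>(A + s)a, w\<rangle>\<close>; its kernel is the eigenspace of \<open>-s\<close>.\<close>
  define b where "b a w x = g x (S a x) (E w x) + s x * g x (E a x) (E w x)" for a w x
  have smooth_b: "smooth_on (b a w) U" for a w
    unfolding b_def by (intro smooth_on_add smooth_on_mult smooth_g smooth_S smooth_E smooth_s open_U)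
  have b_sym: "b a w x = b w a x" if "x \<in> U" for a w x
    using S_sym[OF that, of a w] g_commute[OF that, of "E a x" "E w x"] by (simp add: b_def)
  have b_linear: "linear (\<lambda>a. b a w x)" if "x \<in> U" for w x
    by (rule linearI) (simp_all add: b_def S_linear[OF that] E_linear[OF that] algebra_simps)
  have b_expand: "b a w x = (\<Sum>i\<in>UNIV. a $ i * b (axis i 1) w x)" if "x \<in> U" for a w x
    using linear_expand_axis[OF b_linear[OF that], of a w] by simp
  have ds_expand: "ds a x = (\<Sum>i\<in>UNIV. a $ i * ds (axis i 1) x)" if "x \<in> U" for a x
    using dir_deriv_field_expand[OF smooth_s that, of a] by simp
  define line where "line t = x0 + t *\<^sub>R r" for t
  have line_der: "(line has_derivative (\<lambda>t. t *\<^sub>R r)) (at 0)"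
    unfolding line_def by (auto intro!: derivative_eq_intros)
  have "isCont line 0" using has_derivative_continuous[OF line_der] .
  moreover have "(\<lambda>n. inverse (real (Suc n))) \<longlonglongrightarrow> 0" by (rule LIMSEQ_inverse_real_of_nat)
  ultimately have lim: "(\<lambda>n. line (inverse (real (Suc n)))) \<longlonglongrightarrow> x0"
    using isCont_tendsto_compose[of 0 line] by (simp add: line_def)
  then have "\<forall>\<^sub>F n in sequentially. line (inverse (real (Suc n))) \<in> W"
    using W topological_tendstoD by blast
  then obtain n0 where n0: "\<And>n. n \<ge> n0 \<Longrightarrow> line (inverse (real (Suc n))) \<in> W"
    by (auto simp: eventually_sequentially)
  define t where "t n = inverse (real (Suc (n + n0)))" for n
  have t: "t \<longlonglongrightarrow> 0" "t n > 0" "line (t n) \<in> W" for n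
  proof -
    show "t \<longlonglongrightarrow> 0"
      using LIMSEQ_ignore_initial_segment[OF LIMSEQ_inverse_real_of_nat, of n0] unfolding t_def .
    show "t n > 0" by (simp add: t_def)
    show "line (t n) \<in> W" unfolding t_def by (rule n0) simp
  qed
  have "\<exists>u. norm u = 1 \<and> A (line (t n)) *v u = - s (line (t n)) *\<^sub>R u \<and> ds u (line (t n)) = 0" for n
  proof -
    obtain v where v: "v \<noteq> 0" "A (line (t n)) *v v = - s (line (t n)) *\<^sub>R v" "ds v (line (t n)) = 0"
      using ker[OF t(3)] by blast
    have "line (t n) \<in> U" using t(3) W by auto
    then have "ds ((1 / norm v) *\<^sub>R v) (line (t n)) = 0"
      using v(3) dir_deriv_linear(2)[OF smooth_on_differentiable[OF smooth_s]] by simp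
    then show ?thesis using v
      by (intro exI[of _ "(1 / norm v) *\<^sub>R v"]) (simp add: matrix_vector_mult_scaleR mult.commute)
  qed
  then obtain w where w: "\<And>n. norm (w n) = 1" "\<And>n. A (line (t n)) *v w n = - s (line (t n)) *\<^sub>R w n"
    "\<And>n. ds (w n) (line (t n)) = 0" by metis
  have "compact (sphere (0::real^'m) 1)" by simp
  then obtain u k where u: "u \<in> sphere 0 1" and k: "strict_mono k" and wu: "(w \<circ> k) \<longlonglongrightarrow> u"
    using w(1) unfolding compact_def by (metis dist_0_norm mem_sphere)
  have tk: "(t \<circ> k) \<longlonglongrightarrow> 0" using LIMSEQ_subseq_LIMSEQ[OF t(1) k] .
  have wi: "(\<lambda>n. w (k n) $ i) \<longlonglongrightarrow> u $ i" for i using tendsto_vec_nth[OF wu] by simp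
  have lim0: "(\<lambda>n. line (t (k n))) \<longlonglongrightarrow> x0"
    using isCont_tendsto_compose[OF \<open>isCont line 0\<close> tk] by (simp add: line_def)
  have inU: "line (t n) \<in> U" for n using t(3) W by auto
  have cont: "(\<lambda>n. h (line (t (k n)))) \<longlonglongrightarrow> h x0" if "smooth_on h U" for h :: "real^'m \<Rightarrow> real"
  proof -
    have "isCont h x0"
      using smooth_on_continuous_on[OF that] x0 open_U by (simp add: continuous_on_eq_continuous_at)
    from isCont_tendsto_compose[OF this lim0] show ?thesis .
  qed
  have bw: "b (w n) v (line (t n)) = 0" for n v
    using w(2)[of n] E_linear(2)[OF inU, of "- s (line (t n))" "w n" n] by (simp add: b_def S_eq[OF inU])
  have bu: "b u v x0 = 0" for v
  proof -
    have "(\<lambda>n. \<Sum>i\<in>UNIV. w (k n) $ i * b (axis i 1) v (line (t (k n)))) \<longlonglongrightarrow> (\<Sum>i\<in>UNIV. u $ i * b (axis i 1) v x0)"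
      by (intro tendsto_sum tendsto_mult wi cont smooth_b)
    then have "(\<lambda>n. 0) \<longlonglongrightarrow> b u v x0"
      using bw by (simp add: b_expand[OF inU, symmetric] b_expand[OF x0, symmetric])
    then show ?thesis by (simp add: LIMSEQ_const_iff)
  qed
  have dsu: "ds u x0 = 0"
  proof -
    have "(\<lambda>n. \<Sum>i\<in>UNIV. w (k n) $ i * ds (axis i 1) (line (t (k n)))) \<longlonglongrightarrow> (\<Sum>i\<in>UNIV. u $ i * ds (axis i 1) x0)"
      by (intro tendsto_sum tendsto_mult wi cont smooth_ds)
    then have "(\<lambda>n. 0) \<longlonglongrightarrow> ds u x0"
      using w(3) by (simp add: ds_expand[OF inU, symmetric] ds_expand[OF x0, symmetric])
    then show ?thesis by (simp add: LIMSEQ_const_iff)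
  qed
  have quot: "(\<lambda>n. (h (line (t (k n))) - h x0) / t (k n)) \<longlonglongrightarrow> dir_deriv r h x0"
    if h: "smooth_on h U" for h :: "real^'m \<Rightarrow> real"
  proof -
    have d: "h differentiable at x0" by (rule smooth_on_differentiable[OF h x0])
    have "((\<lambda>t. h (line t)) has_derivative (\<lambda>t. dir_deriv (t *\<^sub>R r) h x0)) (at 0)"
      by (rule has_derivative_compose[OF line_der, of h "\<lambda>u. dir_deriv u h x0"])
        (use has_derivative_dir_deriv[OF d] in \<open>simp add: line_def\<close>)
    then have "((\<lambda>t. h (line t)) has_real_derivative dir_deriv r h x0) (at 0)"
      unfolding has_field_derivative_def dir_deriv_linear(2)[OF d] by (simp add: mult_commute_abs)
    then have "((\<lambda>t. (h (line t) - h x0) / t) \<longlongrightarrow> dir_deriv r h x0) (at 0)"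
      unfolding DERIV_def by (simp add: line_def)
    moreover have "filterlim (t \<circ> k) (at 0) sequentially"
      unfolding filterlim_at using tk t(2) by (auto intro!: always_eventually simp: less_imp_neq[THEN not_sym])
    ultimately show ?thesis using filterlim_compose by fastforce
  qed
  \<comment> \<open>\<open>b (w (k n)) u\<close> is zero at \<open>line (t (k n))\<close> by the choice of \<open>w\<close> and at \<open>x0\<close> because \<open>u\<close> is in the kernel
    there, so all difference quotients vanish.\<close>
  have "dir_deriv r (b u u) x0 = 0"
  proof -
    have "(\<lambda>n. \<Sum>i\<in>UNIV. w (k n) $ i * ((b (axis i 1) u (line (t (k n))) - b (axis i 1) u x0) / t (k n)))
       \<longlonglongrightarrow> (\<Sum>i\<in>UNIV. u $ i * dir_deriv r (b (axis i 1) u) x0)"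
      by (intro tendsto_sum tendsto_mult wi quot smooth_b)
    moreover have "(\<Sum>i\<in>UNIV. w (k n) $ i * ((b (axis i 1) u (line (t (k n))) - b (axis i 1) u x0) / t (k n)))
       = (b (w (k n)) u (line (t (k n))) - b (w (k n)) u x0) / t (k n)" for n
      unfolding b_expand[OF inU, of "w (k n)"] b_expand[OF x0, of "w (k n)"]
      by (simp add: sum_subtractf[symmetric] sum_divide_distrib right_diff_distrib)
    moreover have "b (w (k n)) u x0 = 0" for n using b_sym[OF x0] bu by metis
    ultimately have "(\<lambda>n. 0) \<longlonglongrightarrow> (\<Sum>i\<in>UNIV. u $ i * dir_deriv r (b (axis i 1) u) x0)"
      by (simp add: bw)
    then have "(\<Sum>i\<in>UNIV. u $ i * dir_deriv r (b (axis i 1) u) x0) = 0"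
      by (simp add: LIMSEQ_const_iff)
    moreover have "dir_deriv r (b u u) x0 = (\<Sum>i\<in>UNIV. u $ i * dir_deriv r (b (axis i 1) u) x0)"
    proof -
      have "dir_deriv r (b u u) x0 = dir_deriv r (\<lambda>x. \<Sum>i\<in>UNIV. u $ i * b (axis i 1) u x) x0"
        by (rule dir_deriv_cong[OF open_U x0]) (rule b_expand)
      also have "\<dots> = (\<Sum>i\<in>UNIV. u $ i * dir_deriv r (b (axis i 1) u) x0)"
        by (rule dir_deriv_eqI)
          (rule has_derivative_sum, rule has_derivative_mult_right, rule smooth_on_has_derivative[OF smooth_b x0])
      finally show ?thesis .
    qed
    ultimately show ?thesis by simp
  qed
  moreover have "dir_deriv r (b u u) x0 = N x0 * g x0 (E u x0) (E u x0)"
  proof -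
    have Su: "S u x0 = - s x0 *\<^sub>R E u x0"
    proof (rule tangent_normal_eqI[OF x0])
      show "g x0 (S u x0) (E v x0) = g x0 (- s x0 *\<^sub>R E u x0) (E v x0)" for v
        using bu[of v] by (simp add: b_def)
      show "g x0 (S u x0) (\<eta> x0) = g x0 (- s x0 *\<^sub>R E u x0) (\<eta> x0)"
        by (simp add: S_normal[OF x0] E_normal[OF x0])
    qed
    have "dir_deriv r (b u u) x0 = dir_deriv r (\<lambda>x. g x (S u x) (E u x)) x0
       + (s x0 * dir_deriv r (\<lambda>x. g x (E u x) (E u x)) x0 + ds r x0 * g x0 (E u x0) (E u x0))"
      unfolding b_def
      by (rule dir_deriv_eqI[OF has_derivative_add[OF smooth_on_has_derivative[OF smooth_g[OF smooth_S smooth_E] x0]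
          has_derivative_mult[OF smooth_on_has_derivative[OF smooth_s x0] smooth_on_has_derivative[OF smooth_g[OF smooth_E smooth_E] x0]]]])
    then show ?thesis
      using shape_derivative_along_gradient[OF x0, of u u] dsu ds_xi[OF x0]
        g_commute[OF x0, of "D r (E u) x0" "E u x0"]
      by (simp add: dir_deriv_g[OF x0] smooth_S smooth_E Su r_def algebra_simps)
  qed
  moreover have "u \<noteq> 0" using u by auto
  ultimately show False using N_pos[OF x0] g_E_pos[OF x0, of u] by simp
qed

end

section \<open>Elimination of the Hessian and of the gradient\<close>

text \<open>Here \<open>\<alpha>\<close> is the eigenvalue of the Hessian on the eigenspace of the principal curvature \<open>(s + D)/2\<close>, \<open>h\<close> its
  eigenvalue on the gradient, \<open>N\<close> the squared length of the gradient, and primes denote derivatives along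
  the gradient.  Inserting the known value of \<open>\<alpha>\<close> into its Riccati equation leaves an equation linear
  in \<open>h\<close> and \<open>N\<close>.  The principal curvature \<open>(s - D)/2\<close> is covered by the substitution of \<open>-D\<close> for \<open>D\<close>.\<close>

lemma riccati_row:
  fixes s D N h c \<alpha> \<alpha>' D' :: real
  assumes D: "7 * D^2 = 32 * c - 5 * s^2" and N: "N \<noteq> 0"
    and DD': "7 * D * D' = - 5 * s * N"
    and \<alpha>: "\<alpha> * (7 * D * (3 * s + D)) = - N * (7 * D - 5 * s)"
    and d: "\<alpha>' * (7 * D * (3 * s + D)) + \<alpha> * (7 * (D' * (3 * s + D) + D * (3 * N + D')))
       = - (2 * h * N * (7 * D - 5 * s) + N * (7 * D' - 5 * N))"
    and ric: "\<alpha>' = h * \<alpha> - \<alpha>^2 - N * (c - s * ((s + D) / 2))"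
  shows "h * (49 * D^4 + 112 * s * D^3 - 105 * s^2 * D^2)
    = N * (231 * D^3 - 105 * s * D^2 + 75 * s^2 * D + 75 * s^3)
     + (343 / 32 * D^7 + 637 / 16 * s * D^6 - 539 / 8 * s^2 * D^5 - 5145 / 16 * s^3 * D^4 - 4851 / 32 * s^4 * D^3)"
proof -
  define m where "m = 7 * D * (3 * s + D)"
  define n where "n = 7 * D - 5 * s"
  define k where "k = 7 * (D' * (3 * s + D) + D * (3 * N + D'))"
  define n' where "n' = 7 * D' - 5 * N"
  have c: "c = (7 * D^2 + 5 * s^2) / 32" using D by simp
  have am: "\<alpha> * m = - N * n" using \<alpha> by (simp add: m_def n_def)
  have "\<alpha>' * m^2 = h * (\<alpha> * m) * m - (\<alpha> * m)^2 - N * (c - s * ((s + D) / 2)) * m^2"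
    unfolding ric by (simp add: algebra_simps power2_eq_square)
  then have 1: "\<alpha>' * m^2 = h * (- N * n) * m - (- N * n)^2 - N * (c - s * ((s + D) / 2)) * m^2"
    unfolding am .
  have "\<alpha>' * m^2 + (\<alpha> * m) * k = - (2 * h * N * n + N * n') * m"
    using arg_cong[OF d, of "\<lambda>z. z * m"] by (simp add: m_def n_def k_def n'_def algebra_simps power2_eq_square)
  then have 2: "\<alpha>' * m^2 + (- N * n) * k = - (2 * h * N * n + N * n') * m"
    unfolding am .
  have "N * (h * n * m - N * n^2 - (c - s * ((s + D) / 2)) * m^2 - n * k + n' * m)
    = h * (- N * n) * m - (- N * n)^2 - N * (c - s * ((s + D) / 2)) * m^2 + (- N * n) * k
      + (2 * h * N * n + N * n') * m"
    by (simp add: algebra_simps power2_eq_square)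
  also have "\<dots> = 0" using 1 2 by linarith
  finally have "N * (h * n * m - N * n^2 - (c - s * ((s + D) / 2)) * m^2 - n * k + n' * m) = 0" .
  then have "h * n * m - N * n^2 - (c - s * ((s + D) / 2)) * m^2 - n * k + n' * m = 0"
    using N by simp
  from arg_cong[OF this, of "\<lambda>z. D * z"]
  have "D * (h * n * m - N * n^2 - (c - s * ((s + D) / 2)) * m^2) - n * (D * k) + (D * n') * m = 0"
    by (simp only: right_diff_distrib distrib_left mult_zero_right mult.left_commute[of D n k] mult.assoc[of D n' m])
  moreover have "D * k = - 5 * s * N * (3 * s + 2 * D) + 21 * D^2 * N"
    using arg_cong[OF DD', of "\<lambda>z. z * (3 * s + 2 * D)"] by (simp add: k_def algebra_simps power2_eq_square)
  moreover have "D * n' = - 5 * s * N - 5 * N * D"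
    using DD' by (simp add: n'_def algebra_simps)
  ultimately show ?thesis
    unfolding m_def n_def c by (simp add: field_simps eval_nat_numeral)
qed

text \<open>The difference and the sum of the two rows depend on \<open>D\<close> through \<open>D\<^sup>2\<close> only, up to a factor \<open>D\<close>.  The
  difference is the first claim, and eliminating \<open>h\<close> between both gives the second.\<close>

lemma gradient_norm_relation:
  fixes s D N h :: real
  assumes D: "D \<noteq> 0"
    and row1: "h * (49 * D^4 + 112 * s * D^3 - 105 * s^2 * D^2)
    = N * (231 * D^3 - 105 * s * D^2 + 75 * s^2 * D + 75 * s^3)
     + (343 / 32 * D^7 + 637 / 16 * s * D^6 - 539 / 8 * s^2 * D^5 - 5145 / 16 * s^3 * D^4 - 4851 / 32 * s^4 * D^3)"
    and row2: "h * (49 * D^4 - 112 * s * D^3 - 105 * s^2 * D^2)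
    = N * (- 231 * D^3 - 105 * s * D^2 - 75 * s^2 * D + 75 * s^3)
     + (- 343 / 32 * D^7 + 637 / 16 * s * D^6 + 539 / 8 * s^2 * D^5 - 5145 / 16 * s^3 * D^4 + 4851 / 32 * s^4 * D^3)"
  defines "E \<equiv> D^2"
  shows "224 * s * E * h = N * (462 * E + 150 * s^2) + E * (343 / 16 * E^2 - 539 / 4 * s^2 * E - 4851 / 16 * s^4)" (is ?P)
    and "96 * N * (- 539 * E^2 + 420 * s^2 * E + 775 * s^4)
      + 7 * E * (- 343 * E^3 + 5803 * s^2 * E^2 - 23289 * s^4 * E - 10395 * s^6) = 0" (is ?T)
proof -
  have "D * (224 * s * E * h) = D * (N * (462 * E + 150 * s^2) + E * (343 / 16 * E^2 - 539 / 4 * s^2 * E - 4851 / 16 * s^4))"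
    using row1 row2 unfolding E_def by (simp add: algebra_simps eval_nat_numeral)
  then show P: ?P using D by simp
  have M: "h * E * (98 * E - 210 * s^2) = N * (150 * s^3 - 210 * s * E) + (637 / 8 * s * E^3 - 5145 / 8 * s^3 * E^2)"
    using row1 row2 unfolding E_def by (simp add: algebra_simps eval_nat_numeral)
  have "(98 * E - 210 * s^2) * (224 * s * E * h) = 224 * s * (h * E * (98 * E - 210 * s^2))"
    by simp
  then have "- 7 / 8 * (96 * N * (- 539 * E^2 + 420 * s^2 * E + 775 * s^4)
      + 7 * E * (- 343 * E^3 + 5803 * s^2 * E^2 - 23289 * s^4 * E - 10395 * s^6)) = 0"
    unfolding P M by (simp add: field_simps eval_nat_numeral)
  then show ?T by simp
qed

text \<open>Three equations linear in \<open>h\<close> and \<open>N\<close>; the polynomial is, up to the factor \<open>s\<^sup>2E\<close> and a constant, the condition for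
  their compatibility.\<close>

lemma elimination_polynomial:
  fixes s E N h :: real
  assumes E: "E \<noteq> 0"
    and P: "224 * s * E * h = N * (462 * E + 150 * s^2) + E * (343 / 16 * E^2 - 539 / 4 * s^2 * E - 4851 / 16 * s^4)"
    and T: "96 * N * (- 539 * E^2 + 420 * s^2 * E + 775 * s^4)
      + 7 * E * (- 343 * E^3 + 5803 * s^2 * E^2 - 23289 * s^4 * E - 10395 * s^6) = 0"
    and T': "192 * h * (- 539 * E^2 + 420 * s^2 * E + 775 * s^4) + 96 * N * (2380 * s * E + 2500 * s^3)
      + 7 * (13566 * s * E^3 - 118026 * s^3 * E^2 + 4170 * s^5 * E + 14850 * s^7) = 0"
  shows "s = 0 \<or> 96383 * E^4 - 630042 * s^2 * E^3 + 996520 * s^4 * E^2 + 11572050 * s^6 * E + 8078625 * s^8 = 0"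
proof -
  define \<tau> where "\<tau> = - 539 * E^2 + 420 * s^2 * E + 775 * s^4"
  define \<zeta> where "\<zeta> = - 343 * E^3 + 5803 * s^2 * E^2 - 23289 * s^4 * E - 10395 * s^6"
  define \<kappa> where "\<kappa> = 2380 * s * E + 2500 * s^3"
  define \<rho> where "\<rho> = 13566 * s * E^3 - 118026 * s^3 * E^2 + 4170 * s^5 * E + 14850 * s^7"
  define \<pi> where "\<pi> = 343 / 16 * E^2 - 539 / 4 * s^2 * E - 4851 / 16 * s^4"
  have N\<tau>: "96 * N * \<tau> = - 7 * E * \<zeta>" using T by (simp add: \<tau>_def \<zeta>_def)
  have P': "224 * s * E * h = N * (462 * E + 150 * s^2) + E * \<pi>" using P by (simp add: \<pi>_def)
  \<comment> \<open>After multiplication by this factor, \<open>h\<close> and \<open>N\<close> occur only in the left-hand sides of \<open>P'\<close> and \<open>N\<tau>\<close>.\<close>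
  have "224 * s * E * 96 * \<tau> * (192 * h * \<tau> + 96 * N * \<kappa> + 7 * \<rho>) = 0"
    using T' by (simp add: \<tau>_def \<kappa>_def \<rho>_def)
  then have "192 * \<tau> * ((462 * E + 150 * s^2) * (96 * N * \<tau>) + 96 * \<tau> * E * \<pi>)
      + 224 * s * E * 96 * \<kappa> * (96 * N * \<tau>) + 224 * s * E * 96 * 7 * \<tau> * \<rho> = 0"
  proof -
    have "192 * \<tau> * ((462 * E + 150 * s^2) * (96 * N * \<tau>) + 96 * \<tau> * E * \<pi>)
        = 192 * \<tau> * 96 * \<tau> * (224 * s * E * h)"
      unfolding P' by (simp add: algebra_simps)
    then show ?thesis
      using \<open>224 * s * E * 96 * \<tau> * (192 * h * \<tau> + 96 * N * \<kappa> + 7 * \<rho>) = 0\<close>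
      by (simp add: algebra_simps)
  qed
  then have "E * (192 * \<tau> * (- 7 * \<zeta> * (462 * E + 150 * s^2) + 96 * \<tau> * \<pi>)
      - 224 * s * E * 96 * 7 * \<kappa> * \<zeta> + 224 * s * 96 * 7 * \<tau> * \<rho>) = 0"
    unfolding N\<tau> by (simp add: algebra_simps)
  then have "192 * \<tau> * (- 7 * \<zeta> * (462 * E + 150 * s^2) + 96 * \<tau> * \<pi>)
      - 224 * s * E * 96 * 7 * \<kappa> * \<zeta> + 224 * s * 96 * 7 * \<tau> * \<rho> = 0"
    using E by simp
  moreover have "192 * \<tau> * (- 7 * \<zeta> * (462 * E + 150 * s^2) + 96 * \<tau> * \<pi>)
      - 224 * s * E * 96 * 7 * \<kappa> * \<zeta> + 224 * s * 96 * 7 * \<tau> * \<rho>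
     = 1204224 * s^2 * E * (96383 * E^4 - 630042 * s^2 * E^3 + 996520 * s^4 * E^2 + 11572050 * s^6 * E + 8078625 * s^8)"
    unfolding \<tau>_def \<zeta>_def \<kappa>_def \<rho>_def \<pi>_def by (simp add: algebra_simps eval_nat_numeral)
  ultimately show ?thesis using E by simp
qed

text \<open>After the substitution for \<open>E\<close> the coefficient of \<open>s\<^sup>8\<close> is a nonzero number independent of \<open>c\<close>.\<close>

lemma finite_elimination_roots:
  fixes c :: real
  shows "finite {s. s = 0 \<or> (let E = (32 * c - 5 * s^2) / 7 in
    96383 * E^4 - 630042 * s^2 * E^3 + 996520 * s^4 * E^2 + 11572050 * s^6 * E + 8078625 * s^8 = 0)}"
proof -
  define e :: "real poly" where "e = [: 32 * c / 7, 0, - 5 / 7 :]"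
  define x :: "real poly" where "x = [: 0, 1 :]"
  define p where "p = smult 96383 (e^4) - smult 630042 (x^2 * e^3) + smult 996520 (x^4 * e^2)
    + smult 11572050 (x^6 * e) + smult 8078625 (x^8)"
  have pe: "poly e s = (32 * c - 5 * s^2) / 7" for s by (simp add: e_def power2_eq_square)
  have px: "poly x s = s" for s by (simp add: x_def)
  have "coeff p 8 \<noteq> 0"
    unfolding p_def e_def x_def by (simp add: eval_nat_numeral algebra_simps)
  then have "p \<noteq> 0" by auto
  then have "finite {s. poly p s = 0}" by (rule poly_roots_finite)
  moreover have "{s. s = 0 \<or> (let E = (32 * c - 5 * s^2) / 7 in
    96383 * E^4 - 630042 * s^2 * E^3 + 996520 * s^4 * E^2 + 11572050 * s^6 * E + 8078625 * s^8 = 0)}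
    = insert 0 {s. poly p s = 0}"
    by (auto simp: p_def pe px Let_def)
  ultimately show ?thesis by simp
qed

section \<open>A quadratic identity for the shape operator\<close>

context biconservative_patch
begin

text \<open>If the principal curvatures other than \<open>-s\<close> are both triple and add up to \<open>s\<close>, this is the value that the relation
  between \<open>|A|\<^sup>2\<close> and \<open>f\<close> forces on their product.\<close>

definition curv_prod :: "real^'m \<Rightarrow> real" where "curv_prod x = (3 * (s x)^2 - 8 * c) / 7"

lemma S_eigen: "x \<in> U \<Longrightarrow> A x *v u = e *\<^sub>R u \<Longrightarrow> S u x = e *\<^sub>R E u x"
  by (simp add: S_eq E_linear)

lemma ds_eigen: "x \<in> U \<Longrightarrow> A x *v u = e *\<^sub>R u \<Longrightarrow> e \<noteq> - s x \<Longrightarrow> ds u x = 0"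
  using Xi_S[of x u] Xi_E[of x u] S_eigen[of x u e]
  by (simp add: distrib_right[symmetric] eq_neg_iff_add_eq_0)

text \<open>If \<open>\<lambda> + \<mu> = s\<close> and \<open>\<lambda>\<mu> = curv_prod\<close>, this is the identity
  \<open>(A - \<lambda>)(A - \<mu>) = (-s - \<lambda>)(-s - \<mu>) P\<close>, where \<open>P\<close> is the projection to the gradient, multiplied by \<open>N\<close> and written
  with inner products.  Its coefficients are continuous, even where \<open>\<lambda>\<close> and \<open>\<mu>\<close> are not eigenvalues.\<close>

definition quadratic_at :: "real^'m \<Rightarrow> bool" where
  "quadratic_at x \<longleftrightarrow> (\<forall>u v. N x * (g x (S u x) (S v x) - s x * g x (S u x) (E v x) + curv_prod x * g x (E u x) (E v x))
    = (2 * (s x)^2 + curv_prod x) * (ds u x * ds v x))"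

text \<open>Both sides are linear in \<open>u\<close>, so it is enough to compare them on eigenvectors.\<close>

lemma quadratic_at_of_eigenvalues:
  assumes x: "x \<in> U"
    and roots: "e1^2 - s x * e1 + curv_prod x = 0" "e2^2 - s x * e2 + curv_prod x = 0"
    and ne: "e1 \<noteq> - s x" "e2 \<noteq> - s x"
    and decomp: "\<And>v. \<exists>k u2 u3. v = k *\<^sub>R \<xi> x + u2 + u3 \<and> A x *v u2 = e1 *\<^sub>R u2 \<and> A x *v u3 = e2 *\<^sub>R u3"
  shows "quadratic_at x"
  unfolding quadratic_at_def
proof (intro allI)
  fix u v
  let ?L = "\<lambda>u. N x * (g x (S u x) (S v x) - s x * g x (S u x) (E v x) + curv_prod x * g x (E u x) (E v x))"
  let ?R = "\<lambda>u. (2 * (s x)^2 + curv_prod x) * (ds u x * ds v x)"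
  have e: "?L w = ?R w" if "A x *v w = e *\<^sub>R w" "e^2 - s x * e + curv_prod x = 0" "e \<noteq> - s x" for w e
  proof -
    have "g x (S w x) (S v x) - s x * g x (S w x) (E v x) + curv_prod x * g x (E w x) (E v x)
       = (e^2 - s x * e + curv_prod x) * g x (E w x) (E v x)"
      using S_sym[OF x, of v w] g_commute[OF x, of "E w x" "S v x"] g_commute[OF x, of "E w x" "E v x"]
      by (simp add: S_eigen[OF x that(1)] power2_eq_square algebra_simps)
    then show ?thesis
      using that(2) ds_eigen[OF x that(1,3)] by simp
  qed
  have xi: "?L (\<xi> x) = ?R (\<xi> x)"
    using Xi_S[OF x, of v] Xi_E[OF x, of v] ds_xi[OF x]
    by (simp add: S_xi[OF x] Xi_def[symmetric] power2_eq_square algebra_simps)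
  obtain k u2 u3 where u: "u = k *\<^sub>R \<xi> x + u2 + u3" "A x *v u2 = e1 *\<^sub>R u2" "A x *v u3 = e2 *\<^sub>R u3"
    using decomp by blast
  have lin: "?L (a + b) = ?L a + ?L b" "?R (a + b) = ?R a + ?R b"
    "?L (k *\<^sub>R a) = k * ?L a" "?R (k *\<^sub>R a) = k * ?R a" for a b
    using dir_deriv_linear[OF smooth_on_differentiable[OF smooth_s x]]
    by (simp_all add: S_linear[OF x] E_linear[OF x] algebra_simps)
  show "?L u = ?R u"
    unfolding u(1) lin using e[OF u(2) roots(1) ne(1)] e[OF u(3) roots(2) ne(2)] xi by simp
qed

text \<open>On an eigenvector orthogonal to the gradient the identity becomes a quadratic equation for the
  eigenvalue, which has no more than one root besides \<open>-s\<close>.\<close>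

lemma quadratic_at_not_double:
  assumes x: "x \<in> U" and q: "quadratic_at x"
    and u: "u \<noteq> 0" "A x *v u = - s x *\<^sub>R u" "ds u x = 0"
    and v: "v \<noteq> 0" "A x *v v = e *\<^sub>R v" "e \<noteq> - s x"
    and w: "w \<noteq> 0" "A x *v w = e' *\<^sub>R w" "e' \<noteq> - s x"
  shows "e = e'"
proof -
  have root: "e^2 - s x * e + curv_prod x = 0" if "A x *v u = e *\<^sub>R u" "u \<noteq> 0" "ds u x = 0" for u e
  proof -
    have "N x * ((e^2 - s x * e + curv_prod x) * g x (E u x) (E u x)) = 0"
      using q[unfolded quadratic_at_def, rule_format, of u u] that(3)
      by (simp add: S_eigen[OF x that(1)] power2_eq_square algebra_simps)
    then show ?thesis using N_pos[OF x] g_E_pos[OF x that(2)] by simp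
  qed
  have "e^2 - s x * e + curv_prod x = 0" "e'^2 - s x * e' + curv_prod x = 0" "(- s x)^2 - s x * (- s x) + curv_prod x = 0"
    using root[OF v(2,1) ds_eigen[OF x v(2,3)]] root[OF w(2,1) ds_eigen[OF x w(2,3)]] root[OF u(2,1,3)] by auto
  then have "(e - (- s x)) * (e + (- s x) - s x) = 0" "(e' - (- s x)) * (e' + (- s x) - s x) = 0"
    by (simp_all add: algebra_simps power2_eq_square)
  then show ?thesis using v(3) w(3) by simp
qed

lemma open_not_quadratic_at:
  assumes x: "x \<in> U" and q: "\<not> quadratic_at x"
  shows "\<exists>W. open W \<and> x \<in> W \<and> W \<subseteq> U \<and> (\<forall>y\<in>W. \<not> quadratic_at y)"
proof -
  define h where "h u v y = N y * (g y (S u y) (S v y) - s y * g y (S u y) (E v y) + curv_prod y * g y (E u y) (E v y))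
    - (2 * (s y * s y) + curv_prod y) * (ds u y * ds v y)" for u v y
  have hq: "quadratic_at y \<longleftrightarrow> (\<forall>u v. h u v y = 0)" for y
    by (simp add: quadratic_at_def h_def power2_eq_square)
  have prod_eq: "curv_prod = (\<lambda>y. (3 / 7) * (s y * s y) - (8 / 7) * c)"
    by (simp add: curv_prod_def fun_eq_iff power2_eq_square field_simps)
  have curv_prod: "smooth_on curv_prod U"
    unfolding prod_eq by (intro smooth_on_diff smooth_on_mult smooth_on_const open_U smooth_s)
  have h: "smooth_on (h u v) U" for u v
    unfolding h_def by (intro smooth_on_diff smooth_on_add smooth_on_mult smooth_g smooth_S smooth_E smooth_N
        smooth_ds smooth_s curv_prod open_U smooth_on_const)
  from q obtain u v where uv: "h u v x \<noteq> 0" unfolding hq by blast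
  have "open (U \<inter> h u v -` (- {0}))"
    by (rule continuous_open_preimage[OF smooth_on_continuous_on[OF h] open_U]) auto
  then show ?thesis using x uv hq by (intro exI[of _ "U \<inter> h u v -` (- {0})"]) auto
qed

end

section \<open>The case of a simple principal curvature\<close>

text \<open>The principal curvatures are \<open>-s\<close>, with eigenspace spanned by \<open>\<xi>\<close>, and the roots \<open>curv_plus\<close> and \<open>curv_minus\<close> of
  \<open>t\<^sup>2 - s t + curv_prod\<close>, which are smooth functions of \<open>s\<close> because the discriminant is positive.\<close>

locale split_patch = biconservative_patch G V U F \<eta> c A s \<xi>
  for G :: "real^'n::finite \<Rightarrow> real^'n^'n" and V and U :: "(real^'m::finite) set" and F \<eta> c A s \<xi> +
  fixes gap curv_plus curv_minus :: "real^'m \<Rightarrow> real"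
  defines "gap x \<equiv> sqrt ((32 * c - 5 * (s x)^2) / 7)"
    and "curv_plus x \<equiv> (s x + gap x) / 2" and "curv_minus x \<equiv> (s x - gap x) / 2"
  assumes disc_pos: "x \<in> U \<Longrightarrow> (32 * c - 5 * (s x)^2) / 7 > 0"
    and distinct: "x \<in> U \<Longrightarrow> 3 * s x + gap x \<noteq> 0" "x \<in> U \<Longrightarrow> 3 * s x - gap x \<noteq> 0"
    and decomp: "x \<in> U \<Longrightarrow> \<exists>k u2 u3. v = k *\<^sub>R \<xi> x + u2 + u3 \<and> A x *v u2 = curv_plus x *\<^sub>R u2 \<and> A x *v u3 = curv_minus x *\<^sub>R u3"
    and eig_plus: "x \<in> U \<Longrightarrow> \<exists>u. u \<noteq> 0 \<and> A x *v u = curv_plus x *\<^sub>R u"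
    and eig_minus: "x \<in> U \<Longrightarrow> \<exists>u. u \<noteq> 0 \<and> A x *v u = curv_minus x *\<^sub>R u"
begin

lemma gap_pos: "x \<in> U \<Longrightarrow> gap x > 0"
  using disc_pos by (simp add: gap_def)

lemma gap_sq: "x \<in> U \<Longrightarrow> 7 * (gap x)^2 = 32 * c - 5 * (s x)^2"
  using disc_pos[of x] by (simp add: gap_def)

lemma roots: "x \<in> U \<Longrightarrow> e \<in> {curv_plus x, curv_minus x} \<Longrightarrow> e^2 - s x * e + curv_prod x = 0"
proof -
  assume x: "x \<in> U" and e: "e \<in> {curv_plus x, curv_minus x}"
  have "curv_plus x ^ 2 - s x * curv_plus x + curv_prod x = 0" "curv_minus x ^ 2 - s x * curv_minus x + curv_prod x = 0"
    using gap_sq[OF x] by (simp_all add: curv_plus_def curv_minus_def curv_prod_def power2_eq_square field_simps)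
  with e show ?thesis by auto
qed

lemma not_minus_s: "x \<in> U \<Longrightarrow> e \<in> {curv_plus x, curv_minus x} \<Longrightarrow> e \<noteq> - s x"
  using distinct[of x] by (auto simp: curv_plus_def curv_minus_def)

lemma quadratic_relation:
  assumes x: "x \<in> U"
  shows "N x * (g x (S u x) (S v x) - s x * g x (S u x) (E v x) + curv_prod x * g x (E u x) (E v x))
    = (2 * (s x)^2 + curv_prod x) * (ds u x * ds v x)"
  using quadratic_at_of_eigenvalues[OF x roots[OF x] roots[OF x] not_minus_s[OF x] not_minus_s[OF x] decomp[OF x]]
  unfolding quadratic_at_def by blast

lemma hessian_eigen_orthogonal:
  assumes x: "x \<in> U" and "A x *v u = e *\<^sub>R u" "A x *v w = e' *\<^sub>R w" "e \<noteq> e'"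
  shows "g x (D u Xi x) (E w x) = 0"
  using hessian_S_sym[OF x, of u w] hessian_sym[OF x, of u w] S_eigen[OF x assms(2)] S_eigen[OF x assms(3)] assms(4) by simp

lemma eigen_orthogonal:
  assumes x: "x \<in> U" and "A x *v u = e *\<^sub>R u" "A x *v w = e' *\<^sub>R w" "e \<noteq> e'"
  shows "g x (E u x) (E w x) = 0"
  using S_sym[OF x, of u w] g_commute[OF x, of "E u x" "E w x"] S_eigen[OF x assms(2)] S_eigen[OF x assms(3)] assms(4) by simp

text \<open>The derivative along \<open>\<xi>\<close> of the quadratic identity, taken at two eigenvectors for \<open>e\<close>.  The covariant
  derivatives of \<open>dF(u)\<close> and \<open>dF(v)\<close> enter with the factor \<open>e\<^sup>2 - s e + curv_prod = 0\<close>.  The derivatives of \<open>S u\<close> and \<open>S v\<close>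
  contribute the Hessian, those of \<open>s\<close> and \<open>curv_prod\<close>, namely \<open>N\<close> and \<open>(6/7) s N\<close>, the right-hand side.\<close>

lemma hessian_eigen:
  assumes x: "x \<in> U" and e: "e \<in> {curv_plus x, curv_minus x}" and u: "A x *v u = e *\<^sub>R u" and v: "A x *v v = e *\<^sub>R v"
  shows "(2 * e - s x) * (- s x - e) * g x (D u Xi x) (E v x) = (e - 6 / 7 * s x) * N x * g x (E u x) (E v x)"
proof -
  define r where "r = \<xi> x"
  define q where "q y = g y (S u y) (S v y) - s y * g y (S u y) (E v y) + curv_prod y * g y (E u y) (E v y)" for y
  note du = ds_eigen[OF x u not_minus_s[OF x e]] and dv = ds_eigen[OF x v not_minus_s[OF x e]]
  have prod_eq: "curv_prod = (\<lambda>y. (3 / 7) * (s y * s y) - (8 / 7) * c)"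
    by (simp add: curv_prod_def fun_eq_iff power2_eq_square field_simps)
  have curv_prod: "smooth_on curv_prod U"
    unfolding prod_eq by (intro smooth_on_diff smooth_on_mult smooth_on_const open_U smooth_s)
  note sd = smooth_on_differentiable[OF _ x]
  have ss: "(\<lambda>y. s y * s y) differentiable at x"
    by (intro sd smooth_on_mult open_U smooth_s)
  have ds_r: "ds r x = N x" by (simp add: r_def ds_xi[OF x])
  have dprod: "dir_deriv r curv_prod x = 6 / 7 * s x * N x"
  proof -
    have "dir_deriv r curv_prod x = dir_deriv r (\<lambda>y. (3 / 7) * (s y * s y)) x - dir_deriv r (\<lambda>y. (8 / 7) * c) x"
      unfolding prod_eq by (rule dir_deriv_rules(2)) (intro sd smooth_on_mult smooth_on_const open_U smooth_s)+
    also have "\<dots> = (3 / 7) * dir_deriv r (\<lambda>y. s y * s y) x"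
      by (simp only: dir_deriv_rules(4)[OF ss ss] dir_deriv_const diff_0_right)
    also have "dir_deriv r (\<lambda>y. s y * s y) x = s x * N x + N x * s x"
      using dir_deriv_rules(3)[OF sd[OF smooth_s] sd[OF smooth_s], of r] by (simp add: ds_r)
    finally show ?thesis by simp
  qed
  have sq: "smooth_on q U"
    unfolding q_def by (intro smooth_on_add smooth_on_diff smooth_on_mult smooth_g smooth_S smooth_E smooth_s curv_prod open_U)
  have q0: "q x = 0"
    using quadratic_relation[OF x, of u v] du N_pos[OF x] by (simp add: q_def)
  have "dir_deriv r (\<lambda>y. N y * q y) x = dir_deriv r (\<lambda>y. (2 * (s y * s y) + curv_prod y) * (ds u y * ds v y)) x"
    using quadratic_relation by (intro dir_deriv_cong[OF open_U x]) (simp add: q_def power2_eq_square)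
  also have "\<dots> = 0"
  proof -
    have "smooth_on (\<lambda>y. 2 * (s y * s y) + curv_prod y) U"
      by (intro smooth_on_add smooth_on_mult smooth_on_const smooth_s curv_prod open_U)
    then show ?thesis
      using du dv by (simp add: dir_deriv_rules(3) sd smooth_ds smooth_on_mult open_U)
  qed
  finally have "dir_deriv r q x = 0"
    using N_pos[OF x] q0 by (simp add: dir_deriv_rules(3) sd smooth_N sq)
  moreover have "dir_deriv r q x =
      (g x (D r (S u) x) (S v x) + g x (S u x) (D r (S v) x))
      - (s x * (g x (D r (S u) x) (E v x) + g x (S u x) (D r (E v) x)) + N x * g x (S u x) (E v x))
      + (curv_prod x * (g x (D r (E u) x) (E v x) + g x (E u x) (D r (E v) x)) + 6 / 7 * s x * N x * g x (E u x) (E v x))"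
    unfolding q_def
    apply (subst dir_deriv_rules(1))
      apply (rule sd, intro smooth_on_diff smooth_on_mult smooth_g smooth_S smooth_E smooth_s open_U)
     apply (rule sd, intro smooth_on_diff smooth_on_mult smooth_g smooth_S smooth_E curv_prod open_U)
    apply (subst dir_deriv_rules(2))
      apply (rule sd, intro smooth_on_diff smooth_on_mult smooth_g smooth_S smooth_E smooth_s open_U)
     apply (rule sd, intro smooth_on_diff smooth_on_mult smooth_g smooth_S smooth_E smooth_s open_U)
    apply (simp add: dir_deriv_rules(3) sd smooth_g smooth_S smooth_E smooth_s curv_prod dir_deriv_g[OF x] dprod ds_xi[OF x, folded r_def])
    done
  moreover have "g x (D r (S u) x) (E v x) = e * g x (E v x) (D r (E u) x) + (- s x - e) * g x (D u Xi x) (E v x)"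
    using shape_derivative_along_gradient[OF x, of u v] du by (simp add: r_def S_eigen[OF x v] algebra_simps)
  moreover have "g x (D r (S v) x) (E u x) = e * g x (E u x) (D r (E v) x) + (- s x - e) * g x (D u Xi x) (E v x)"
    using shape_derivative_along_gradient[OF x, of v u] dv hessian_sym[OF x, of u v]
    by (simp add: r_def S_eigen[OF x u] algebra_simps)
  ultimately have main: "(2 * e - s x) * (- s x - e) * g x (D u Xi x) (E v x)
      + (e^2 - s x * e + curv_prod x) * (g x (E v x) (D r (E u) x) + g x (E u x) (D r (E v) x))
      = (e - 6 / 7 * s x) * N x * g x (E u x) (E v x)"
    using g_commute[OF x, of "E u x" "D r (S v) x"] g_commute[OF x, of "D r (E u) x" "E v x"]
    by (simp add: S_eigen[OF x u] S_eigen[OF x v] algebra_simps power2_eq_square)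
  then show ?thesis using roots[OF x e] by simp
qed

text \<open>The eigenvalues \<open>hess_plus\<close>, \<open>hess_minus\<close> and \<open>hess_xi\<close> of the Hessian on the eigenspaces of \<open>curv_plus\<close> and \<open>curv_minus\<close> and
  on \<open>\<xi>\<close>, and the coefficients in \<open>Hess s = coef_id I + coef_shape A + coef_grad ds \<otimes> ds\<close> that these
  eigenvalues determine.  In this form the Hessian is differentiated without reference to eigenvectors.\<close>

definition hess_plus :: "real^'m \<Rightarrow> real" where "hess_plus x = - N x * (7 * gap x - 5 * s x) / (7 * gap x * (3 * s x + gap x))"
definition hess_minus :: "real^'m \<Rightarrow> real" where "hess_minus x = - N x * (7 * gap x + 5 * s x) / (7 * gap x * (3 * s x - gap x))"
definition coef_id :: "real^'m \<Rightarrow> real" where "coef_id x = (curv_plus x * hess_minus x - curv_minus x * hess_plus x) / gap x"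
definition coef_shape :: "real^'m \<Rightarrow> real" where "coef_shape x = (hess_plus x - hess_minus x) / gap x"
definition hess_xi :: "real^'m \<Rightarrow> real" where "hess_xi x = dir_deriv (\<xi> x) N x / (2 * N x)"
definition coef_grad :: "real^'m \<Rightarrow> real" where "coef_grad x = (hess_xi x - coef_id x + coef_shape x * s x) / N x"

lemma hess_eq_coef: "x \<in> U \<Longrightarrow> coef_id x + coef_shape x * curv_plus x = hess_plus x" "x \<in> U \<Longrightarrow> coef_id x + coef_shape x * curv_minus x = hess_minus x"
proof -
  assume x: "x \<in> U"
  have "curv_plus x - curv_minus x = gap x" by (simp add: curv_plus_def curv_minus_def field_simps)
  moreover have "gap x * (coef_id x + coef_shape x * curv_plus x) = hess_plus x * (curv_plus x - curv_minus x)" "gap x * (coef_id x + coef_shape x * curv_minus x) = hess_minus x * (curv_plus x - curv_minus x)"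
    using gap_pos[OF x] by (simp_all add: coef_id_def coef_shape_def field_simps)
  ultimately show "coef_id x + coef_shape x * curv_plus x = hess_plus x" "coef_id x + coef_shape x * curv_minus x = hess_minus x"
    using gap_pos[OF x] by auto
qed

lemma hessian_eigen_value:
  assumes x: "x \<in> U" and e: "e \<in> {curv_plus x, curv_minus x}" and u: "A x *v u = e *\<^sub>R u"
  shows "g x (D u Xi x) (E v x) = (coef_id x + coef_shape x * e) * g x (E u x) (E v x)"
proof -
  have same: "g x (D u Xi x) (E w x) = (coef_id x + coef_shape x * e) * g x (E u x) (E w x)"
    if w: "A x *v w = e *\<^sub>R w" for w
  proof -
    have h: "(2 * e - s x) * (- s x - e) * g x (D u Xi x) (E w x) = (e - 6 / 7 * s x) * N x * g x (E u x) (E w x)"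
      by (rule hessian_eigen[OF x e u w])
    consider "e = curv_plus x" | "e = curv_minus x" using e by blast
    then show ?thesis
    proof cases
      case 1
      have "- (gap x * (3 * s x + gap x)) * 7 * g x (D u Xi x) (E w x) = (7 * gap x - 5 * s x) * N x * g x (E u x) (E w x)"
        using h unfolding 1 curv_plus_def by (simp add: field_simps)
      then show ?thesis unfolding 1 hess_eq_coef(1)[OF x] hess_plus_def
        using gap_pos[OF x] distinct[OF x] by (simp add: divide_simps) (simp add: algebra_simps)
    next
      case 2
      have "(gap x * (3 * s x - gap x)) * 7 * g x (D u Xi x) (E w x) = - (7 * gap x + 5 * s x) * N x * g x (E u x) (E w x)"
        using h unfolding 2 curv_minus_def by (simp add: field_simps)
      then show ?thesis unfolding 2 hess_eq_coef(2)[OF x] hess_minus_def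
        using gap_pos[OF x] distinct[OF x] by (simp add: divide_simps) (simp add: algebra_simps)
    qed
  qed
  have other: "g x (D u Xi x) (E w x) = (coef_id x + coef_shape x * e) * g x (E u x) (E w x)"
    if w: "A x *v w = e' *\<^sub>R w" for w e'
  proof (cases "e = e'")
    case True
    then show ?thesis using same w by simp
  next
    case False
    then show ?thesis
      using hessian_eigen_orthogonal[OF x u w] eigen_orthogonal[OF x u w] by simp
  qed
  obtain k u2 u3 where v: "v = k *\<^sub>R \<xi> x + u2 + u3" "A x *v u2 = curv_plus x *\<^sub>R u2" "A x *v u3 = curv_minus x *\<^sub>R u3"
    using decomp[OF x] by blast
  show ?thesis
    unfolding v(1) E_linear[OF x] using other[OF v(2)] other[OF v(3)] other[OF xi_principal[OF x]]
    by (simp add: distrib_left)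
qed

lemma dN: "x \<in> U \<Longrightarrow> dir_deriv u N x = 2 * g x (D u Xi x) (Xi x)"
  unfolding N_def using dir_deriv_g[OF _ smooth_Xi smooth_Xi, of x u] g_commute[of x "Xi x" "D u Xi x"] by simp

lemma D_Xi_linear:
  assumes x: "x \<in> U"
  shows "D (u + v) Xi x = D u Xi x + D v Xi x" "D (k *\<^sub>R u) Xi x = k *\<^sub>R D u Xi x"
  using nabla_direction_linear[of F x Xi] F_in_V[OF x] smooth_on_differentiable[OF smooth_Xi x]
    smooth_on_differentiable[OF smooth_F x] by blast+

text \<open>The tangent part is compared on eigenvectors; on a pair of vectors orthogonal to \<open>\<xi>\<close> and on mixed pairs it
  is known from \<open>hessian_eigen_value\<close>, and \<open>coef_grad\<close> is chosen to make it right on \<open>\<xi>\<close> itself.\<close>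

lemma D_Xi_formula:
  assumes x: "x \<in> U"
  shows "D u Xi x = coef_id x *\<^sub>R E u x + coef_shape x *\<^sub>R S u x + (coef_grad x * ds u x) *\<^sub>R Xi x + (- s x * ds u x) *\<^sub>R \<eta> x"
    (is "_ = ?R u")
proof (rule tangent_normal_eqI[OF x])
  show "g x (D u Xi x) (\<eta> x) = g x (?R u) (\<eta> x)"
    using D_Xi_normal[OF x] E_normal[OF x] S_normal[OF x] Xi_normal[OF x] eta_unit[OF x] by simp
next
  fix v
  have eig: "g x (D u Xi x) (E v x) = g x (?R u) (E v x)"
    if u: "A x *v u = e *\<^sub>R u" and e: "e \<in> {curv_plus x, curv_minus x}" for u v e
    using hessian_eigen_value[OF x e u, of v] ds_eigen[OF x u not_minus_s[OF x e]]
    by (simp add: S_eigen[OF x u] algebra_simps)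
  have R_sym: "g x (?R u) (E v x) = g x (?R v) (E u x)" for u v
    using S_sym[OF x, of u v] g_commute[OF x, of "E u x" "E v x"] Xi_E[OF x] eta_normal[OF x] by simp
  have xi: "g x (D (\<xi> x) Xi x) (Xi x) = g x (?R (\<xi> x)) (Xi x)"
  proof -
    have "g x (?R (\<xi> x)) (Xi x) = coef_id x * N x - coef_shape x * s x * N x + coef_grad x * N x * N x"
      using eta_normal[OF x, of "\<xi> x"] by (simp add: S_xi[OF x] ds_xi[OF x] Xi_def[symmetric] N_def[symmetric])
    also have "\<dots> = hess_xi x * N x" using N_pos[OF x] by (simp add: coef_grad_def field_simps)
    also have "\<dots> = g x (D (\<xi> x) Xi x) (Xi x)" using N_pos[OF x] by (simp add: hess_xi_def dN[OF x])
    finally show ?thesis by simp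
  qed
  have xi2: "g x (D (\<xi> x) Xi x) (E v x) = g x (?R (\<xi> x)) (E v x)" for v
  proof -
    obtain k u2 u3 where v: "v = k *\<^sub>R \<xi> x + u2 + u3" "A x *v u2 = curv_plus x *\<^sub>R u2" "A x *v u3 = curv_minus x *\<^sub>R u3"
      using decomp[OF x] by blast
    have *: "g x (D (\<xi> x) Xi x) (E w x) = g x (?R (\<xi> x)) (E w x)"
      if "A x *v w = e *\<^sub>R w" "e \<in> {curv_plus x, curv_minus x}" for w e
      using eig[OF that, of "\<xi> x"] hessian_sym[OF x, of w "\<xi> x"] R_sym[of "\<xi> x" w] by simp
    show ?thesis
      unfolding v(1) E_linear[OF x] ip_simps using *[OF v(2)] *[OF v(3)] xi by (simp add: Xi_def)
  qed
  obtain k u2 u3 where u: "u = k *\<^sub>R \<xi> x + u2 + u3" "A x *v u2 = curv_plus x *\<^sub>R u2" "A x *v u3 = curv_minus x *\<^sub>R u3"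
    using decomp[OF x] by blast
  have R_lin: "?R (a + b) = ?R a + ?R b" "?R (k *\<^sub>R a) = k *\<^sub>R ?R a" for a b k
    using dir_deriv_linear[OF smooth_on_differentiable[OF smooth_s x]]
    by (simp_all add: S_linear[OF x] E_linear[OF x] algebra_simps)
  show "g x (D u Xi x) (E v x) = g x (?R u) (E v x)"
    unfolding u(1) R_lin D_Xi_linear[OF x] ip_simps using eig[OF u(2)] eig[OF u(3)] xi2 by simp
qed

lemma differentiable_coefficients:
  assumes x: "x \<in> U"
  shows "gap differentiable at x" "hess_plus differentiable at x" "hess_minus differentiable at x"
    "coef_id differentiable at x" "coef_shape differentiable at x" "coef_grad differentiable at x"
proof -
  note sd = smooth_on_differentiable[OF _ x]
  have s: "s differentiable at x" and N: "N differentiable at x" by (intro sd smooth_s smooth_N)+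
  have "smooth_on (\<lambda>y. (1 / 7) * (32 * c - 5 * (s y * s y))) U"
    by (intro smooth_on_mult smooth_on_diff smooth_on_const smooth_s open_U)
  from has_derivative_real_sqrt[OF _ smooth_on_has_derivative[OF this x]]
  have "(\<lambda>y. sqrt ((1 / 7) * (32 * c - 5 * (s y * s y)))) differentiable at x"
    using disc_pos[OF x] unfolding differentiable_def by (auto simp: power2_eq_square)
  then show gap: "gap differentiable at x"
    unfolding gap_def by (simp add: power2_eq_square)
  have q: "(\<lambda>y. a y / b y) differentiable at x"
    if "a differentiable at x" "b differentiable at x" "b x \<noteq> 0" for a b :: "real^'m \<Rightarrow> real"
    using that by (simp add: differentiable_divide)
  show hess_plus: "hess_plus differentiable at x"
    unfolding hess_plus_def by (intro q differentiable_mult differentiable_diff differentiable_add differentiable_minus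
        differentiable_const s N gap) (use gap_pos[OF x] distinct[OF x] in auto)
  show hess_minus: "hess_minus differentiable at x"
    unfolding hess_minus_def by (intro q differentiable_mult differentiable_diff differentiable_add differentiable_minus
        differentiable_const s N gap) (use gap_pos[OF x] distinct[OF x] in auto)
  show coef_id: "coef_id differentiable at x"
    unfolding coef_id_def curv_plus_def curv_minus_def by (intro q differentiable_mult differentiable_diff differentiable_add
        differentiable_const s N gap hess_plus hess_minus) (use gap_pos[OF x] in auto)
  show coef_shape: "coef_shape differentiable at x"
    unfolding coef_shape_def by (intro q differentiable_diff gap hess_plus hess_minus) (use gap_pos[OF x] in auto)
  have "(\<lambda>y. dir_deriv (\<xi> y) N y) differentiable at x"
    by (intro sd smooth_on_dir_deriv_field open_U smooth_N smooth_xi)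
  then show "coef_grad differentiable at x"
    unfolding coef_grad_def hess_xi_def by (intro q differentiable_mult differentiable_diff differentiable_add
        differentiable_const s N coef_id coef_shape) (use N_pos[OF x] in auto)
qed

text \<open>The Ricci identity for the gradient field, with one direction along \<open>\<xi>\<close> and the other in the eigenspace of \<open>e\<close>,
  tested against the latter.  After insertion of \<open>D_Xi_formula\<close> the second-order terms
  \<open>\<nabla>\<^sub>u dF(v)\<close> and \<open>\<nabla>\<^sub>u S v\<close> cancel, being symmetric in \<open>u\<close> and \<open>v\<close>.\<close>

lemma riccati:
  assumes x: "x \<in> U" and e: "e \<in> {curv_plus x, curv_minus x}" and u: "A x *v u = e *\<^sub>R u" "u \<noteq> 0"
  shows "dir_deriv (\<xi> x) coef_id x + e * dir_deriv (\<xi> x) coef_shape x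
    = coef_grad x * N x * (coef_id x + coef_shape x * e) + s x * N x * e - c * N x"
proof -
  define r where "r = \<xi> x"
  note sd = smooth_on_differentiable[OF _ x]
  note dc = differentiable_coefficients[OF x]
  have du: "ds u x = 0" by (rule ds_eigen[OF x u(1) not_minus_s[OF x e]])
  have Er: "E r x = Xi x" "S r x = - s x *\<^sub>R Xi x" "ds r x = N x"
    by (simp_all add: r_def Xi_def S_xi[OF x] ds_xi[OF x])
  have D2: "D v (D w Xi) x = (dir_deriv v coef_id x *\<^sub>R E w x + coef_id x *\<^sub>R D v (E w) x)
      + (dir_deriv v coef_shape x *\<^sub>R S w x + coef_shape x *\<^sub>R D v (S w) x)
      + (dir_deriv v (\<lambda>y. coef_grad y * ds w y) x *\<^sub>R Xi x + (coef_grad x * ds w x) *\<^sub>R D v Xi x)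
      + (dir_deriv v (\<lambda>y. - s y * ds w y) x *\<^sub>R \<eta> x + (- s x * ds w x) *\<^sub>R D v \<eta> x)" for v w
  proof -
    note sc = nabla_scale[where F=F, OF F_in_V[OF x]]
    have t: "(\<lambda>y. coef_id y *\<^sub>R E w y) differentiable at x" "(\<lambda>y. coef_shape y *\<^sub>R S w y) differentiable at x"
      "(\<lambda>y. (coef_grad y * ds w y) *\<^sub>R Xi y) differentiable at x" "(\<lambda>y. (- s y * ds w y) *\<^sub>R \<eta> y) differentiable at x"
      "(\<lambda>y. coef_grad y * ds w y) differentiable at x" "(\<lambda>y. - s y * ds w y) differentiable at x"
      by (intro differentiable_scaleR differentiable_mult differentiable_minus dc sd smooth_E smooth_S
          smooth_Xi smooth_ds smooth_s smooth_eta)+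
    have "D v (D w Xi) x = D v (\<lambda>y. coef_id y *\<^sub>R E w y + coef_shape y *\<^sub>R S w y + (coef_grad y * ds w y) *\<^sub>R Xi y
        + (- s y * ds w y) *\<^sub>R \<eta> y) x"
      by (rule nabla_cong[OF open_U x D_Xi_formula])
    also have "\<dots> = D v (\<lambda>y. coef_id y *\<^sub>R E w y) x + D v (\<lambda>y. coef_shape y *\<^sub>R S w y) x
        + D v (\<lambda>y. (coef_grad y * ds w y) *\<^sub>R Xi y) x + D v (\<lambda>y. (- s y * ds w y) *\<^sub>R \<eta> y) x"
      by (simp only: nabla_add[where F=F, OF F_in_V[OF x]] t differentiable_add)
    also have "\<dots> = (dir_deriv v coef_id x *\<^sub>R E w x + coef_id x *\<^sub>R D v (E w) x)
      + (dir_deriv v coef_shape x *\<^sub>R S w x + coef_shape x *\<^sub>R D v (S w) x)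
      + (dir_deriv v (\<lambda>y. coef_grad y * ds w y) x *\<^sub>R Xi x + (coef_grad x * ds w x) *\<^sub>R D v Xi x)
      + (dir_deriv v (\<lambda>y. - s y * ds w y) x *\<^sub>R \<eta> x + (- s x * ds w x) *\<^sub>R D v \<eta> x)"
      by (simp only: sc[OF sd[OF smooth_E] dc(4)] sc[OF sd[OF smooth_S] dc(5)] sc[OF sd[OF smooth_Xi] t(5)]
          sc[OF sd[OF smooth_eta] t(6)])
    finally show ?thesis .
  qed
  have orth: "g x (Xi x) (E u x) = 0" using Xi_E[OF x, of u] du by simp
  have gu: "g x (E u x) (E u x) > 0" by (rule g_E_pos[OF x u(2)])
  have eta: "g x (\<eta> x) (E u x) = 0" by (rule eta_normal[OF x])
  have Deta: "g x (D u \<eta> x) (E u x) = - e * g x (E u x) (E u x)"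
  proof -
    have "D u \<eta> x = - (e *\<^sub>R E u x)"
      using S_eigen[OF x u(1)] by (simp add: S_def minus_equation_iff[of "D u \<eta> x"])
    then show ?thesis by simp
  qed
  have H: "g x (D u Xi x) (E u x) = (coef_id x + coef_shape x * e) * g x (E u x) (E u x)"
    by (rule hessian_eigen_value[OF x e u(1)])
  have "g x (D r (D u Xi) x) (E u x) - g x (D u (D r Xi) x) (E u x)
     = (dir_deriv r coef_id x + e * dir_deriv r coef_shape x) * g x (E u x) (E u x)
       - coef_grad x * N x * ((coef_id x + coef_shape x * e) * g x (E u x) (E u x)) - s x * N x * e * g x (E u x) (E u x)"
    unfolding D2 using D_E_commute[OF x, of r u] codazzi[OF x, of r u]
    by (simp add: Er du orth eta Deta H S_eigen[OF x u(1)] algebra_simps)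
  moreover have "g x (D r (D u Xi) x) (E u x) - g x (D u (D r Xi) x) (E u x) = - c * N x * g x (E u x) (E u x)"
    using arg_cong[OF ricci_along[OF x smooth_Xi, of r u], of "\<lambda>z. g x z (E u x)"]
    by (simp add: Er orth g_commute[OF x, of "E u x" "Xi x"] N_def)
  ultimately have "(dir_deriv r coef_id x + e * dir_deriv r coef_shape x - (coef_grad x * N x * (coef_id x + coef_shape x * e) + s x * N x * e - c * N x))
      * g x (E u x) (E u x) = 0"
    by (simp add: algebra_simps)
  then show ?thesis using gu by (simp add: r_def)
qed

lemma derivative_rules_along_gradient:
  assumes x: "x \<in> U"
  shows "ds (\<xi> x) x = N x" "dir_deriv (\<xi> x) N x = 2 * hess_xi x * N x"
    "7 * gap x * dir_deriv (\<xi> x) gap x = - 5 * s x * N x"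
proof -
  let ?r = "\<xi> x"
  note sd = smooth_on_differentiable[OF _ x]
  note dD = differentiable_coefficients(1)[OF x]
  note ds = sd[OF smooth_s]
  show 1: "ds ?r x = N x" by (rule ds_xi[OF x])
  show "dir_deriv ?r N x = 2 * hess_xi x * N x" using N_pos[OF x] by (simp add: hess_xi_def)
  have "dir_deriv ?r (\<lambda>y. 7 * (gap y * gap y)) x = dir_deriv ?r (\<lambda>y. 32 * c - 5 * (s y * s y)) x"
    using gap_sq by (intro dir_deriv_cong[OF open_U x]) (simp add: power2_eq_square)
  moreover have "dir_deriv ?r (\<lambda>y. 7 * (gap y * gap y)) x = 7 * (2 * gap x * dir_deriv ?r gap x)"
    using dir_deriv_rules(4)[OF differentiable_mult[OF dD dD] dD, of ?r 7] dir_deriv_rules(3)[OF dD dD, of ?r] by simp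
  moreover have "dir_deriv ?r (\<lambda>y. 32 * c - 5 * (s y * s y)) x = - 5 * (2 * s x * N x)"
  proof -
    have "dir_deriv ?r (\<lambda>y. 32 * c - 5 * (s y * s y)) x = dir_deriv ?r (\<lambda>y. 32 * c) x - dir_deriv ?r (\<lambda>y. 5 * (s y * s y)) x"
      by (rule dir_deriv_rules(2)) (intro differentiable_const differentiable_mult ds)+
    then show ?thesis
      using dir_deriv_rules(4)[OF differentiable_mult[OF ds ds] ds, of ?r 5] dir_deriv_rules(3)[OF ds ds, of ?r]
      by (simp add: 1)
  qed
  ultimately show "7 * gap x * dir_deriv ?r gap x = - 5 * s x * N x" by simp
qed

text \<open>The Riccati equations take the standard form \<open>\<alpha>' = h \<alpha> - \<alpha>\<^sup>2 - N (c - s \<lambda>)\<close> once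
  \<open>coef_id + coef_shape \<lambda> = \<alpha>\<close> is differentiated, because the principal curvature satisfies
  \<open>\<lambda>' = (-s - \<lambda>) \<alpha>\<close>.\<close>

lemma gradient_norm_equations:
  assumes x: "x \<in> U"
  defines "\<Delta> \<equiv> (gap x)^2"
  shows "224 * s x * \<Delta> * hess_xi x = N x * (462 * \<Delta> + 150 * (s x)^2) + \<Delta> * (343 / 16 * \<Delta>^2 - 539 / 4 * (s x)^2 * \<Delta> - 4851 / 16 * (s x)^4)"
    and "96 * N x * (- 539 * \<Delta>^2 + 420 * (s x)^2 * \<Delta> + 775 * (s x)^4)
      + 7 * \<Delta> * (- 343 * \<Delta>^3 + 5803 * (s x)^2 * \<Delta>^2 - 23289 * (s x)^4 * \<Delta> - 10395 * (s x)^6) = 0"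
proof -
  let ?r = "\<xi> x"
  define D' where "D' = dir_deriv ?r gap x"
  note sd = smooth_on_differentiable[OF _ x]
  note dc = differentiable_coefficients[OF x]
  note ds = sd[OF smooth_s]
  note dN = sd[OF smooth_N]
  note rules = derivative_rules_along_gradient[OF x, folded D'_def]
  have D0: "gap x \<noteq> 0" using gap_pos[OF x] by simp
  have N0: "N x \<noteq> 0" using N_pos[OF x] by simp
  note dm = differentiable_mult and dd = differentiable_diff and da = differentiable_add and dk = differentiable_const
  have \<alpha>: "hess_plus y * (7 * gap y * (3 * s y + gap y)) = - N y * (7 * gap y - 5 * s y)"
    and \<beta>: "hess_minus y * (7 * gap y * (3 * s y - gap y)) = - N y * (7 * gap y + 5 * s y)" if "y \<in> U" for y
    using gap_pos[OF that] distinct[OF that] by (simp_all add: hess_plus_def hess_minus_def)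
  have lin: "dir_deriv ?r (\<lambda>y. 3 * s y + gap y) x = 3 * N x + D'" "dir_deriv ?r (\<lambda>y. 3 * s y - gap y) x = 3 * N x - D'"
    "dir_deriv ?r (\<lambda>y. 7 * gap y - 5 * s y) x = 7 * D' - 5 * N x" "dir_deriv ?r (\<lambda>y. 7 * gap y + 5 * s y) x = 7 * D' + 5 * N x"
    "dir_deriv ?r (\<lambda>y. 7 * gap y) x = 7 * D'"
    using dir_deriv_rules(1)[OF dm[OF dk[of 3] ds] dc(1), of ?r] dir_deriv_rules(2)[OF dm[OF dk[of 3] ds] dc(1), of ?r]
      dir_deriv_rules(2)[OF dm[OF dk[of 7] dc(1)] dm[OF dk[of 5] ds], of ?r]
      dir_deriv_rules(1)[OF dm[OF dk[of 7] dc(1)] dm[OF dk[of 5] ds], of ?r]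
      dir_deriv_rules(4)[OF ds ds, of ?r 3] dir_deriv_rules(4)[OF ds ds, of ?r 5] dir_deriv_rules(4)[OF dc(1) dc(1), of ?r 7]
    by (simp_all add: rules(1) D'_def)
  have d\<alpha>: "dir_deriv ?r hess_plus x * (7 * gap x * (3 * s x + gap x)) + hess_plus x * (7 * (D' * (3 * s x + gap x) + gap x * (3 * N x + D')))
       = - (2 * hess_xi x * N x * (7 * gap x - 5 * s x) + N x * (7 * D' - 5 * N x))"
  proof -
    have "dir_deriv ?r (\<lambda>y. hess_plus y * (7 * gap y * (3 * s y + gap y))) x = dir_deriv ?r (\<lambda>y. - (N y * (7 * gap y - 5 * s y))) x"
      using \<alpha> by (intro dir_deriv_cong[OF open_U x]) simp
    moreover have "dir_deriv ?r (\<lambda>y. hess_plus y * (7 * gap y * (3 * s y + gap y))) x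
        = hess_plus x * (7 * gap x * (3 * N x + D') + 7 * D' * (3 * s x + gap x)) + dir_deriv ?r hess_plus x * (7 * gap x * (3 * s x + gap x))"
      by (simp only: dir_deriv_rules(3)[OF dc(2) dm[OF dm[OF dk[of 7] dc(1)] da[OF dm[OF dk[of 3] ds] dc(1)]]]
          dir_deriv_rules(3)[OF dm[OF dk[of 7] dc(1)] da[OF dm[OF dk[of 3] ds] dc(1)]] lin)
    moreover have "dir_deriv ?r (\<lambda>y. - (N y * (7 * gap y - 5 * s y))) x
        = - (N x * (7 * D' - 5 * N x) + 2 * hess_xi x * N x * (7 * gap x - 5 * s x))"
      by (simp only: dir_deriv_rules(5)[OF dm[OF dN dd[OF dm[OF dk[of 7] dc(1)] dm[OF dk[of 5] ds]]] dN]
          dir_deriv_rules(3)[OF dN dd[OF dm[OF dk[of 7] dc(1)] dm[OF dk[of 5] ds]]] lin rules(2))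
    ultimately show ?thesis by (simp add: algebra_simps)
  qed
  have d\<beta>: "dir_deriv ?r hess_minus x * (7 * gap x * (3 * s x - gap x)) + hess_minus x * (7 * (D' * (3 * s x - gap x) + gap x * (3 * N x - D')))
       = - (2 * hess_xi x * N x * (7 * gap x + 5 * s x) + N x * (7 * D' + 5 * N x))"
  proof -
    have "dir_deriv ?r (\<lambda>y. hess_minus y * (7 * gap y * (3 * s y - gap y))) x = dir_deriv ?r (\<lambda>y. - (N y * (7 * gap y + 5 * s y))) x"
      using \<beta> by (intro dir_deriv_cong[OF open_U x]) simp
    moreover have "dir_deriv ?r (\<lambda>y. hess_minus y * (7 * gap y * (3 * s y - gap y))) x
        = hess_minus x * (7 * gap x * (3 * N x - D') + 7 * D' * (3 * s x - gap x)) + dir_deriv ?r hess_minus x * (7 * gap x * (3 * s x - gap x))"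
      by (simp only: dir_deriv_rules(3)[OF dc(3) dm[OF dm[OF dk[of 7] dc(1)] dd[OF dm[OF dk[of 3] ds] dc(1)]]]
          dir_deriv_rules(3)[OF dm[OF dk[of 7] dc(1)] dd[OF dm[OF dk[of 3] ds] dc(1)]] lin)
    moreover have "dir_deriv ?r (\<lambda>y. - (N y * (7 * gap y + 5 * s y))) x
        = - (N x * (7 * D' + 5 * N x) + 2 * hess_xi x * N x * (7 * gap x + 5 * s x))"
      by (simp only: dir_deriv_rules(5)[OF dm[OF dN da[OF dm[OF dk[of 7] dc(1)] dm[OF dk[of 5] ds]]] dN]
          dir_deriv_rules(3)[OF dN da[OF dm[OF dk[of 7] dc(1)] dm[OF dk[of 5] ds]]] lin rules(2))
    ultimately show ?thesis by (simp add: algebra_simps)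
  qed
  have half: "(\<lambda>y. (1 / 2) * (s y + gap y)) differentiable at x" "(\<lambda>y. (1 / 2) * (s y - gap y)) differentiable at x"
    by (intro dm dk da dd ds dc)+
  have curv_plus': "curv_plus = (\<lambda>y. (1 / 2) * (s y + gap y))" and curv_minus': "curv_minus = (\<lambda>y. (1 / 2) * (s y - gap y))"
    by (simp_all add: curv_plus_def curv_minus_def fun_eq_iff)
  have dcurv: "dir_deriv ?r curv_plus x = (N x + D') / 2" "dir_deriv ?r curv_minus x = (N x - D') / 2"
    unfolding curv_plus' curv_minus'
    using dir_deriv_rules(4)[OF da[OF ds dc(1)] ds, of ?r "1/2"] dir_deriv_rules(4)[OF dd[OF ds dc(1)] ds, of ?r "1/2"]
      dir_deriv_rules(1,2)[OF ds dc(1), of ?r] by (simp_all add: rules(1) D'_def)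
  \<comment> \<open>The equations \<open>\<lambda>' = (-s - \<lambda>) \<alpha>\<close> for the two principal curvatures.\<close>
  have speed: "(N x + D') / 2 = (- s x - curv_plus x) * hess_plus x" "(N x - D') / 2 = (- s x - curv_minus x) * hess_minus x"
  proof -
    have "14 * gap x * ((N x + D') / 2) = N x * (7 * gap x - 5 * s x)" "14 * gap x * ((N x - D') / 2) = N x * (7 * gap x + 5 * s x)"
      using rules(3) by (simp_all add: field_simps)
    moreover have "14 * gap x * ((- s x - curv_plus x) * hess_plus x) = N x * (7 * gap x - 5 * s x)"
      "14 * gap x * ((- s x - curv_minus x) * hess_minus x) = N x * (7 * gap x + 5 * s x)"
      using \<alpha>[OF x] \<beta>[OF x] unfolding curv_plus_def curv_minus_def by (simp_all add: algebra_simps add_divide_distrib diff_divide_distrib)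
    ultimately show "(N x + D') / 2 = (- s x - curv_plus x) * hess_plus x" "(N x - D') / 2 = (- s x - curv_minus x) * hess_minus x"
      using D0 by (metis mult_left_cancel mult_eq_0_iff zero_neq_numeral)+
  qed
  have cgN: "coef_grad x * N x = hess_xi x - coef_id x + coef_shape x * s x" using N0 by (simp add: coef_grad_def)
  have hess_plus': "dir_deriv ?r hess_plus x = hess_xi x * hess_plus x - (hess_plus x)^2 - N x * (c - s x * ((s x + gap x) / 2))"
  proof -
    obtain u where u: "A x *v u = curv_plus x *\<^sub>R u" "u \<noteq> 0" using eig_plus[OF x] by blast
    have "dir_deriv ?r hess_plus x = dir_deriv ?r (\<lambda>y. coef_id y + coef_shape y * curv_plus y) x"
      by (rule dir_deriv_cong[OF open_U x]) (simp add: hess_eq_coef)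
    also have "\<dots> = dir_deriv ?r coef_id x + curv_plus x * dir_deriv ?r coef_shape x + coef_shape x * ((N x + D') / 2)"
      using dir_deriv_rules(1)[OF dc(4) dm[OF dc(5) half(1)[folded curv_plus']], of ?r]
        dir_deriv_rules(3)[OF dc(5) half(1)[folded curv_plus'], of ?r] by (simp add: dcurv)
    also have "\<dots> = hess_xi x * hess_plus x - (hess_plus x)^2 - N x * (c - s x * curv_plus x)"
      unfolding speed riccati[OF x _ u, simplified] cgN using hess_eq_coef(1)[OF x, symmetric]
      by (simp add: algebra_simps power2_eq_square)
    finally show ?thesis by (simp add: curv_plus_def)
  qed
  have hess_minus': "dir_deriv ?r hess_minus x = hess_xi x * hess_minus x - (hess_minus x)^2 - N x * (c - s x * ((s x - gap x) / 2))"
  proof -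
    obtain u where u: "A x *v u = curv_minus x *\<^sub>R u" "u \<noteq> 0" using eig_minus[OF x] by blast
    have "dir_deriv ?r hess_minus x = dir_deriv ?r (\<lambda>y. coef_id y + coef_shape y * curv_minus y) x"
      by (rule dir_deriv_cong[OF open_U x]) (simp add: hess_eq_coef)
    also have "\<dots> = dir_deriv ?r coef_id x + curv_minus x * dir_deriv ?r coef_shape x + coef_shape x * ((N x - D') / 2)"
      using dir_deriv_rules(1)[OF dc(4) dm[OF dc(5) half(2)[folded curv_minus']], of ?r]
        dir_deriv_rules(3)[OF dc(5) half(2)[folded curv_minus'], of ?r] by (simp add: dcurv)
    also have "\<dots> = hess_xi x * hess_minus x - (hess_minus x)^2 - N x * (c - s x * curv_minus x)"
      unfolding speed riccati[OF x _ u, simplified] cgN using hess_eq_coef(2)[OF x, symmetric]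
      by (simp add: algebra_simps power2_eq_square)
    finally show ?thesis by (simp add: curv_minus_def)
  qed
  have row1: "hess_xi x * (49 * gap x^4 + 112 * s x * gap x^3 - 105 * (s x)^2 * gap x^2)
    = N x * (231 * gap x^3 - 105 * s x * gap x^2 + 75 * (s x)^2 * gap x + 75 * (s x)^3)
     + (343 / 32 * gap x^7 + 637 / 16 * s x * gap x^6 - 539 / 8 * (s x)^2 * gap x^5 - 5145 / 16 * (s x)^3 * gap x^4 - 4851 / 32 * (s x)^4 * gap x^3)"
    by (rule riccati_row[OF gap_sq[OF x] N0 rules(3) \<alpha>[OF x] d\<alpha> hess_plus'])
  have row2: "hess_xi x * (49 * gap x^4 - 112 * s x * gap x^3 - 105 * (s x)^2 * gap x^2)
    = N x * (- 231 * gap x^3 - 105 * s x * gap x^2 - 75 * (s x)^2 * gap x + 75 * (s x)^3)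
     + (- 343 / 32 * gap x^7 + 637 / 16 * s x * gap x^6 + 539 / 8 * (s x)^2 * gap x^5 - 5145 / 16 * (s x)^3 * gap x^4 + 4851 / 32 * (s x)^4 * gap x^3)"
  proof -
    have "7 * (- gap x)^2 = 32 * c - 5 * (s x)^2" "7 * (- gap x) * (- D') = - 5 * s x * N x"
      using gap_sq[OF x] rules(3) by simp_all
    moreover have "hess_minus x * (7 * (- gap x) * (3 * s x + (- gap x))) = - N x * (7 * (- gap x) - 5 * s x)"
      using \<beta>[OF x] by (simp add: algebra_simps)
    moreover have "dir_deriv ?r hess_minus x * (7 * (- gap x) * (3 * s x + (- gap x)))
        + hess_minus x * (7 * ((- D') * (3 * s x + (- gap x)) + (- gap x) * (3 * N x + (- D'))))
       = - (2 * hess_xi x * N x * (7 * (- gap x) - 5 * s x) + N x * (7 * (- D') - 5 * N x))"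
      using d\<beta> by (simp add: algebra_simps)
    moreover have "dir_deriv ?r hess_minus x = hess_xi x * hess_minus x - (hess_minus x)^2 - N x * (c - s x * ((s x + (- gap x)) / 2))"
      using hess_minus' by simp
    ultimately show ?thesis
      using riccati_row[of "- gap x" c "s x" "N x" "- D'" "hess_minus x" "dir_deriv ?r hess_minus x" "hess_xi x"] N0 by simp
  qed
  show "224 * s x * \<Delta> * hess_xi x = N x * (462 * \<Delta> + 150 * (s x)^2) + \<Delta> * (343 / 16 * \<Delta>^2 - 539 / 4 * (s x)^2 * \<Delta> - 4851 / 16 * (s x)^4)"
    "96 * N x * (- 539 * \<Delta>^2 + 420 * (s x)^2 * \<Delta> + 775 * (s x)^4)
      + 7 * \<Delta> * (- 343 * \<Delta>^3 + 5803 * (s x)^2 * \<Delta>^2 - 23289 * (s x)^4 * \<Delta> - 10395 * (s x)^6) = 0"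
    unfolding \<Delta>_def using gradient_norm_relation[OF D0 row1 row2] by simp_all
qed

text \<open>The equation between \<open>N\<close> and \<open>s\<close> is differentiated along \<open>\<xi>\<close>, where \<open>s\<close> has the derivative \<open>N\<close> and \<open>N\<close> the derivative
  \<open>2 hess_xi N\<close>; this is the third equation for the elimination.\<close>

lemma s_algebraic:
  assumes x: "x \<in> U"
  shows "s x = 0 \<or> (let E = (32 * c - 5 * (s x)^2) / 7 in
    96383 * E^4 - 630042 * (s x)^2 * E^3 + 996520 * (s x)^4 * E^2 + 11572050 * (s x)^6 * E + 8078625 * (s x)^8 = 0)"
proof -
  define e where "e z = (32 * c - 5 * z^2) / 7" for z :: real
  define \<tau> where "\<tau> z = - 539 * (e z)^2 + 420 * z^2 * e z + 775 * z^4" for z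
  define \<sigma> where "\<sigma> z = 7 * e z * (- 343 * (e z)^3 + 5803 * z^2 * (e z)^2 - 23289 * z^4 * e z - 10395 * z^6)" for z
  have sq: "(gap y)^2 = e (s y)" if "y \<in> U" for y using gap_sq[OF that] by (simp add: e_def)
  have "(gap x)^2 \<noteq> 0" using gap_pos[OF x] by simp
  then have e0: "e (s x) \<noteq> 0" unfolding sq[OF x] .
  \<comment> \<open>\<open>\<tau>\<close> and \<open>\<sigma>\<close> are functions of \<open>s\<close> alone, since \<open>gap\<^sup>2 = e(s)\<close>; their derivatives are expressed through \<open>e\<close> again.\<close>
  have de: "(e has_real_derivative - 10 / 7 * z) (at z)" for z
    unfolding e_def by (auto intro!: derivative_eq_intros)
  have d\<tau>: "(\<tau> has_real_derivative 2380 * z * e z + 2500 * z^3) (at z)" for z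
    unfolding \<tau>_def by (auto intro!: derivative_eq_intros de simp: field_simps eval_nat_numeral)
  have d\<sigma>: "(\<sigma> has_real_derivative 7 * (13566 * z * (e z)^3 - 118026 * z^3 * (e z)^2 + 4170 * z^5 * e z + 14850 * z^7)) (at z)" for z
    unfolding \<sigma>_def by (auto intro!: derivative_eq_intros de simp: field_simps eval_nat_numeral)
  note sd = smooth_on_differentiable[OF _ x]
  have chain: "((\<lambda>y. h (s y)) has_derivative (\<lambda>u. h' * ds u x)) (at x)"
    if "(h has_real_derivative h') (at (s x))" for h h'
    using has_derivative_compose[OF smooth_on_has_derivative[OF smooth_s x], of h "(*) h'"] that
    by (simp add: has_field_derivative_def)
  have rel: "96 * (N y * \<tau> (s y)) + \<sigma> (s y) = 0" if "y \<in> U" for y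
    using gradient_norm_equations(2)[OF that] unfolding sq[OF that] \<tau>_def \<sigma>_def by simp
  have "dir_deriv (\<xi> x) (\<lambda>y. 96 * (N y * \<tau> (s y)) + \<sigma> (s y)) x = dir_deriv (\<xi> x) (\<lambda>y. 0) x"
    by (rule dir_deriv_cong[OF open_U x rel])
  moreover have "dir_deriv (\<xi> x) (\<lambda>y. 96 * (N y * \<tau> (s y)) + \<sigma> (s y)) x =
      96 * (N x * ((2380 * s x * e (s x) + 2500 * s x^3) * N x) + 2 * hess_xi x * N x * \<tau> (s x))
      + 7 * (13566 * s x * (e (s x))^3 - 118026 * s x^3 * (e (s x))^2 + 4170 * s x^5 * e (s x) + 14850 * s x^7) * N x"
    by (rule dir_deriv_eqI[THEN trans], rule has_derivative_add[OF has_derivative_mult_right[OF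
            has_derivative_mult[OF smooth_on_has_derivative[OF smooth_N x] chain[OF d\<tau>]]] chain[OF d\<sigma>]])
      (simp add: derivative_rules_along_gradient(1,2)[OF x])
  ultimately have "N x * (192 * hess_xi x * \<tau> (s x) + 96 * N x * (2380 * s x * e (s x) + 2500 * s x^3)
      + 7 * (13566 * s x * (e (s x))^3 - 118026 * s x^3 * (e (s x))^2 + 4170 * s x^5 * e (s x) + 14850 * s x^7)) = 0"
    by (simp add: algebra_simps)
  then have T': "192 * hess_xi x * \<tau> (s x) + 96 * N x * (2380 * s x * e (s x) + 2500 * s x^3)
      + 7 * (13566 * s x * (e (s x))^3 - 118026 * s x^3 * (e (s x))^2 + 4170 * s x^5 * e (s x) + 14850 * s x^7) = 0"
    using N_pos[OF x] by simp
  show ?thesis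
    unfolding Let_def
    using elimination_polynomial[OF e0 gradient_norm_equations(1)[OF x, unfolded sq[OF x]] gradient_norm_equations(2)[OF x, unfolded sq[OF x]]
        T'[unfolded \<tau>_def]]
    by (simp add: e_def)
qed

text \<open>A continuous function with finitely many values on a ball is constant there, but the derivative of
  \<open>s\<close> along its gradient is \<open>N > 0\<close>.\<close>

lemma split_patch_empty: "U = {}"
proof (rule ccontr)
  assume "U \<noteq> {}"
  then obtain x where x: "x \<in> U" by blast
  then obtain r where r: "r > 0" "ball x r \<subseteq> U" using open_U open_contains_ball by blast
  have fin: "finite (s ` ball x r)"
    by (rule finite_subset[OF _ finite_elimination_roots[of c]]) (use s_algebraic r in auto)
  have "continuous_on (ball x r) s"
    using smooth_on_continuous_on[OF smooth_s] r continuous_on_subset by blast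
  then have "s constant_on ball x r"
    by (rule continuous_finite_range_constant[OF connected_ball _ fin])
  then obtain k where k: "\<And>y. y \<in> ball x r \<Longrightarrow> s y = k" by (auto simp: constant_on_def)
  have "ds (\<xi> x) x = dir_deriv (\<xi> x) (\<lambda>y. k) x"
    by (rule dir_deriv_cong[OF open_ball _ k]) (use r in auto)
  then show False using ds_xi[OF x] N_pos[OF x] by simp
qed

end

section \<open>The multiplicity of the principal curvature of the gradient\<close>

context biconservative_patch
begin

lemma xi_eigspace: "x \<in> U \<Longrightarrow> A x *v v = - s x *\<^sub>R v \<Longrightarrow> dim (eigspace (A x) (- s x)) = 1 \<Longrightarrow> \<exists>k. v = k *\<^sub>R \<xi> x"
proof -
  assume x: "x \<in> U" and v: "A x *v v = - s x *\<^sub>R v" and d: "dim (eigspace (A x) (- s x)) = 1"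
  have xi: "\<xi> x \<in> eigspace (A x) (- s x)" "v \<in> eigspace (A x) (- s x)"
    using xi_principal[OF x] v by (simp_all add: eigspace_def)
  have ind: "independent {\<xi> x}" using xi_nonzero[OF x] by simp
  have "eigspace (A x) (- s x) \<subseteq> span {\<xi> x}"
    by (rule card_ge_dim_independent[OF _ ind]) (use xi d in auto)
  then have "v \<in> span {\<xi> x}" using xi by blast
  then show ?thesis by (auto simp: span_singleton)
qed

text \<open>If \<open>-s\<close> is the simple eigenvalue, the other two have sum \<open>s\<close> and product \<open>curv_prod\<close>, and the quadratic identity
  holds; if \<open>-s\<close> is triple, the identity fails.  A point of the second kind would have a neighbourhood of
  such points, which \<open>double_principal_curvature_impossible\<close> excludes.  So the patch is a \<open>split_patch\<close>.\<close>

theorem relation_on_no_patch: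
  assumes m: "CARD('m) = 7"
    and hyp: "\<And>x. x \<in> U \<Longrightarrow> \<exists>a b d. a \<noteq> b \<and> a \<noteq> d \<and> b \<noteq> d \<and>
      (\<forall>e v. v \<noteq> 0 \<longrightarrow> A x *v v = e *\<^sub>R v \<longrightarrow> e \<in> {a, b, d}) \<and>
      dim (eigspace (A x) a) = 1 \<and> dim (eigspace (A x) b) = 3 \<and> dim (eigspace (A x) d) = 3 \<and>
      2 * s x = a + 3 * b + 3 * d \<and> 14 * (a^2 + 3 * b^2 + 3 * d^2) - 20 * (s x)^2 = 96 * c"
  shows "U = {}"
proof (rule ccontr)
  assume "U \<noteq> {}"
  have simple_case: "\<exists>b d. b \<noteq> d \<and> b \<noteq> - s x \<and> d \<noteq> - s x \<and> b + d = s x \<and> b * d = curv_prod x \<and>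
      (\<forall>v. \<exists>k u2 u3. v = k *\<^sub>R \<xi> x + u2 + u3 \<and> A x *v u2 = b *\<^sub>R u2 \<and> A x *v u3 = d *\<^sub>R u3) \<and>
      (\<exists>u. u \<noteq> 0 \<and> A x *v u = b *\<^sub>R u) \<and> (\<exists>u. u \<noteq> 0 \<and> A x *v u = d *\<^sub>R u)"
    if x: "x \<in> U" and a: "a = - s x" and ne: "a \<noteq> b" "a \<noteq> d" "b \<noteq> d"
      and dims: "dim (eigspace (A x) a) = 1" "dim (eigspace (A x) b) = 3" "dim (eigspace (A x) d) = 3"
      and tr: "2 * s x = a + 3 * b + 3 * d" and nrm: "14 * (a^2 + 3 * b^2 + 3 * d^2) - 20 * (s x)^2 = 96 * c"
    for x a b d
  proof (rule exI[of _ b], rule exI[of _ d], intro conjI allI)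
    show "b \<noteq> d" "b \<noteq> - s x" "d \<noteq> - s x" using ne a by auto
    show sum: "b + d = s x" using tr a by simp
    have sx: "s x = b + d" using sum by simp
    show "b * d = curv_prod x" using nrm unfolding a curv_prod_def sx by (simp add: field_simps power2_eq_square)
    show "\<exists>u. u \<noteq> 0 \<and> A x *v u = b *\<^sub>R u" "\<exists>u. u \<noteq> 0 \<and> A x *v u = d *\<^sub>R u"
      using dims by (auto intro: eigspace_nonzero)
    fix v
    obtain v1 v2 v3 where v: "v = v1 + v2 + v3" "A x *v v1 = a *\<^sub>R v1" "A x *v v2 = b *\<^sub>R v2" "A x *v v3 = d *\<^sub>R v3"
      using eigspace_decomposition(1)[OF ne, of "A x" v] dims m by auto
    then obtain k where "v1 = k *\<^sub>R \<xi> x" using xi_eigspace[OF x, of v1] dims(1) a by auto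
    with v show "\<exists>k u2 u3. v = k *\<^sub>R \<xi> x + u2 + u3 \<and> A x *v u2 = b *\<^sub>R u2 \<and> A x *v u3 = d *\<^sub>R u3" by blast
  qed
  have double_case: "\<not> quadratic_at x \<and> (\<exists>u. u \<noteq> 0 \<and> A x *v u = - s x *\<^sub>R u \<and> ds u x = 0)"
    if x: "x \<in> U" and dim: "dim (eigspace (A x) (- s x)) = 3" and ne: "a \<noteq> d" "a \<noteq> - s x" "d \<noteq> - s x"
      and dims: "dim (eigspace (A x) a) > 0" "dim (eigspace (A x) d) > 0" for x a d
  proof -
    have "linear (\<lambda>u. ds u x)"
      using dir_deriv_linear[OF smooth_on_differentiable[OF smooth_s x]] by (intro linearI) auto
    then obtain u where u: "u \<noteq> 0" "A x *v u = - s x *\<^sub>R u" "ds u x = 0"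
      using exists_kernel_vector[OF subspace_eigspace, of "A x" "- s x" "\<lambda>u. ds u x"] dim
      by (auto simp: eigspace_def)
    obtain v w where "v \<noteq> 0" "A x *v v = a *\<^sub>R v" "w \<noteq> 0" "A x *v w = d *\<^sub>R w"
      using eigspace_nonzero[OF dims(1)] eigspace_nonzero[OF dims(2)] by blast
    then show ?thesis using quadratic_at_not_double[OF x _ u] ne u by blast
  qed
  have cases: "(\<exists>b d. b \<noteq> d \<and> b \<noteq> - s x \<and> d \<noteq> - s x \<and> b + d = s x \<and> b * d = curv_prod x \<and>
      (\<forall>v. \<exists>k u2 u3. v = k *\<^sub>R \<xi> x + u2 + u3 \<and> A x *v u2 = b *\<^sub>R u2 \<and> A x *v u3 = d *\<^sub>R u3) \<and>
      (\<exists>u. u \<noteq> 0 \<and> A x *v u = b *\<^sub>R u) \<and> (\<exists>u. u \<noteq> 0 \<and> A x *v u = d *\<^sub>R u))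
    \<or> (\<not> quadratic_at x \<and> (\<exists>u. u \<noteq> 0 \<and> A x *v u = - s x *\<^sub>R u \<and> ds u x = 0))" (is "?A x \<or> ?B x")
    if x: "x \<in> U" for x
  proof -
    obtain a b d where ne: "a \<noteq> b" "a \<noteq> d" "b \<noteq> d"
      and ev: "\<And>e v. v \<noteq> 0 \<Longrightarrow> A x *v v = e *\<^sub>R v \<Longrightarrow> e \<in> {a, b, d}"
      and dims: "dim (eigspace (A x) a) = 1" "dim (eigspace (A x) b) = 3" "dim (eigspace (A x) d) = 3"
      and tr: "2 * s x = a + 3 * b + 3 * d" and nrm: "14 * (a^2 + 3 * b^2 + 3 * d^2) - 20 * (s x)^2 = 96 * c"
      using hyp[OF x] by metis
    have "- s x \<in> {a, b, d}" using ev[OF xi_nonzero[OF x] xi_principal[OF x]] .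
    then consider "a = - s x" | "b = - s x" | "d = - s x" by auto
    then show ?thesis
    proof cases
      case 1
      then show ?thesis using simple_case[OF x 1 ne dims tr nrm] by blast
    next
      case 2
      then have "?B x" using double_case[OF x, of a d] ne dims by auto
      then show ?thesis ..
    next
      case 3
      then have "?B x" using double_case[OF x, of a b] ne dims by auto
      then show ?thesis ..
    qed
  qed
  have A_quad: "quadratic_at x" if x: "x \<in> U" and a: "?A x" for x
  proof -
    obtain b d where bd: "b \<noteq> - s x" "d \<noteq> - s x" "b + d = s x" "b * d = curv_prod x"
      "\<And>v. \<exists>k u2 u3. v = k *\<^sub>R \<xi> x + u2 + u3 \<and> A x *v u2 = b *\<^sub>R u2 \<and> A x *v u3 = d *\<^sub>R u3"
      using a by blast
    have "b^2 - s x * b + curv_prod x = 0" "d^2 - s x * d + curv_prod x = 0"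
      unfolding bd(3,4)[symmetric] by (simp_all add: algebra_simps power2_eq_square)
    then show ?thesis using quadratic_at_of_eigenvalues[OF x _ _ bd(1,2,5)] by blast
  qed
  have "quadratic_at x" if x: "x \<in> U" for x
  proof (rule ccontr)
    assume "\<not> quadratic_at x"
    then obtain W where W: "open W" "x \<in> W" "W \<subseteq> U" "\<And>y. y \<in> W \<Longrightarrow> \<not> quadratic_at y"
      using open_not_quadratic_at[OF x] by blast
    show False
    proof (rule double_principal_curvature_impossible[OF W(1,3,2)])
      fix y assume y: "y \<in> W"
      then have "\<not> ?A y" using A_quad W by blast
      then show "\<exists>u. u \<noteq> 0 \<and> A y *v u = - s y *\<^sub>R u \<and> ds u y = 0"
        using cases[of y] y W(3) by blast
    qed
  qed
  then have all_A: "?A x" if "x \<in> U" for x using cases that by blast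
  define gap where "gap x = sqrt ((32 * c - 5 * (s x)^2) / 7)" for x
  define curv_plus where "curv_plus x = (s x + gap x) / 2" for x
  define curv_minus where "curv_minus x = (s x - gap x) / 2" for x
  have split: "(32 * c - 5 * (s x)^2) / 7 > 0 \<and> curv_plus x \<noteq> - s x \<and> curv_minus x \<noteq> - s x \<and>
     (\<forall>v. \<exists>k u2 u3. v = k *\<^sub>R \<xi> x + u2 + u3 \<and> A x *v u2 = curv_plus x *\<^sub>R u2 \<and> A x *v u3 = curv_minus x *\<^sub>R u3) \<and>
      (\<exists>u. u \<noteq> 0 \<and> A x *v u = curv_plus x *\<^sub>R u) \<and> (\<exists>u. u \<noteq> 0 \<and> A x *v u = curv_minus x *\<^sub>R u)"
    if x: "x \<in> U" for x
  proof -
    obtain b d where bd: "b \<noteq> d" "b \<noteq> - s x" "d \<noteq> - s x" "b + d = s x" "b * d = curv_prod x"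
      "\<And>v. \<exists>k u2 u3. v = k *\<^sub>R \<xi> x + u2 + u3 \<and> A x *v u2 = b *\<^sub>R u2 \<and> A x *v u3 = d *\<^sub>R u3"
      "\<exists>u. u \<noteq> 0 \<and> A x *v u = b *\<^sub>R u" "\<exists>u. u \<noteq> 0 \<and> A x *v u = d *\<^sub>R u"
      using all_A[OF x] by blast
    have "(32 * c - 5 * (s x)^2) / 7 = (s x)^2 - 4 * curv_prod x" by (simp add: curv_prod_def field_simps)
    also have "\<dots> = (b - d)^2" unfolding bd(4,5)[symmetric] by (simp add: power2_eq_square algebra_simps)
    finally have disc: "(32 * c - 5 * (s x)^2) / 7 = (b - d)^2" .
    then have gap: "gap x = \<bar>b - d\<bar>" by (simp add: gap_def)
    have pos: "(32 * c - 5 * (s x)^2) / 7 > 0" unfolding disc using bd(1) by simp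
    show ?thesis
    proof (cases "b > d")
      case True
      then have "curv_plus x = b" "curv_minus x = d" using bd(4) by (auto simp: curv_plus_def curv_minus_def gap)
      then show ?thesis using bd pos by auto
    next
      case False
      then have e: "curv_plus x = d" "curv_minus x = b" using bd(4) by (auto simp: curv_plus_def curv_minus_def gap)
      have "\<exists>k u2 u3. v = k *\<^sub>R \<xi> x + u2 + u3 \<and> A x *v u2 = d *\<^sub>R u2 \<and> A x *v u3 = b *\<^sub>R u3" for v
      proof -
        obtain k u2 u3 where "v = k *\<^sub>R \<xi> x + u2 + u3" "A x *v u2 = b *\<^sub>R u2" "A x *v u3 = d *\<^sub>R u3"
          using bd(6) by blast
        then show ?thesis by (intro exI[of _ k] exI[of _ u3] exI[of _ u2]) (simp add: add_ac)
      qed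
      then show ?thesis using bd pos unfolding e by blast
    qed
  qed
  interpret split_patch G V U F \<eta> c A s \<xi> gap curv_plus curv_minus
  proof unfold_locales
    show "gap x \<equiv> sqrt ((32 * c - 5 * (s x)^2) / 7)" "curv_plus x \<equiv> (s x + gap x) / 2" "curv_minus x \<equiv> (s x - gap x) / 2" for x
      by (simp_all add: gap_def curv_plus_def curv_minus_def)
    let ?gap = "\<lambda>x. sqrt ((32 * c - 5 * (s x)^2) / 7)"
    fix x assume x: "x \<in> U"
    note sp = split[OF x, unfolded curv_plus_def curv_minus_def gap_def]
    show "(32 * c - 5 * (s x)^2) / 7 > 0" "\<exists>u. u \<noteq> 0 \<and> A x *v u = ((s x + ?gap x) / 2) *\<^sub>R u"
      "\<exists>u. u \<noteq> 0 \<and> A x *v u = ((s x - ?gap x) / 2) *\<^sub>R u"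
      using sp by auto
    show "3 * s x + ?gap x \<noteq> 0" "3 * s x - ?gap x \<noteq> 0"
      using sp by auto
    show "\<exists>k u2 u3. v = k *\<^sub>R \<xi> x + u2 + u3 \<and> A x *v u2 = ((s x + ?gap x) / 2) *\<^sub>R u2 \<and> A x *v u3 = ((s x - ?gap x) / 2) *\<^sub>R u3" for v
      using sp by blast
  qed
  show False using split_patch_empty \<open>U \<noteq> {}\<close> by simp
qed

end

section \<open>Metrics and curvature in charts\<close>

lemma topological_chart_facts:
  assumes c: "topological_chart X c"
  shows open_chart_image: "openin X W \<Longrightarrow> W \<subseteq> chart_dom c \<Longrightarrow> open (chart_map c ` W)"
    and chart_inv_map: "p \<in> chart_dom c \<Longrightarrow> chart_inv c (chart_map c p) = p"
proof -
  have op: "openin X (chart_dom c)" "open (chart_map c ` chart_dom c)"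
    and h: "homeomorphic_map (subtopology X (chart_dom c)) (top_of_set (chart_map c ` chart_dom c)) (chart_map c)"
    using c by (auto simp: topological_chart_def)
  have ts: "topspace (subtopology X (chart_dom c)) = chart_dom c"
    using openin_subset[OF op(1)] by auto
  have inj: "inj_on (chart_map c) (chart_dom c)"
    using homeomorphic_imp_injective_map[OF h] unfolding ts .
  show "chart_inv c (chart_map c p) = p" if "p \<in> chart_dom c"
    unfolding chart_inv_def using inv_into_f_f[OF inj that] .
  assume W: "openin X W" "W \<subseteq> chart_dom c"
  then have "openin (subtopology X (chart_dom c)) W"
    by (simp add: openin_open_subtopology[OF op(1)])
  then have "openin (top_of_set (chart_map c ` chart_dom c)) (chart_map c ` W)"
    using homeomorphic_imp_open_map[OF h] by (simp add: open_map_def)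
  then show "open (chart_map c ` W)"
    using op(2) openin_open_trans by blast
qed

lemma riem_metric_subset: "riem_metric G V \<Longrightarrow> open W \<Longrightarrow> W \<subseteq> V \<Longrightarrow> riem_metric G W"
  unfolding riem_metric_def using smooth_on_subset by blast

lemma riem_metric_chart:
  assumes M: "connected_oriented_riemannian M" and c: "c \<in> atlas M"
  shows "riem_metric (metric M c) (chart_map c ` chart_dom c)"
proof
  show "open (chart_map c ` chart_dom c)"
    using M c by (auto simp: connected_oriented_riemannian_def oriented_manifold_def topological_chart_def)
  show "smooth_on (metric M c) (chart_map c ` chart_dom c)"
    using M c by (auto simp: connected_oriented_riemannian_def riemannian_metric_def)
  fix x assume "x \<in> chart_map c ` chart_dom c"
  then show "transpose (metric M c x) = metric M c x" "v \<noteq> 0 \<Longrightarrow> ip (metric M c x) v v > 0" for v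
    using M c unfolding connected_oriented_riemannian_def riemannian_metric_def ip_def by blast+
qed

lemma inner_at_eq_ip: "inner_at M c x u v = ip (metric M c x) u v"
  by (simp add: inner_at_def ip_def)

lemma christoffel_eq_levi_civita:
  assumes "riem_metric (metric M c) V" and x: "x \<in> V"
  shows "christoffel M c k i j x = levi_civita (metric M c) x (axis i 1) (axis j 1) $ k"
proof -
  interpret riem_metric "metric M c" V by fact
  have "(\<Sum>l\<in>UNIV. matrix_inv (metric M c x) $ k $ l * (1 / 2 * (dir_deriv (axis i 1) (metric M c) x $ j $ l
      + dir_deriv (axis j 1) (metric M c) x $ i $ l - dir_deriv (axis l 1) (metric M c) x $ i $ j)))
    = christoffel M c k i j x"
    unfolding christoffel_def partial_deriv_eq_dir_deriv dir_deriv_nth2[OF smooth_on_differentiable[OF smooth_G x]]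
    by (simp add: sum_distrib_left mult.left_commute)
  then show ?thesis
    by (simp add: levi_civita_def matrix_vector_mult_def ip_axis)
qed

lemma levi_civita_expand:
  assumes "riem_metric (metric M c) V" and x: "x \<in> V"
  shows "levi_civita (metric M c) x u v $ k = (\<Sum>i\<in>UNIV. \<Sum>j\<in>UNIV. christoffel M c k i j x * u $ i * v $ j)"
proof -
  interpret riem_metric "metric M c" V by fact
  have "levi_civita (metric M c) x u v = (\<Sum>i\<in>UNIV. \<Sum>j\<in>UNIV. (u $ i * v $ j) *\<^sub>R levi_civita (metric M c) x (axis i 1) (axis j 1))"
    by (rule bilinear_expand_axis[OF bilinear_levi_civita[OF x]])
  then show ?thesis
    by (simp add: christoffel_eq_levi_civita[OF assms] mult_ac)
qed

text \<open>Both sides are trilinear, so they are compared on coordinate vectors.\<close>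

lemma curvature_eq_riem_curv:
  assumes "riem_metric (metric M c) V" and x: "x \<in> V"
  shows "curvature M c x u v w = riem_curv (metric M c) x u v w"
proof -
  interpret riem_metric "metric M c" V by fact
  let ?R = "riem_curv (metric M c) x" and ?L = "levi_civita (metric M c)"
  have sc1: "?R (r *\<^sub>R u) v w = r *\<^sub>R ?R u v w" for r u v w
  proof -
    have "dir_deriv v (\<lambda>y. ?L y (r *\<^sub>R u) w) x = dir_deriv v (\<lambda>y. r *\<^sub>R ?L y u w) x"
      by (rule dir_deriv_cong[OF open_V x]) (simp add: levi_civita_linear)
    also have "\<dots> = r *\<^sub>R dir_deriv v (\<lambda>y. ?L y u w) x"
      by (rule dir_deriv_eqI[OF has_derivative_scaleR_right[OF has_derivative_dir_deriv[OF differentiable_levi_civita[OF x]]]])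
    finally show ?thesis
      by (simp add: riem_curv_def levi_civita_linear[OF x] dir_deriv_linear[OF differentiable_levi_civita[OF x]] algebra_simps)
  qed
  have sc2: "?R u (r *\<^sub>R v) w = r *\<^sub>R ?R u v w" for r u v w
    using sc1[of r v u w] riem_curv_anti[of x u "r *\<^sub>R v" w] riem_curv_anti[of x v u w] by simp
  have sc3: "?R u v (r *\<^sub>R w) = r *\<^sub>R ?R u v w" for r u v w
  proof -
    have "dir_deriv a (\<lambda>y. ?L y b (r *\<^sub>R w)) x = r *\<^sub>R dir_deriv a (\<lambda>y. ?L y b w) x" for a b
    proof -
      have "dir_deriv a (\<lambda>y. ?L y b (r *\<^sub>R w)) x = dir_deriv a (\<lambda>y. r *\<^sub>R ?L y b w) x"
        by (rule dir_deriv_cong[OF open_V x]) (simp add: levi_civita_linear)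
      also have "\<dots> = r *\<^sub>R dir_deriv a (\<lambda>y. ?L y b w) x"
        by (rule dir_deriv_eqI[OF has_derivative_scaleR_right[OF has_derivative_dir_deriv[OF differentiable_levi_civita[OF x]]]])
      finally show ?thesis .
    qed
    then show ?thesis
      by (simp add: riem_curv_def levi_civita_linear[OF x] algebra_simps)
  qed
  have lin: "linear (\<lambda>u. ?R u v w)" "linear (\<lambda>v. ?R u v w)" "linear (\<lambda>w. ?R u v w)" for u v w
    by (intro linearI; simp add: riem_curv_add[OF x] sc1 sc2 sc3)+
  have ex: "?R u v w = (\<Sum>i\<in>UNIV. \<Sum>j\<in>UNIV. \<Sum>k\<in>UNIV. (u $ i * v $ j * w $ k) *\<^sub>R ?R (axis i 1) (axis j 1) (axis k 1))"
  proof -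
    have "?R u v w = (\<Sum>i\<in>UNIV. (u $ i) *\<^sub>R ?R (axis i 1) v w)"
      by (rule linear_expand_axis[OF lin(1)])
    also have "\<dots> = (\<Sum>i\<in>UNIV. (u $ i) *\<^sub>R (\<Sum>j\<in>UNIV. (v $ j) *\<^sub>R ?R (axis i 1) (axis j 1) w))"
      by (subst linear_expand_axis[OF lin(2)]) simp
    also have "\<dots> = (\<Sum>i\<in>UNIV. (u $ i) *\<^sub>R (\<Sum>j\<in>UNIV. (v $ j) *\<^sub>R (\<Sum>k\<in>UNIV. (w $ k) *\<^sub>R ?R (axis i 1) (axis j 1) (axis k 1))))"
      by (subst linear_expand_axis[OF lin(3)]) simp
    finally show ?thesis by (simp add: scaleR_sum_right mult.assoc)
  qed
  have basis: "?R (axis i 1) (axis j 1) (axis k 1) $ l =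
     partial_deriv i (christoffel M c l j k) x - partial_deriv j (christoffel M c l i k) x
        + (\<Sum>s\<in>UNIV. christoffel M c l i s x * christoffel M c s j k x
                    - christoffel M c l j s x * christoffel M c s i k x)" for i j k l
  proof -
    have d: "dir_deriv a (\<lambda>y. ?L y (axis b 1) (axis k 1)) x $ l = dir_deriv a (christoffel M c l b k) x" for a b
    proof -
      have "dir_deriv a (\<lambda>y. ?L y (axis b 1) (axis k 1)) x $ l = dir_deriv a (\<lambda>y. ?L y (axis b 1) (axis k 1) $ l) x"
        by (rule dir_deriv_vec_nth[OF differentiable_levi_civita[OF x], symmetric])
      also have "\<dots> = dir_deriv a (christoffel M c l b k) x"
        by (rule dir_deriv_cong[OF open_V x]) (simp add: christoffel_eq_levi_civita[OF assms(1)])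
      finally show ?thesis .
    qed
    have q: "?L x (axis a 1) z $ l = (\<Sum>s\<in>UNIV. christoffel M c l a s x * z $ s)" for a z
    proof -
      have "linear (?L x (axis a 1))" using bilinear_levi_civita[OF x] by (simp add: bilinear_def)
      from linear_expand_axis[OF this, of z] show ?thesis
        by (simp add: christoffel_eq_levi_civita[OF assms] mult.commute)
    qed
    have q2: "?L x (axis a 1) (?L x (axis b 1) (axis k 1)) $ l
        = (\<Sum>s\<in>UNIV. christoffel M c l a s x * christoffel M c s b k x)" for a b
      unfolding q by (simp only: christoffel_eq_levi_civita[OF assms, of _ b k])
    show ?thesis
      by (simp only: riem_curv_def vector_add_component vector_minus_component d q2
          partial_deriv_eq_dir_deriv sum_subtractf add_diff_eq)
  qed
  show ?thesis
    by (subst ex) (simp add: vec_eq_iff curvature_def basis)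
qed

section \<open>The shape operator of an immersed hypersurface\<close>

lemma jacobian_mult: "F differentiable at x \<Longrightarrow> jacobian F x *v u = dir_deriv u F x"
  for F :: "real^'m::finite \<Rightarrow> real^'n::finite"
  unfolding jacobian_def dir_deriv_def
  using fun_cong[OF matrix_vector_mul(2)[OF linear_frechet_derivative]] by metis

lemma ip_congruence: "ip (transpose J ** G ** J) u v = ip G (J *v u) (J *v v)"
proof -
  have "ip (transpose J ** G ** J) u v = u \<bullet> (transpose J *v (G *v (J *v v)))"
    by (simp add: ip_def matrix_vector_mul_assoc matrix_mul_assoc)
  also have "\<dots> = (J *v u) \<bullet> (G *v (J *v v))"
    by (metis dot_lmul_matrix inner_commute transpose_matrix_vector)
  finally show ?thesis by (simp add: ip_def)
qed

locale immersed_hypersurface =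
  fixes M :: "('a, 'm::finite) riem_manifold" and N :: "('b, 'n::finite) riem_manifold"
    and \<phi> :: "'a \<Rightarrow> 'b" and \<eta> :: "('b, 'n) chart \<Rightarrow> 'a \<Rightarrow> real^'n" and c :: real
  assumes M: "connected_oriented_riemannian M" and N: "connected_oriented_riemannian N"
    and sectional: "constant_sectional_curvature N c" and isometric: "isometric_immersion M N \<phi>"
    and normal: "unit_normal_field M N \<phi> \<eta>" and codimension: "CARD('n) = Suc CARD('m)"
begin

lemma chart_M: "a \<in> atlas M \<Longrightarrow> topological_chart (mtop M) a"
  using M by (auto simp: connected_oriented_riemannian_def oriented_manifold_def)

lemma chart_N: "d \<in> atlas N \<Longrightarrow> topological_chart (mtop N) d"
  using N by (auto simp: connected_oriented_riemannian_def oriented_manifold_def)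

lemma open_chart_M: "a \<in> atlas M \<Longrightarrow> openin (mtop M) (chart_dom a)"
  using chart_M by (auto simp: topological_chart_def)

lemma open_chart_N: "d \<in> atlas N \<Longrightarrow> openin (mtop N) (chart_dom d)"
  using chart_N by (auto simp: topological_chart_def)

lemma charts_cover_M: "p \<in> topspace (mtop M) \<Longrightarrow> \<exists>a\<in>atlas M. p \<in> chart_dom a"
  using M unfolding connected_oriented_riemannian_def oriented_manifold_def by blast

lemma charts_cover_N: "p \<in> topspace (mtop N) \<Longrightarrow> \<exists>d\<in>atlas N. p \<in> chart_dom d"
  using N unfolding connected_oriented_riemannian_def oriented_manifold_def by blast

lemma chart_dom_M: "a \<in> atlas M \<Longrightarrow> p \<in> chart_dom a \<Longrightarrow> p \<in> topspace (mtop M)"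
  using open_chart_M openin_subset by blast

lemma phi_continuous: "continuous_map (mtop M) (mtop N) \<phi>"
  using isometric by (auto simp: isometric_immersion_def smooth_map_def)

lemma chart_around_image: "p \<in> topspace (mtop M) \<Longrightarrow> \<exists>d\<in>atlas N. \<phi> p \<in> chart_dom d"
  using charts_cover_N continuous_map_image_subset_topspace[OF phi_continuous] by blast

lemma open_preimage:
  assumes "openin (mtop M) W" "openin (mtop N) D"
  shows "openin (mtop M) {q \<in> W. \<phi> q \<in> D}"
proof -
  have "openin (mtop M) (W \<inter> {q \<in> topspace (mtop M). \<phi> q \<in> D})"
    using assms openin_continuous_map_preimage[OF phi_continuous] by blast
  moreover have "W \<inter> {q \<in> topspace (mtop M). \<phi> q \<in> D} = {q \<in> W. \<phi> q \<in> D}"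
    using openin_subset[OF assms(1)] by auto
  ultimately show ?thesis by simp
qed

abbreviation rep where "rep a d \<equiv> coord_rep a d \<phi>"
abbreviation nrm where "nrm a d \<equiv> \<eta> d \<circ> chart_inv a"

lemma inv_map: "a \<in> atlas M \<Longrightarrow> p \<in> chart_dom a \<Longrightarrow> chart_inv a (chart_map a p) = p"
  by (rule chart_inv_map[OF chart_M])

lemma inv_map_N: "d \<in> atlas N \<Longrightarrow> p \<in> chart_dom d \<Longrightarrow> chart_inv d (chart_map d p) = p"
  by (rule chart_inv_map[OF chart_N])

lemma rep_map: "a \<in> atlas M \<Longrightarrow> p \<in> chart_dom a \<Longrightarrow> rep a d (chart_map a p) = chart_map d (\<phi> p)"
  by (simp add: coord_rep_def inv_map)

lemma nrm_map: "a \<in> atlas M \<Longrightarrow> p \<in> chart_dom a \<Longrightarrow> nrm a d (chart_map a p) = \<eta> d p"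
  by (simp add: inv_map)

lemma differential_at_eq: "differential_at a d \<phi> p u = dir_deriv u (rep a d) (chart_map a p)"
  by (simp add: differential_at_def dir_deriv_def)

lemma patch:
  assumes a: "a \<in> atlas M" and d: "d \<in> atlas N"
    and W: "openin (mtop M) W" "W \<subseteq> {q \<in> chart_dom a. \<phi> q \<in> chart_dom d}"
  shows "immersed_patch (metric N d) (chart_map d ` chart_dom d) (chart_map a ` W) (rep a d) (nrm a d) c"
proof (intro immersed_patch.intro immersed_patch_axioms.intro riem_metric_chart[OF N d])
  interpret riem_metric "metric N d" "chart_map d ` chart_dom d" by (rule riem_metric_chart[OF N d])
  have sub: "chart_map a ` W \<subseteq> rep_dom a d \<phi>" using W by (auto simp: rep_dom_def)
  show "open (chart_map a ` W)" using open_chart_image[OF chart_M[OF a] W(1)] W(2) by blast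
  show "rep a d ` chart_map a ` W \<subseteq> chart_map d ` chart_dom d" using W(2) rep_map[OF a] by auto
  show "smooth_on (rep a d) (chart_map a ` W)"
    by (rule smooth_on_subset[OF _ sub])
      (use isometric a d in \<open>simp add: isometric_immersion_def smooth_map_def\<close>)
  show "smooth_on (nrm a d) (chart_map a ` W)"
    by (rule smooth_on_subset[OF _ sub])
      (use normal a d in \<open>simp add: unit_normal_field_def vector_field_along_def\<close>)
  show "CARD('n) = Suc CARD('m)" by (rule codimension)
  fix x assume "x \<in> chart_map a ` W"
  then obtain p where p: "x = chart_map a p" "p \<in> chart_dom a" "\<phi> p \<in> chart_dom d" using W(2) by auto
  have "inj (differential_at a d \<phi> p)" using isometric a d p by (auto simp: isometric_immersion_def)
  then show "inj (\<lambda>u. dir_deriv u (rep a d) x)" by (simp add: differential_at_eq[abs_def] p(1))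
  show "ip (metric N d (rep a d x)) (nrm a d x) (nrm a d x) = 1"
    "ip (metric N d (rep a d x)) (nrm a d x) (dir_deriv u (rep a d) x) = 0" for u
    using normal a d p unfolding p(1) rep_map[OF a p(2)] nrm_map[OF a p(2)]
    by (auto simp: unit_normal_field_def inner_at_eq_ip differential_at_eq)
next
  interpret riem_metric "metric N d" "chart_map d ` chart_dom d" by (rule riem_metric_chart[OF N d])
  fix y u v w assume y: "y \<in> chart_map d ` chart_dom d"
  show "riem_curv (metric N d) y u v w = (c * ip (metric N d y) v w) *\<^sub>R u - (c * ip (metric N d y) u w) *\<^sub>R v"
  proof (rule riem_curv_constant_sectional[OF y])
    fix u v :: "real^'n" assume "u \<noteq> v" "independent {u, v}"
    then have "sectional_curvature N d y u v = c"
      using sectional d y unfolding constant_sectional_curvature_def by blast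
    then show "ip (metric N d y) (riem_curv (metric N d) y u v v) u
        / (ip (metric N d y) u u * ip (metric N d y) v v - (ip (metric N d y) u v)\<^sup>2) = c"
      by (simp add: sectional_curvature_def inner_at_eq_ip curvature_eq_riem_curv[OF riem_metric_chart[OF N d] y])
  qed
qed

lemma chart_patch:
  assumes "a \<in> atlas M" "d \<in> atlas N"
  shows "immersed_patch (metric N d) (chart_map d ` chart_dom d)
    (chart_map a ` {q \<in> chart_dom a. \<phi> q \<in> chart_dom d}) (rep a d) (nrm a d) c"
  by (rule patch[OF assms open_preimage[OF open_chart_M[OF assms(1)] open_chart_N[OF assms(2)]]]) simp

lemma differentiable_rep:
  assumes "a \<in> atlas M" "d \<in> atlas N" "p \<in> chart_dom a" "\<phi> p \<in> chart_dom d"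
  shows "rep a d differentiable at (chart_map a p)" "nrm a d differentiable at (chart_map a p)"
proof -
  interpret immersed_patch "metric N d" "chart_map d ` chart_dom d"
    "chart_map a ` {q \<in> chart_dom a. \<phi> q \<in> chart_dom d}" "rep a d" "nrm a d" c
    by (rule chart_patch[OF assms(1,2)])
  have "chart_map a p \<in> chart_map a ` {q \<in> chart_dom a. \<phi> q \<in> chart_dom d}" using assms by auto
  then show "rep a d differentiable at (chart_map a p)" "nrm a d differentiable at (chart_map a p)"
    using smooth_on_differentiable smooth_F smooth_eta by blast+
qed

lemma covariant_deriv_along_eq_nabla:
  assumes a: "a \<in> atlas M" and d: "d \<in> atlas N" and p: "p \<in> chart_dom a" "\<phi> p \<in> chart_dom d"
  shows "covariant_deriv_along N \<phi> \<eta> a d p u = nabla (metric N d) (rep a d) u (nrm a d) (chart_map a p)"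
proof -
  have "chart_map d (\<phi> p) \<in> chart_map d ` chart_dom d" using p by auto
  from levi_civita_expand[OF riem_metric_chart[OF N d] this]
  have "(\<chi> k. \<Sum>i\<in>UNIV. \<Sum>j\<in>UNIV. christoffel N d k i j (chart_map d (\<phi> p)) * v $ i * w $ j)
      = levi_civita (metric N d) (chart_map d (\<phi> p)) v w" for v w
    by (simp add: vec_eq_iff)
  then show ?thesis
    unfolding covariant_deriv_along_def nabla_def rep_map[OF a p(1)] nrm_map[OF a p(1)] differential_at_eq
    by (simp add: dir_deriv_def)
qed

text \<open>The derivative of a transition map of the ambient manifold carries the differential of the immersion and
  the covariant derivative of the normal from one chart to the other.\<close>

lemma target_chart_change:
  assumes a: "a \<in> atlas M" and d: "d \<in> atlas N" and d': "d' \<in> atlas N"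
    and p: "p \<in> chart_dom a" "\<phi> p \<in> chart_dom d" "\<phi> p \<in> chart_dom d'"
  shows "differential_at a d' \<phi> p u
      = dir_deriv (differential_at a d \<phi> p u) (coord_rep d d' id) (chart_map d (\<phi> p))"
    and "covariant_deriv_along N \<phi> \<eta> a d' p u
      = dir_deriv (covariant_deriv_along N \<phi> \<eta> a d p u) (coord_rep d d' id) (chart_map d (\<phi> p))"
    and "coord_rep d d' id differentiable at (chart_map d (\<phi> p))"
proof -
  define F where "F = coord_rep d d' id"
  define V' where "V' = chart_map d ` (chart_dom d \<inter> chart_dom d')"
  define W where "W = {q \<in> chart_dom a. \<phi> q \<in> chart_dom d \<inter> chart_dom d'}"
  define U where "U = chart_map a ` W"
  define x where "x = chart_map a p"
  have oV: "openin (mtop N) (chart_dom d \<inter> chart_dom d')" using open_chart_N d d' by blast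
  have V': "open V'" "V' \<subseteq> chart_map d ` chart_dom d"
    unfolding V'_def using open_chart_image[OF chart_N[OF d] oV] by auto
  have W: "openin (mtop M) W" unfolding W_def by (rule open_preimage[OF open_chart_M[OF a] oV])
  have U: "open U" unfolding U_def
    by (rule open_chart_image[OF chart_M[OF a] W]) (auto simp: W_def)
  have xU: "x \<in> U" using p by (auto simp: U_def W_def x_def)
  have F: "smooth_on F V'" "\<And>y. y \<in> V' \<Longrightarrow> det (jacobian F y) > 0"
    using N d d' unfolding F_def V'_def connected_oriented_riemannian_def oriented_manifold_def by blast+
  have FV: "F ` V' \<subseteq> chart_map d' ` chart_dom d'"
    by (auto simp: F_def V'_def coord_rep_def inv_map_N[OF d])
  have dF: "F differentiable at y" if "y \<in> V'" for y by (rule smooth_on_differentiable[OF F(1) that])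
  have M': "riem_metric (metric N d) V'" by (rule riem_metric_subset[OF riem_metric_chart[OF N d] V'])
  have pull: "ip (metric N d y) u v = ip (metric N d' (F y)) (dir_deriv u F y) (dir_deriv v F y)"
    if y: "y \<in> V'" for y u v
  proof -
    have "metric N d y = transpose (jacobian F y) ** metric N d' (F y) ** jacobian F y"
      using N d d' y unfolding F_def V'_def connected_oriented_riemannian_def riemannian_metric_def by blast
    then show ?thesis by (simp add: ip_congruence jacobian_mult[OF dF[OF y]])
  qed
  have surj: "surj (\<lambda>u. dir_deriv u F y)" if y: "y \<in> V'" for y
  proof -
    have "invertible (jacobian F y)" using F(2)[OF y] invertible_det_nz[of "jacobian F y"] by simp
    then have "jacobian F y *v (matrix_inv (jacobian F y) *v w) = w" for w
      by (simp add: matrix_vector_mul_assoc matrix_inv_mult)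
    then show ?thesis unfolding jacobian_mult[OF dF[OF y]] by (metis surjI)
  qed
  have UV: "rep a d ` U \<subseteq> V'" unfolding U_def V'_def W_def using rep_map[OF a] by auto
  have repx: "rep a d x = chart_map d (\<phi> p)" unfolding x_def by (rule rep_map[OF a p(1)])
  note diff = differentiable_rep[OF a d p(1,2), folded x_def]
  have V'x: "rep a d x \<in> V'" using UV xU by auto
  have rep': "rep a d' y = F (rep a d y)" and nrm': "nrm a d' y = dir_deriv (nrm a d y) F (rep a d y)"
    if y: "y \<in> U" for y
  proof -
    obtain q where q: "y = chart_map a q" "q \<in> chart_dom a" "\<phi> q \<in> chart_dom d" "\<phi> q \<in> chart_dom d'"
      using y by (auto simp: U_def W_def)
    show "rep a d' y = F (rep a d y)"
      unfolding q(1) rep_map[OF a q(2)] by (simp add: F_def coord_rep_def inv_map_N[OF d q(3)])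
    have "\<eta> d' q = jacobian F (chart_map d (\<phi> q)) *v \<eta> d q"
      using normal chart_dom_M[OF a q(2)] d d' q
      unfolding unit_normal_field_def vector_field_along_def F_def by blast
    moreover have "chart_map d (\<phi> q) \<in> V'" using q by (auto simp: V'_def)
    ultimately show "nrm a d' y = dir_deriv (nrm a d y) F (rep a d y)"
      unfolding q(1) rep_map[OF a q(2)] nrm_map[OF a q(2)] by (simp add: jacobian_mult[OF dF])
  qed
  show "coord_rep d d' id differentiable at (chart_map d (\<phi> p))"
    using dF[OF V'x] by (simp add: repx F_def)
  have "dir_deriv u (rep a d') x = dir_deriv u (\<lambda>y. F (rep a d y)) x"
    by (rule dir_deriv_cong[OF U xU rep'])
  also have "\<dots> = dir_deriv (dir_deriv u (rep a d) x) F (rep a d x)"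
    by (rule dir_deriv_eqI[OF has_derivative_compose_dir_deriv[OF diff(1) dF[OF V'x]]])
  finally show "differential_at a d' \<phi> p u
      = dir_deriv (differential_at a d \<phi> p u) (coord_rep d d' id) (chart_map d (\<phi> p))"
    by (simp add: differential_at_eq x_def[symmetric] repx F_def)
  have "nabla (metric N d') (rep a d') u (nrm a d') x
      = nabla (metric N d') (\<lambda>y. F (rep a d y)) u (\<lambda>y. dir_deriv (nrm a d y) F (rep a d y)) x"
    by (rule nabla_cong_both[OF U xU rep' nrm'])
  also have "\<dots> = dir_deriv (nabla (metric N d) (rep a d) u (nrm a d) x) F (rep a d x)"
    by (rule nabla_pushforward[OF riem_metric_chart[OF N d'] M' F(1) FV pull U xU UV diff surj[OF V'x]])
  finally show "covariant_deriv_along N \<phi> \<eta> a d' p u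
      = dir_deriv (covariant_deriv_along N \<phi> \<eta> a d p u) (coord_rep d d' id) (chart_map d (\<phi> p))"
    by (simp add: covariant_deriv_along_eq_nabla[OF a d p(1,2)] covariant_deriv_along_eq_nabla[OF a d' p(1,3)]
        x_def[symmetric] repx F_def)
qed

abbreviation shape where "shape a p \<equiv> shape_operator M N \<phi> \<eta> a p"

lemma injective_differential:
  "a \<in> atlas M \<Longrightarrow> d \<in> atlas N \<Longrightarrow> p \<in> chart_dom a \<Longrightarrow> \<phi> p \<in> chart_dom d \<Longrightarrow> inj (differential_at a d \<phi> p)"
  using isometric by (auto simp: isometric_immersion_def)

text \<open>A matrix that solves the equation in one chart of the ambient manifold solves it in all of them, and it is unique
  because the differential is injective; so the definite description in \<open>shape_operator\<close> denotes it.\<close>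

lemma weingarten_formula:
  assumes a: "a \<in> atlas M" and p: "p \<in> chart_dom a" and d: "d \<in> atlas N" "\<phi> p \<in> chart_dom d"
  shows "differential_at a d \<phi> p (shape a p *v u) = - covariant_deriv_along N \<phi> \<eta> a d p u"
proof -
  let ?P = "\<lambda>B. \<forall>d\<in>atlas N. \<phi> p \<in> chart_dom d \<longrightarrow>
        (\<forall>u. differential_at a d \<phi> p (B *v u) = - covariant_deriv_along N \<phi> \<eta> a d p u)"
  interpret immersed_patch "metric N d" "chart_map d ` chart_dom d"
    "chart_map a ` {q \<in> chart_dom a. \<phi> q \<in> chart_dom d}" "rep a d" "nrm a d" c
    by (rule chart_patch[OF a d(1)])
  have "chart_map a p \<in> chart_map a ` {q \<in> chart_dom a. \<phi> q \<in> chart_dom d}" using p d by auto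
  from weingarten_map_exists[OF this] obtain B
    where B: "\<And>u. differential_at a d \<phi> p (B *v u) = - covariant_deriv_along N \<phi> \<eta> a d p u"
    unfolding S_def differential_at_eq covariant_deriv_along_eq_nabla[OF a d(1) p d(2)] by blast
  have "?P B"
  proof (intro ballI impI allI)
    fix d' u assume d': "d' \<in> atlas N" "\<phi> p \<in> chart_dom d'"
    show "differential_at a d' \<phi> p (B *v u) = - covariant_deriv_along N \<phi> \<eta> a d' p u"
      unfolding target_chart_change(1,2)[OF a d(1) d'(1) p d(2) d'(2)] B
      by (rule dir_deriv_linear(4)[OF target_chart_change(3)[OF a d(1) d'(1) p d(2) d'(2)]])
  qed
  moreover have "B' = B" if "?P B'" for B'
  proof -
    have "differential_at a d \<phi> p (B' *v u) = differential_at a d \<phi> p (B *v u)" for u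
      using that B d by simp
    then have "B' *v u = B *v u" for u
      using injective_differential[OF a d(1) p d(2)] by (meson injD)
    then show ?thesis by (simp add: matrix_eq)
  qed
  ultimately have "?P (THE B. ?P B)" by (rule theI)
  then show ?thesis using d unfolding shape_operator_def by blast
qed

text \<open>\<open>J\<close> is the Jacobian of the transition map.\<close>

lemma source_chart_change:
  assumes a: "a \<in> atlas M" and b: "b \<in> atlas M" and p: "p \<in> chart_dom a" "p \<in> chart_dom b"
  shows "\<exists>J. invertible J \<and> shape b p ** J = J ** shape a p"
proof -
  obtain d where d: "d \<in> atlas N" "\<phi> p \<in> chart_dom d" using chart_around_image[OF chart_dom_M[OF a p(1)]] by blast
  define \<tau> where "\<tau> = coord_rep a b id"
  define V where "V = chart_map a ` (chart_dom a \<inter> chart_dom b)"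
  define W where "W = {q \<in> chart_dom a \<inter> chart_dom b. \<phi> q \<in> chart_dom d}"
  define U where "U = chart_map a ` W"
  define x where "x = chart_map a p"
  have "openin (mtop M) W"
    unfolding W_def using open_preimage open_chart_M[OF a] open_chart_M[OF b] open_chart_N[OF d(1)] by blast
  then have U: "open U" unfolding U_def by (rule open_chart_image[OF chart_M[OF a]]) (auto simp: W_def)
  have xU: "x \<in> U" using p d by (auto simp: U_def W_def x_def)
  have xV: "x \<in> V" using p by (auto simp: V_def x_def)
  have \<tau>: "smooth_on \<tau> V" "det (jacobian \<tau> x) > 0"
    using M a b xV unfolding \<tau>_def V_def connected_oriented_riemannian_def oriented_manifold_def by blast+
  have d\<tau>: "\<tau> differentiable at x" by (rule smooth_on_differentiable[OF \<tau>(1) xV])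
  have \<tau>x: "\<tau> x = chart_map b p" by (simp add: \<tau>_def x_def coord_rep_def inv_map[OF a p(1)])
  have eq: "rep a d y = rep b d (\<tau> y)" "nrm a d y = nrm b d (\<tau> y)" if y: "y \<in> U" for y
  proof -
    obtain q where q: "y = chart_map a q" "q \<in> chart_dom a" "q \<in> chart_dom b"
      using y by (auto simp: U_def W_def)
    then show "rep a d y = rep b d (\<tau> y)" "nrm a d y = nrm b d (\<tau> y)"
      by (simp_all add: \<tau>_def coord_rep_def inv_map[OF a q(2)] inv_map[OF b q(3)])
  qed
  note diff = differentiable_rep[OF b d(1) p(2) d(2), folded \<tau>x]
  define J where "J = jacobian \<tau> x"
  have Ju: "J *v u = dir_deriv u \<tau> x" for u unfolding J_def by (rule jacobian_mult[OF d\<tau>])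
  have D: "differential_at a d \<phi> p u = differential_at b d \<phi> p (J *v u)" for u
  proof -
    have "dir_deriv u (rep a d) x = dir_deriv u (\<lambda>y. rep b d (\<tau> y)) x"
      by (rule dir_deriv_cong[OF U xU eq(1)])
    also have "\<dots> = dir_deriv (dir_deriv u \<tau> x) (rep b d) (\<tau> x)"
      by (rule dir_deriv_eqI[OF has_derivative_compose_dir_deriv[OF d\<tau> diff(1)]])
    finally show ?thesis by (simp add: differential_at_eq x_def[symmetric] \<tau>x Ju)
  qed
  have C: "covariant_deriv_along N \<phi> \<eta> a d p u = covariant_deriv_along N \<phi> \<eta> b d p (J *v u)" for u
  proof -
    have "nabla (metric N d) (rep a d) u (nrm a d) x
        = nabla (metric N d) (\<lambda>y. rep b d (\<tau> y)) u (\<lambda>y. nrm b d (\<tau> y)) x"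
      by (rule nabla_cong_both[OF U xU eq])
    also have "\<dots> = nabla (metric N d) (rep b d) (dir_deriv u \<tau> x) (nrm b d) (\<tau> x)"
      by (rule nabla_reparametrize[OF d\<tau> diff])
    finally show ?thesis
      by (simp add: covariant_deriv_along_eq_nabla[OF a d(1) p(1) d(2)]
          covariant_deriv_along_eq_nabla[OF b d(1) p(2) d(2)] x_def[symmetric] \<tau>x Ju)
  qed
  have "shape b p *v (J *v u) = J *v (shape a p *v u)" for u
  proof (rule injD[OF injective_differential[OF b d(1) p(2) d(2)]])
    show "differential_at b d \<phi> p (shape b p *v (J *v u)) = differential_at b d \<phi> p (J *v (shape a p *v u))"
      unfolding weingarten_formula[OF b p(2) d] C[symmetric] D[symmetric] weingarten_formula[OF a p(1) d] ..
  qed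
  then have "shape b p ** J = J ** shape a p"
    by (simp add: matrix_eq matrix_vector_mul_assoc[symmetric])
  moreover have "invertible J" using \<tau>(2) invertible_det_nz[of J] by (simp add: J_def)
  ultimately show ?thesis by blast
qed

lemma chart_at: "p \<in> topspace (mtop M) \<Longrightarrow> chart_at M p \<in> atlas M \<and> p \<in> chart_dom (chart_at M p)"
  unfolding chart_at_def using charts_cover_M someI_ex[of "\<lambda>c. c \<in> atlas M \<and> p \<in> chart_dom c"] by blast

lemma chart_independence:
  assumes a: "a \<in> atlas M" and p: "p \<in> chart_dom a"
  shows "mean_curvature M N \<phi> \<eta> p = trace (shape a p) / real CARD('m)"
    and "principal_curvatures M N \<phi> \<eta> p = {\<mu>. \<exists>v. v \<noteq> 0 \<and> shape a p *v v = \<mu> *\<^sub>R v}"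
    and "curvature_multiplicity M N \<phi> \<eta> p \<mu> = dim (eigspace (shape a p) \<mu>)"
proof -
  let ?b = "chart_at M p"
  have b: "?b \<in> atlas M" "p \<in> chart_dom ?b" using chart_at[OF chart_dom_M[OF a p]] by auto
  obtain J where J: "invertible J" "shape ?b p ** J = J ** shape a p"
    using source_chart_change[OF a b(1) p b(2)] by blast
  note Ji = matrix_inv_mult[OF J(1)]
  have "trace (shape ?b p) = trace ((shape ?b p ** J) ** matrix_inv J)"
    by (simp add: matrix_mul_assoc[symmetric] Ji)
  also have "\<dots> = trace (matrix_inv J ** (J ** shape a p))"
    unfolding J(2) by (rule trace_mul_sym)
  also have "\<dots> = trace (shape a p)" by (simp add: matrix_mul_assoc Ji)
  finally show "mean_curvature M N \<phi> \<eta> p = trace (shape a p) / real CARD('m)"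
    by (simp add: mean_curvature_def)
  have Jinv: "matrix_inv J *v (J *v v) = v" "J *v (matrix_inv J *v v) = v" for v
    by (simp_all add: matrix_vector_mul_assoc Ji)
  have sh: "shape ?b p *v (J *v v) = J *v (shape a p *v v)" for v
    using J(2) by (simp add: matrix_vector_mul_assoc)
  have eig: "eigspace (shape ?b p) \<mu> = (*v) J ` eigspace (shape a p) \<mu>" for \<mu>
  proof safe
    fix v assume v: "v \<in> eigspace (shape ?b p) \<mu>"
    let ?w = "matrix_inv J *v v"
    have "J *v (shape a p *v ?w) = J *v (\<mu> *\<^sub>R ?w)"
      using v sh[of ?w] by (simp add: Jinv eigspace_def matrix_vector_mult_scaleR)
    then have "shape a p *v ?w = \<mu> *\<^sub>R ?w" by (metis Jinv(1))
    then show "v \<in> (*v) J ` eigspace (shape a p) \<mu>"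
      by (intro image_eqI[of _ _ ?w]) (simp_all add: Jinv eigspace_def)
  next
    fix v assume "v \<in> eigspace (shape a p) \<mu>"
    then show "J *v v \<in> eigspace (shape ?b p) \<mu>" by (simp add: eigspace_def sh matrix_vector_mult_scaleR)
  qed
  have inj: "inj ((*v) J)" using Jinv(1) by (metis injI)
  have "curvature_multiplicity M N \<phi> \<eta> p \<mu> = dim (eigspace (shape ?b p) \<mu>)"
    by (simp add: curvature_multiplicity_def eigspace_def)
  also have "\<dots> = dim (eigspace (shape a p) \<mu>)"
    unfolding eig by (rule dim_image_eq[OF matrix_vector_mul_linear]) (use inj in \<open>auto intro: inj_on_subset\<close>)
  finally show "curvature_multiplicity M N \<phi> \<eta> p \<mu> = dim (eigspace (shape a p) \<mu>)" .
  have nz: "J *v v = 0 \<longleftrightarrow> v = 0" for v using Jinv(1)[of v] by auto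
  have "(\<exists>v. v \<noteq> 0 \<and> v \<in> eigspace (shape ?b p) \<mu>) \<longleftrightarrow> (\<exists>v. v \<noteq> 0 \<and> v \<in> eigspace (shape a p) \<mu>)" for \<mu>
    unfolding eig using nz by blast
  then show "principal_curvatures M N \<phi> \<eta> p = {\<mu>. \<exists>v. v \<noteq> 0 \<and> shape a p *v v = \<mu> *\<^sub>R v}"
    by (simp add: principal_curvatures_def eigspace_def)
qed

text \<open>In coordinates the shape operator is the inverse Gram matrix times the matrix of the second fundamental
  form, which makes the mean curvature and its gradient smooth.\<close>

lemma chart_coefficients:
  assumes a: "a \<in> atlas M" and d: "d \<in> atlas N" and W: "openin (mtop M) W" "W \<subseteq> {q \<in> chart_dom a. \<phi> q \<in> chart_dom d}"
  defines "U \<equiv> chart_map a ` W"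
  shows "hypersurface_patch (metric N d) (chart_map d ` chart_dom d) U (rep a d) (nrm a d) c
      (\<lambda>x. shape a (chart_inv a x))"
    and "smooth_on (mean_curvature M N \<phi> \<eta> \<circ> chart_inv a) U"
    and "smooth_on (\<lambda>x. gradient M a (mean_curvature M N \<phi> \<eta>) (chart_inv a x)) U"
    and "\<And>x u. x \<in> U \<Longrightarrow> ip (metric N d (rep a d x))
        (dir_deriv (gradient M a (mean_curvature M N \<phi> \<eta>) (chart_inv a x)) (rep a d) x) (dir_deriv u (rep a d) x)
      = dir_deriv u (mean_curvature M N \<phi> \<eta> \<circ> chart_inv a) x"
proof -
  interpret immersed_patch "metric N d" "chart_map d ` chart_dom d" U "rep a d" "nrm a d" c
    unfolding U_def by (rule patch[OF a d W])
  interpret m: riem_metric "metric M a" "chart_map a ` chart_dom a" by (rule riem_metric_chart[OF M a])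
  have pt: "\<exists>p. x = chart_map a p \<and> p \<in> W \<and> p \<in> chart_dom a \<and> \<phi> p \<in> chart_dom d \<and> chart_inv a x = p"
    if x: "x \<in> U" for x
    using x W(2) inv_map[OF a] unfolding U_def by auto
  have Ua: "U \<subseteq> chart_map a ` chart_dom a" using W(2) by (auto simp: U_def)
  have inv: "invertible (metric M a x)" if "x \<in> U" for x using m.invertible_G Ua that by blast
  show hp: "hypersurface_patch (metric N d) (chart_map d ` chart_dom d) U (rep a d) (nrm a d) c
      (\<lambda>x. shape a (chart_inv a x))"
  proof unfold_locales
    fix x u assume "x \<in> U"
    then obtain p where p: "x = chart_map a p" "p \<in> chart_dom a" "\<phi> p \<in> chart_dom d" "chart_inv a x = p"
      using pt by blast
    show "dir_deriv (shape a (chart_inv a x) *v u) (rep a d) x = - nabla (metric N d) (rep a d) u (nrm a d) x"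
      using weingarten_formula[OF a p(2) d p(3), of u]
      unfolding p(4) differential_at_eq covariant_deriv_along_eq_nabla[OF a d p(2,3)] p(1)[symmetric] .
  qed
  interpret hypersurface_patch "metric N d" "chart_map d ` chart_dom d" U "rep a d" "nrm a d" c
    "\<lambda>x. shape a (chart_inv a x)" by (rule hp)
  have iso: "ip (metric M a x) u v = g x (E u x) (E v x)" if x: "x \<in> U" for x u v
  proof -
    obtain p where p: "x = chart_map a p" "p \<in> chart_dom a" "\<phi> p \<in> chart_dom d" using pt[OF x] by blast
    then show ?thesis
      using isometric a d unfolding isometric_immersion_def inner_at_eq_ip differential_at_eq p(1) rep_map[OF a p(2)]
      by metis
  qed
  have sg: "smooth_on (metric M a) U" by (rule smooth_on_subset[OF m.smooth_G Ua])
  define B where "B x = (\<chi> i j. g x (E (axis i 1) x) (S (axis j 1) x))" for x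
  have sB: "smooth_on B U"
    by (rule smooth_on_componentwise[OF open_U], rule smooth_on_componentwise[OF open_U])
      (simp add: B_def smooth_g smooth_E smooth_S)
  have shape_eq: "shape a (chart_inv a x) = matrix_inv (metric M a x) ** B x" if x: "x \<in> U" for x
  proof -
    have "(metric M a x ** shape a (chart_inv a x)) $ i $ j = B x $ i $ j" for i j
    proof -
      have "(metric M a x ** shape a (chart_inv a x)) $ i $ j
          = ip (metric M a x) (axis i 1) (shape a (chart_inv a x) *v axis j 1)"
        unfolding ip_axis[symmetric] by (simp only: ip_def matrix_vector_mul_assoc)
      then show ?thesis by (simp add: iso[OF x] S_eq[OF x] B_def)
    qed
    then have "metric M a x ** shape a (chart_inv a x) = B x" by (simp add: vec_eq_iff)
    from arg_cong[OF this, of "\<lambda>X. matrix_inv (metric M a x) ** X"] show ?thesis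
      by (simp add: matrix_mul_assoc matrix_inv_mult[OF inv[OF x]])
  qed
  have minv: "smooth_on (\<lambda>x. matrix_inv (metric M a x)) U"
    by (rule smooth_on_matrix_inv[OF open_U sg inv])
  show sf: "smooth_on (mean_curvature M N \<phi> \<eta> \<circ> chart_inv a) U"
  proof (rule smooth_on_cong[OF open_U])
    show "(\<Sum>i\<in>UNIV. \<Sum>k\<in>UNIV. matrix_inv (metric M a x) $ i $ k * B x $ k $ i) * (1 / real CARD('m))
        = (mean_curvature M N \<phi> \<eta> \<circ> chart_inv a) x" if x: "x \<in> U" for x
      using pt[OF x] chart_independence(1)[OF a] shape_eq[OF x] by (auto simp: trace_def matrix_matrix_mult_def)
    show "smooth_on (\<lambda>x. (\<Sum>i\<in>UNIV. \<Sum>k\<in>UNIV. matrix_inv (metric M a x) $ i $ k * B x $ k $ i) * (1 / real CARD('m))) U"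
      by (intro smooth_on_mult smooth_on_const smooth_on_sum smooth_on_vec_nth open_U sB minv)
  qed
  define f where "f = mean_curvature M N \<phi> \<eta> \<circ> chart_inv a"
  have grad: "gradient M a (mean_curvature M N \<phi> \<eta>) (chart_inv a x)
      = matrix_inv (metric M a x) *v (\<chi> i. dir_deriv (axis i 1) f x)" if x: "x \<in> U" for x
  proof -
    have "chart_map a (chart_inv a x) = x" using pt[OF x] by auto
    then show ?thesis by (simp add: gradient_def partial_deriv_eq_dir_deriv f_def)
  qed
  show "smooth_on (\<lambda>x. gradient M a (mean_curvature M N \<phi> \<eta>) (chart_inv a x)) U"
  proof (rule smooth_on_cong[OF open_U])
    show "matrix_inv (metric M a x) *v (\<chi> i. dir_deriv (axis i 1) f x)
        = gradient M a (mean_curvature M N \<phi> \<eta>) (chart_inv a x)" if "x \<in> U" for x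
      using grad[OF that] by simp
    have "smooth_on (\<lambda>x. \<chi> i. dir_deriv (axis i 1) f x) U"
      by (rule smooth_on_componentwise[OF open_U])
        (simp add: smooth_on_dir_deriv[OF open_U sf[folded f_def]])
    then show "smooth_on (\<lambda>x. matrix_inv (metric M a x) *v (\<chi> i. dir_deriv (axis i 1) f x)) U"
      by (rule smooth_on_bilinear[OF bounded_bilinear_matrix_vector_mult open_U minv])
  qed
  show "ip (metric N d (rep a d x))
        (dir_deriv (gradient M a (mean_curvature M N \<phi> \<eta>) (chart_inv a x)) (rep a d) x) (dir_deriv u (rep a d) x)
      = dir_deriv u (mean_curvature M N \<phi> \<eta> \<circ> chart_inv a) x" if x: "x \<in> U" for x u
  proof -
    have xa: "x \<in> chart_map a ` chart_dom a" using Ua x by blast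
    let ?G = "gradient M a (mean_curvature M N \<phi> \<eta>) (chart_inv a x)"
    have "g x (E ?G x) (E u x) = ip (metric M a x) u ?G"
      unfolding iso[OF x, symmetric] by (rule m.ip_commute[OF xa])
    also have "\<dots> = u \<bullet> (\<chi> i. dir_deriv (axis i 1) f x)"
      unfolding grad[OF x] ip_def by (simp add: matrix_vector_mul_assoc matrix_inv_mult[OF inv[OF x]])
    also have "\<dots> = dir_deriv u f x"
      using dir_deriv_field_expand[OF sf[folded f_def] x, of u] by (simp add: inner_vec_def)
    finally show ?thesis by (simp add: f_def)
  qed
qed

end

section \<open>The impossible relation\<close>

theorem lemma4p10:
  fixes M :: "('a, 7) riem_manifold" and N :: "('b, 8) riem_manifold"
    and \<phi> :: "'a \<Rightarrow> 'b" and \<eta> :: "('b, 8) chart \<Rightarrow> 'a \<Rightarrow> real^8"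
    and c :: real and W :: "'a set"
  assumes "connected_oriented_riemannian M"
    and "connected_oriented_riemannian N"
    and "constant_sectional_curvature N c"
    and "isometric_immersion M N \<phi>"
    and "unit_normal_field M N \<phi> \<eta>"
    and "biconservative M N \<phi> \<eta>"
    and "\<forall>p\<in>topspace (mtop M). \<exists>\<mu>1 \<mu>2 \<mu>3.
           distinct [\<mu>1, \<mu>2, \<mu>3] \<and> principal_curvatures M N \<phi> \<eta> p = {\<mu>1, \<mu>2, \<mu>3} \<and>
           curvature_multiplicity M N \<phi> \<eta> p \<mu>1 = 1 \<and>
           curvature_multiplicity M N \<phi> \<eta> p \<mu>2 = 3 \<and>
           curvature_multiplicity M N \<phi> \<eta> p \<mu>3 = 3"
    and "\<forall>a\<in>atlas M. \<forall>p\<in>chart_dom a. gradient M a (mean_curvature M N \<phi> \<eta>) p \<noteq> 0"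
    and "openin (mtop M) W" and "W \<noteq> {}"
  shows "\<not> (\<forall>p\<in>W. 14 * shape_norm_sq M N \<phi> \<eta> p - 245 * (mean_curvature M N \<phi> \<eta> p)\<^sup>2 - 96 * c = 0)"
proof
  assume rel: "\<forall>p\<in>W. 14 * shape_norm_sq M N \<phi> \<eta> p - 245 * (mean_curvature M N \<phi> \<eta> p)\<^sup>2 - 96 * c = 0"
  interpret immersed_hypersurface M N \<phi> \<eta> c
    by unfold_locales (use assms(1-5) in simp_all)
  obtain p0 where p0: "p0 \<in> W" using assms(10) by blast
  then have "p0 \<in> topspace (mtop M)" using openin_subset[OF assms(9)] by blast
  then obtain a d where a: "a \<in> atlas M" "p0 \<in> chart_dom a" and d: "d \<in> atlas N" "\<phi> p0 \<in> chart_dom d"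
    using charts_cover_M chart_around_image by blast
  define W' where "W' = {q \<in> W \<inter> chart_dom a. \<phi> q \<in> chart_dom d}"
  have W': "openin (mtop M) W'" "W' \<subseteq> {q \<in> chart_dom a. \<phi> q \<in> chart_dom d}"
    using open_preimage[OF openin_Int[OF assms(9) open_chart_M[OF a(1)]] open_chart_N[OF d(1)]]
    by (auto simp: W'_def)
  define f where "f = mean_curvature M N \<phi> \<eta>"
  define U where "U = chart_map a ` W'"
  define s where "s x = 7 / 2 * f (chart_inv a x)" for x
  \<comment> \<open>\<open>\<xi>\<close> is the gradient of \<open>s\<close>.\<close>
  define \<xi> where "\<xi> x = (7 / 2 :: real) *\<^sub>R gradient M a f (chart_inv a x)" for x
  note cc = chart_coefficients[OF a(1) d(1) W', folded U_def f_def]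
  interpret hypersurface_patch "metric N d" "chart_map d ` chart_dom d" U "rep a d" "nrm a d" c
    "\<lambda>x. shape a (chart_inv a x)" by (rule cc(1))
  have pt: "\<exists>p. x = chart_map a p \<and> p \<in> W \<and> p \<in> chart_dom a \<and> chart_inv a x = p" if "x \<in> U" for x
    using that inv_map[OF a(1)] by (auto simp: U_def W'_def)
  interpret biconservative_patch "metric N d" "chart_map d ` chart_dom d" U "rep a d" "nrm a d" c
    "\<lambda>x. shape a (chart_inv a x)" s \<xi>
  proof unfold_locales
    show "smooth_on s U"
      unfolding s_def using smooth_on_mult[OF open_U smooth_on_const cc(2), of "7 / 2"] by (simp add: o_def)
    show "smooth_on \<xi> U"
      unfolding \<xi>_def by (intro smooth_on_scaleR[OF open_U smooth_on_const cc(3)])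
    fix x assume x: "x \<in> U"
    then obtain p where p: "p \<in> chart_dom a" "chart_inv a x = p" using pt by blast
    have "dir_deriv u s x = 7 / 2 * dir_deriv u (f \<circ> chart_inv a) x" for u
      unfolding s_def by (rule dir_deriv_eqI[OF has_derivative_mult_right[OF
          smooth_on_has_derivative[OF cc(2) x, unfolded o_def]], folded o_def])
    then show "g x (E (\<xi> x) x) (E u x) = dir_deriv u s x" for u
      using cc(4)[OF x, of u] by (simp add: \<xi>_def E_linear[OF x])
    have "2 *\<^sub>R (shape a p *v gradient M a f p) + (7 * f p) *\<^sub>R gradient M a f p = 0"
      using assms(6) a p unfolding biconservative_def f_def by auto
    then have "2 *\<^sub>R (shape a p *v gradient M a f p) = 2 *\<^sub>R ((- (7 / 2) * f p) *\<^sub>R gradient M a f p)"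
      by (simp add: eq_neg_iff_add_eq_0)
    then have "shape a p *v gradient M a f p = (- (7 / 2) * f p) *\<^sub>R gradient M a f p"
      by (simp only: scaleR_cancel_left) simp
    then show "shape a (chart_inv a x) *v \<xi> x = - s x *\<^sub>R \<xi> x"
      by (simp add: \<xi>_def s_def p(2) matrix_vector_mult_scaleR)
    show "\<xi> x \<noteq> 0" using assms(8) a p by (simp add: \<xi>_def f_def)
  qed
  have "U = {}"
  proof (rule relation_on_no_patch)
    fix x assume "x \<in> U"
    then obtain p where p: "p \<in> W" "p \<in> chart_dom a" "chart_inv a x = p" using pt by blast
    note ci = chart_independence[OF a(1) p(2)]
    obtain \<mu>1 \<mu>2 \<mu>3 where mu: "\<mu>1 \<noteq> \<mu>2" "\<mu>1 \<noteq> \<mu>3" "\<mu>2 \<noteq> \<mu>3" "principal_curvatures M N \<phi> \<eta> p = {\<mu>1, \<mu>2, \<mu>3}"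
      "curvature_multiplicity M N \<phi> \<eta> p \<mu>1 = 1" "curvature_multiplicity M N \<phi> \<eta> p \<mu>2 = 3"
      "curvature_multiplicity M N \<phi> \<eta> p \<mu>3 = 3"
      using assms(7) chart_dom_M[OF a(1) p(2)] by fastforce
    have dims: "dim (eigspace (shape a p) \<mu>1) = 1" "dim (eigspace (shape a p) \<mu>2) = 3" "dim (eigspace (shape a p) \<mu>3) = 3"
      using mu(5-7) unfolding ci(3) .
    have "trace (shape a p) = \<mu>1 + 3 * \<mu>2 + 3 * \<mu>3"
      using eigspace_decomposition(2)[OF mu(1-3), of "shape a p"] dims by simp
    then have tr: "2 * s x = \<mu>1 + 3 * \<mu>2 + 3 * \<mu>3"
      using ci(1) by (simp add: s_def f_def p(3))
    have "shape_norm_sq M N \<phi> \<eta> p = \<mu>1^2 + 3 * \<mu>2^2 + 3 * \<mu>3^2"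
      unfolding shape_norm_sq_def mu(4) using mu(1-3,5-7) by simp
    moreover have "(f p)^2 = 4 / 49 * (s x)^2" by (simp add: s_def p(3) power2_eq_square)
    moreover have "14 * shape_norm_sq M N \<phi> \<eta> p - 245 * (f p)\<^sup>2 - 96 * c = 0" using rel p(1) by (simp add: f_def)
    ultimately have nrm: "14 * (\<mu>1^2 + 3 * \<mu>2^2 + 3 * \<mu>3^2) - 20 * (s x)^2 = 96 * c"
      by simp
    have ev: "\<forall>e v. v \<noteq> 0 \<longrightarrow> shape a p *v v = e *\<^sub>R v \<longrightarrow> e \<in> {\<mu>1, \<mu>2, \<mu>3}"
      using mu(4) unfolding ci(2) by blast
    show "\<exists>a' b d. a' \<noteq> b \<and> a' \<noteq> d \<and> b \<noteq> d \<and>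
      (\<forall>e v. v \<noteq> 0 \<longrightarrow> shape a (chart_inv a x) *v v = e *\<^sub>R v \<longrightarrow> e \<in> {a', b, d}) \<and>
      dim (eigspace (shape a (chart_inv a x)) a') = 1 \<and> dim (eigspace (shape a (chart_inv a x)) b) = 3 \<and>
      dim (eigspace (shape a (chart_inv a x)) d) = 3 \<and>
      2 * s x = a' + 3 * b + 3 * d \<and> 14 * (a'^2 + 3 * b^2 + 3 * d^2) - 20 * (s x)^2 = 96 * c"
      unfolding p(3) using mu(1-3) ev dims tr nrm by blast
  qed simp
  moreover have "p0 \<in> W'" using p0 a d by (simp add: W'_def)
  ultimately show False by (simp add: U_def)
qed

end
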